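(* Let $t$ be a nonnegative integer. (i) $\Lambda_I^t(M_0)$ is a sheaf of normal subgroups of $\Lambda_I(M_0)$. (ii) The map $f\mapsto 1+f$ induces an isomorphism of sheaves of groups $$\lambda_I^{(t)}(M_0)\simeq\frac{\Lambda_I^t(M_0)}{\Lambda_I^{t+1}(M_0)}.$$
   Context: Fix $q\in\mathbf{C}$ with $|q|>1$; $\sigma_q f(z)=f(qz)$, applied entrywise; $\mathbf{E}_q=\mathbf{C}^*/q^{\mathbf{Z}}$. Fix integers $\mu_1>\cdots>\mu_k$, $r_i\ge1$, $A_i\in GL_{r_i}(\mathbf{C})$, $n=\sum r_i$; $A_0$ is the block diagonal matrix with blocks $z^{-\mu_i}A_i$ and $M_0$ the corresponding $q$-difference module. $F[A]=(\sigma_qF)AF^{-1}$. A sector is a germ at $0$ of a $q^{-\mathbf{N}}$-invariant open subset $W\subset\mathbf{C}^*$; its horizon is its image in $\mathbf{E}_q$. A function $f$ holomorphic on $W$ is flat if for every $m\in\mathbf{N}$, $z^{-m}f$ is bounded on $q^{-\mathbf{N}}K$ for every compact $K\subset W$. It is $t$-flat if $f|\theta|^t$ has polynomial growth near $0$ on $q^{-\mathbf{N}}K$ for every compact $K\subset W$ (i.e. is $O(|z|^{-N})$ for some $N$), for one (hence any) $\theta=\theta_{q,c}$, where $\theta_{q,c}(z)=\sum_{m\in\mathbf{Z}}q^{-m(m+1)/2}(z/c)^m$. $\mathcal{A}_0$ is the sheaf on $\mathbf{E}_q$ whose sections over $V$ are (classes, under restriction to smaller sectors with the same horizon, of) flat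 functions on sectors with horizon $V$. $\lambda_I(M_0)$ is the sheaf on $\mathbf{E}_q$ whose sections over $V$ are the block strictly upper triangular matrices $f=(f_{i,j})$ (blocks $f_{i,j}$ of size $r_i\times r_j$, zero unless $i<j$) with entries in $\mathcal{A}_0(V)$ and $(\sigma_qf)A_0=A_0f$. The Stokes sheaf is the sheaf of groups (under multiplication) $\Lambda_I(M_0)=I_n+\lambda_I(M_0)$, i.e. its sections $F$ satisfy $F[A_0]=A_0$. $\lambda_I^t(M_0)\subset\lambda_I(M_0)$ is the subsheaf of sections with $t$-flat entries and $\Lambda_I^t(M_0)=I_n+\lambda_I^t(M_0)$. $\lambda_I^{(t)}(M_0)\subset\lambda_I(M_0)$ is the subsheaf (of additive groups) of those $f$ whose blocks $f_{i,j}$ vanish unless $\mu_i-\mu_j=t$. *)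

theory Defs
  imports
    "HOL-Complex_Analysis.Complex_Analysis"
    "HOL-Library.Landau_Symbols"
    "HOL-Algebra.Coset"
    "Jordan_Normal_Form.Matrix"
begin

section \<open>Sheaves of groups on a topological space\<close>

text \<open>\<open>sec P U\<close> is the group of sections over \<open>U\<close> and \<open>res P U V\<close> is the restriction from
  \<open>U\<close> to \<open>V \<subseteq> U\<close>. Only values at open sets matter.\<close>

record ('x, 'a) group_presheaf =
  sec :: "'x set \<Rightarrow> 'a monoid"
  res :: "'x set \<Rightarrow> 'x set \<Rightarrow> 'a \<Rightarrow> 'a"

locale presheaf_of_groups =
  fixes X :: "'x topology" and P :: "('x, 'a) group_presheaf"
  assumes group_sec: "openin X U \<Longrightarrow> group (sec P U)"
    and res_hom: "openin X U \<Longrightarrow> openin X V \<Longrightarrow> V \<subseteq> U \<Longrightarrow> res P U V \<in> hom (sec P U) (sec P V)"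
    and res_id: "openin X U \<Longrightarrow> s \<in> carrier (sec P U) \<Longrightarrow> res P U U s = s"
    and res_res: "openin X U \<Longrightarrow> openin X V \<Longrightarrow> openin X W \<Longrightarrow> W \<subseteq> V \<Longrightarrow> V \<subseteq> U \<Longrightarrow>
      s \<in> carrier (sec P U) \<Longrightarrow> res P V W (res P U V s) = res P U W s"

locale sheaf_of_groups = presheaf_of_groups +
  assumes ex1_glue:
    "(\<And>U. U \<in> \<U> \<Longrightarrow> openin X U) \<Longrightarrow>
     (\<And>U. U \<in> \<U> \<Longrightarrow> s U \<in> carrier (sec P U)) \<Longrightarrow>
     (\<And>U V. U \<in> \<U> \<Longrightarrow> V \<in> \<U> \<Longrightarrow> res P U (U \<inter> V) (s U) = res P V (U \<inter> V) (s V)) \<Longrightarrow>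
     \<exists>!s'. s' \<in> carrier (sec P (\<Union>\<U>)) \<and> (\<forall>U\<in>\<U>. res P (\<Union>\<U>) U s' = s U)"

definition sheaf_of_normal_subgroups ::
  "'x topology \<Rightarrow> ('x, 'a) group_presheaf \<Rightarrow> ('x, 'a) group_presheaf \<Rightarrow> bool" where
  "sheaf_of_normal_subgroups X H G \<longleftrightarrow>
     sheaf_of_groups X H \<and> sheaf_of_groups X G \<and>
     (\<forall>U. openin X U \<longrightarrow>
        carrier (sec H U) \<lhd> sec G U \<and>
        sec H U = (sec G U)\<lparr>carrier := carrier (sec H U)\<rparr>) \<and>
     (\<forall>U V. openin X U \<longrightarrow> openin X V \<longrightarrow> V \<subseteq> U \<longrightarrow>
        (\<forall>s\<in>carrier (sec H U). res H U V s = res G U V s))"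

definition iso_of_group_sheaves ::
  "'x topology \<Rightarrow> ('x, 'a) group_presheaf \<Rightarrow> ('x, 'b) group_presheaf \<Rightarrow> ('x set \<Rightarrow> 'a \<Rightarrow> 'b) \<Rightarrow> bool"
  where
  "iso_of_group_sheaves X P Q \<phi> \<longleftrightarrow>
     sheaf_of_groups X P \<and> sheaf_of_groups X Q \<and>
     (\<forall>U. openin X U \<longrightarrow> \<phi> U \<in> iso (sec P U) (sec Q U)) \<and>
     (\<forall>U V. openin X U \<longrightarrow> openin X V \<longrightarrow> V \<subseteq> U \<longrightarrow>
        (\<forall>s\<in>carrier (sec P U). res Q U V (\<phi> U s) = \<phi> V (res P U V s)))"

subsection \<open>Associated sheaf\<close>

definition stalk_germ ::
  "'x topology \<Rightarrow> ('x, 'a) group_presheaf \<Rightarrow> 'x \<Rightarrow> 'x set \<Rightarrow> 'a \<Rightarrow> ('x set \<times> 'a) set" where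
  "stalk_germ X P x U a =
     {(V, b). openin X V \<and> x \<in> V \<and> b \<in> carrier (sec P V) \<and>
        (\<exists>W. openin X W \<and> x \<in> W \<and> W \<subseteq> U \<inter> V \<and> res P U W a = res P V W b)}"

definition stalk_mult ::
  "'x topology \<Rightarrow> ('x, 'a) group_presheaf \<Rightarrow> 'x \<Rightarrow>
   ('x set \<times> 'a) set \<Rightarrow> ('x set \<times> 'a) set \<Rightarrow> ('x set \<times> 'a) set" where
  "stalk_mult X P x g h =
     (\<Union>(U, a)\<in>g. \<Union>(V, b)\<in>h.
        stalk_germ X P x (U \<inter> V) (res P U (U \<inter> V) a \<otimes>\<^bsub>sec P (U \<inter> V)\<^esub> res P V (U \<inter> V) b))"

text \<open>The unit of the adjunction: a section is sent to its family of germs.\<close>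

definition sheafify_unit ::
  "'x topology \<Rightarrow> ('x, 'a) group_presheaf \<Rightarrow> 'x set \<Rightarrow> 'a \<Rightarrow> 'x \<Rightarrow> ('x set \<times> 'a) set" where
  "sheafify_unit X P U a = (\<lambda>x\<in>U. stalk_germ X P x U a)"

definition sheafify ::
  "'x topology \<Rightarrow> ('x, 'a) group_presheaf \<Rightarrow> ('x, 'x \<Rightarrow> ('x set \<times> 'a) set) group_presheaf" where
  "sheafify X P =
     \<lparr>sec = (\<lambda>U.
        \<lparr>carrier = {s \<in> extensional U. \<forall>x\<in>U. \<exists>V a. openin X V \<and> x \<in> V \<and> V \<subseteq> U \<and>
            a \<in> carrier (sec P V) \<and> restrict s V = sheafify_unit X P V a},
         mult = (\<lambda>s s'. \<lambda>x\<in>U. stalk_mult X P x (s x) (s' x)),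
         one = sheafify_unit X P U \<one>\<^bsub>sec P U\<^esub>\<rparr>),
      res = (\<lambda>U V s. restrict s V)\<rparr>"

subsection \<open>Quotient sheaf\<close>

definition quotient_presheaf ::
  "('x, 'a) group_presheaf \<Rightarrow> ('x, 'a) group_presheaf \<Rightarrow> ('x, 'a set) group_presheaf" where
  "quotient_presheaf G H =
     \<lparr>sec = (\<lambda>U. sec G U Mod carrier (sec H U)),
      res = (\<lambda>U V C. carrier (sec H V) <#>\<^bsub>sec G V\<^esub> (res G U V ` C))\<rparr>"

definition quotient_sheaf ::
  "'x topology \<Rightarrow> ('x, 'a) group_presheaf \<Rightarrow> ('x, 'a) group_presheaf \<Rightarrow>
   ('x, 'x \<Rightarrow> ('x set \<times> 'a set) set) group_presheaf" where
  "quotient_sheaf X G H = sheafify X (quotient_presheaf G H)"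

definition quotient_proj ::
  "'x topology \<Rightarrow> ('x, 'a) group_presheaf \<Rightarrow> ('x, 'a) group_presheaf \<Rightarrow>
   'x set \<Rightarrow> 'a \<Rightarrow> 'x \<Rightarrow> ('x set \<times> 'a set) set" where
  "quotient_proj X G H U s =
     sheafify_unit X (quotient_presheaf G H) U (carrier (sec H U) #>\<^bsub>sec G U\<^esub> s)"

section \<open>The space \<open>E\<^sub>q = \<complex>\<^sup>*/q\<^sup>\<int>\<close>\<close>

text \<open>Points of \<open>E\<^sub>q\<close> are the orbits of \<open>q\<^sup>\<int>\<close> in \<open>\<complex>\<^sup>*\<close>.\<close>

definition Eq_proj :: "complex \<Rightarrow> complex \<Rightarrow> complex set" where
  "Eq_proj q z = range (\<lambda>m::int. q powi m * z)"

definition Eq_preimage :: "complex \<Rightarrow> complex set set \<Rightarrow> complex set" where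
  "Eq_preimage q V = {z. z \<noteq> 0 \<and> Eq_proj q z \<in> V}"

definition Eq_space :: "complex \<Rightarrow> complex set topology" where
  "Eq_space q = topology (\<lambda>V. V \<subseteq> Eq_proj q ` (- {0}) \<and> open (Eq_preimage q V))"

lemma openin_Eq_space:
  "openin (Eq_space q) V \<longleftrightarrow> V \<subseteq> Eq_proj q ` (- {0}) \<and> open (Eq_preimage q V)"
proof -
  have "istopology (\<lambda>V. V \<subseteq> Eq_proj q ` (- {0}) \<and> open (Eq_preimage q V))"
  proof -
    have "Eq_preimage q (S \<inter> T) = Eq_preimage q S \<inter> Eq_preimage q T" for S T
      by (auto simp: Eq_preimage_def)
    moreover have "Eq_preimage q (\<Union>\<K>) = (\<Union>K\<in>\<K>. Eq_preimage q K)" for \<K>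
      by (auto simp: Eq_preimage_def)
    ultimately show ?thesis
      unfolding istopology_def by (auto intro: open_Int)
  qed
  then show ?thesis
    by (simp add: Eq_space_def)
qed

lemma quotient_map_Eq_space:
  "quotient_map (top_of_set (- {0})) (Eq_space q) (Eq_proj q)"
proof -
  have op: "open (- {0::complex})"
    by (rule open_Compl) simp
  have "Eq_preimage q (Eq_proj q ` (- {0})) = - {0}"
    by (auto simp: Eq_preimage_def)
  then have "openin (Eq_space q) (Eq_proj q ` (- {0}))"
    using op by (simp only: openin_Eq_space subset_refl)
  then have sp: "topspace (Eq_space q) = Eq_proj q ` (- {0})"
    by (metis openin_Eq_space openin_subset openin_topspace subset_antisym)
  have "{x. x \<noteq> 0 \<and> Eq_proj q x \<in> U} = Eq_preimage q U" for U
    by (auto simp: Eq_preimage_def)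
  then show ?thesis
    unfolding quotient_map_def sp
    using op by (auto simp: openin_Eq_space openin_open_eq Eq_preimage_def)
qed

section \<open>Functions on sectors\<close>

text \<open>\<open>sector q W V\<close>: \<open>W\<close> represents a sector with horizon \<open>V\<close>. Passing to the germ of \<open>W\<close> at
  \<open>0\<close> does not change the horizon, and is a particular case of shrinking the sector with fixed
  horizon; so the germ is never formed separately.\<close>

definition sector :: "complex \<Rightarrow> complex set \<Rightarrow> complex set set \<Rightarrow> bool" where
  "sector q W V \<longleftrightarrow>
     open W \<and> W \<subseteq> - {0} \<and> (\<forall>z\<in>W. z / q \<in> W) \<and> Eq_proj q ` W = V"

definition qdown :: "complex \<Rightarrow> complex set \<Rightarrow> complex set" where
  "qdown q K = (\<Union>m::nat. (\<lambda>z. z / q ^ m) ` K)"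

definition theta :: "complex \<Rightarrow> complex \<Rightarrow> complex \<Rightarrow> complex" where
  "theta q c z = (\<Sum>\<^sub>\<infinity>m\<in>(UNIV::int set). q powi (- (m * (m + 1) div 2)) * (z / c) powi m)"

definition flat_on :: "complex \<Rightarrow> complex set \<Rightarrow> (complex \<Rightarrow> complex) \<Rightarrow> bool" where
  "flat_on q W f \<longleftrightarrow> f holomorphic_on W \<and>
     (\<forall>m::nat. \<forall>K. compact K \<longrightarrow> K \<subseteq> W \<longrightarrow> bounded ((\<lambda>z. f z / z ^ m) ` qdown q K))"

definition t_flat_on :: "complex \<Rightarrow> nat \<Rightarrow> complex set \<Rightarrow> (complex \<Rightarrow> complex) \<Rightarrow> bool" where
  "t_flat_on q t W f \<longleftrightarrow> f holomorphic_on W \<and>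
     (\<exists>c. c \<noteq> 0 \<and> (\<forall>K. compact K \<longrightarrow> K \<subseteq> W \<longrightarrow>
        (\<exists>N::nat. (\<lambda>z. cmod (f z) * cmod (theta q c z) ^ t)
           \<in> O[at 0 within qdown q K](\<lambda>z. inverse (cmod z ^ N)))))"

text \<open>In \<open>t_flat_on\<close> the choice of \<open>c\<close> is immaterial: two theta functions are comparable up to
  powers of \<open>z\<close> away from their zeros, and the maximum principle handles the zeros.\<close>

text \<open>\<open>sgerm q V W f\<close> is the class of \<open>(W, f)\<close>, where \<open>W\<close> is a sector with horizon \<open>V\<close>, modulo
  restriction to smaller sectors with horizon \<open>V\<close>. Classes are formed among all functions (with
  values in an arbitrary type, and ignoring the values outside of \<open>W\<close>); analytic conditions on a
  class then ask for a representative satisfying them.\<close>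

type_synonym 'm sgerm = "(complex set \<times> (complex \<Rightarrow> 'm)) set"

definition sgerm ::
  "complex \<Rightarrow> complex set set \<Rightarrow> complex set \<Rightarrow> (complex \<Rightarrow> 'm) \<Rightarrow> 'm sgerm" where
  "sgerm q V W f =
     {(W', g). sector q W' V \<and> (\<exists>W''. sector q W'' V \<and> W'' \<subseteq> W \<inter> W' \<and> (\<forall>z\<in>W''. f z = g z))}"

text \<open>Pointwise operations on classes; the unions are over representatives yielding one and the
  same class.\<close>

definition sgerm_const :: "complex \<Rightarrow> complex set set \<Rightarrow> 'm \<Rightarrow> 'm sgerm" where
  "sgerm_const q V c = sgerm q V (Eq_preimage q V) (\<lambda>z. c)"

definition sgerm_map ::
  "complex \<Rightarrow> complex set set \<Rightarrow> (complex \<Rightarrow> 'm \<Rightarrow> 'p) \<Rightarrow> 'm sgerm \<Rightarrow> 'p sgerm" where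
  "sgerm_map q V \<phi> s = (\<Union>(W, f)\<in>s. sgerm q V W (\<lambda>z. \<phi> z (f z)))"

definition sgerm_map2 ::
  "complex \<Rightarrow> complex set set \<Rightarrow> ('m \<Rightarrow> 'n \<Rightarrow> 'p) \<Rightarrow> 'm sgerm \<Rightarrow> 'n sgerm \<Rightarrow> 'p sgerm" where
  "sgerm_map2 q V \<phi> s s' =
     (\<Union>(W, f)\<in>s. \<Union>(W', g)\<in>s'. sgerm q V (W \<inter> W') (\<lambda>z. \<phi> (f z) (g z)))"

definition sgerm_sigma :: "complex \<Rightarrow> complex set set \<Rightarrow> 'm sgerm \<Rightarrow> 'm sgerm" where
  "sgerm_sigma q V s = (\<Union>(W, f)\<in>s. sgerm q V ((\<lambda>z. z / q) ` W) (\<lambda>z. f (q * z)))"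

definition sgerm_res ::
  "complex \<Rightarrow> complex set set \<Rightarrow> complex set set \<Rightarrow> 'm sgerm \<Rightarrow> 'm sgerm" where
  "sgerm_res q U V s = (\<Union>(W, f)\<in>s. sgerm q V (W \<inter> Eq_preimage q V) f)"

text \<open>Sections over \<open>V\<close> of the sheaf \<open>\<A>\<^sub>0\<close> of flat functions, and the \<open>t\<close>-flat ones.\<close>

definition flat_sections :: "complex \<Rightarrow> complex set set \<Rightarrow> complex sgerm set" where
  "flat_sections q V = {sgerm q V W f | W f. sector q W V \<and> flat_on q W f}"

definition t_flat_sections :: "complex \<Rightarrow> nat \<Rightarrow> complex set set \<Rightarrow> complex sgerm set" where
  "t_flat_sections q t V = {sgerm q V W f | W f. sector q W V \<and> flat_on q W f \<and> t_flat_on q t W f}"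

section \<open>The Stokes sheaf and its filtration\<close>

text \<open>The data \<open>M\<^sub>0\<close> is given by \<open>k\<close>, \<open>\<mu>\<^sub>i\<close>, \<open>r\<^sub>i\<close> and \<open>A\<^sub>i\<close> for \<open>1 \<le> i \<le> k\<close>. Matrix entries are
  numbered from \<open>0\<close>, but the blocks from \<open>1\<close>.\<close>

definition total_rank :: "nat \<Rightarrow> (nat \<Rightarrow> nat) \<Rightarrow> nat" where
  "total_rank k r = (\<Sum>i=1..k. r i)"

definition A0_mat ::
  "nat \<Rightarrow> (nat \<Rightarrow> int) \<Rightarrow> (nat \<Rightarrow> complex mat) \<Rightarrow> complex \<Rightarrow> complex mat" where
  "A0_mat k \<mu> A z = diag_block_mat (map (\<lambda>i. z powi (- \<mu> i) \<cdot>\<^sub>m A i) [1..<Suc k])"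

definition mat_block :: "(nat \<Rightarrow> nat) \<Rightarrow> nat \<Rightarrow> nat \<Rightarrow> complex mat \<Rightarrow> complex mat" where
  "mat_block r i j M =
     mat (r i) (r j) (\<lambda>(a, b). M $$ ((\<Sum>l=1..<i. r l) + a, (\<Sum>l=1..<j. r l) + b))"

definition sgerm_entry ::
  "complex \<Rightarrow> complex set set \<Rightarrow> nat \<Rightarrow> nat \<Rightarrow> complex mat sgerm \<Rightarrow> complex sgerm" where
  "sgerm_entry q V a b = sgerm_map q V (\<lambda>z M. M $$ (a, b))"

definition block_vanishes ::
  "complex \<Rightarrow> complex set set \<Rightarrow> (nat \<Rightarrow> nat) \<Rightarrow> nat \<Rightarrow> nat \<Rightarrow> complex mat sgerm \<Rightarrow> bool" where
  "block_vanishes q V r i j s \<longleftrightarrow>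
     sgerm_map q V (\<lambda>z. mat_block r i j) s = sgerm_const q V (0\<^sub>m (r i) (r j))"

definition lambda_sections ::
  "complex \<Rightarrow> nat \<Rightarrow> (nat \<Rightarrow> int) \<Rightarrow> (nat \<Rightarrow> nat) \<Rightarrow> (nat \<Rightarrow> complex mat) \<Rightarrow>
   complex set set \<Rightarrow> complex mat sgerm set" where
  "lambda_sections q k \<mu> r A V =
     {s. (\<exists>W f. sector q W V \<and> f \<in> W \<rightarrow> carrier_mat (total_rank k r) (total_rank k r) \<and>
            s = sgerm q V W f) \<and>
         (\<forall>a<total_rank k r. \<forall>b<total_rank k r. sgerm_entry q V a b s \<in> flat_sections q V) \<and>
         (\<forall>i\<in>{1..k}. \<forall>j\<in>{1..k}. \<not> i < j \<longrightarrow> block_vanishes q V r i j s) \<and>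
         sgerm_map q V (\<lambda>z M. M * A0_mat k \<mu> A z) (sgerm_sigma q V s) =
           sgerm_map q V (\<lambda>z M. A0_mat k \<mu> A z * M) s}"

definition lambda_t_sections ::
  "complex \<Rightarrow> nat \<Rightarrow> (nat \<Rightarrow> int) \<Rightarrow> (nat \<Rightarrow> nat) \<Rightarrow> (nat \<Rightarrow> complex mat) \<Rightarrow> nat \<Rightarrow>
   complex set set \<Rightarrow> complex mat sgerm set" where
  "lambda_t_sections q k \<mu> r A t V =
     {s \<in> lambda_sections q k \<mu> r A V.
        \<forall>a<total_rank k r. \<forall>b<total_rank k r. sgerm_entry q V a b s \<in> t_flat_sections q t V}"

definition lambda_graded_sections ::
  "complex \<Rightarrow> nat \<Rightarrow> (nat \<Rightarrow> int) \<Rightarrow> (nat \<Rightarrow> nat) \<Rightarrow> (nat \<Rightarrow> complex mat) \<Rightarrow> nat \<Rightarrow>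
   complex set set \<Rightarrow> complex mat sgerm set" where
  "lambda_graded_sections q k \<mu> r A t V =
     {s \<in> lambda_sections q k \<mu> r A V.
        \<forall>i\<in>{1..k}. \<forall>j\<in>{1..k}. \<mu> i - \<mu> j \<noteq> int t \<longrightarrow> block_vanishes q V r i j s}"

definition one_plus :: "complex \<Rightarrow> nat \<Rightarrow> complex set set \<Rightarrow> complex mat sgerm \<Rightarrow> complex mat sgerm"
  where
  "one_plus q n V = sgerm_map q V (\<lambda>z M. 1\<^sub>m n + M)"

text \<open>Given the sections of a subsheaf of \<open>\<lambda>\<^sub>I(M\<^sub>0)\<close>: the associated additive sheaf \<open>\<lambda>\<close>, and the
  multiplicative one \<open>I\<^sub>n + \<lambda>\<close>.\<close>

definition additive_sheaf ::
  "complex \<Rightarrow> nat \<Rightarrow> (complex set set \<Rightarrow> complex mat sgerm set) \<Rightarrow>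
   (complex set, complex mat sgerm) group_presheaf" where
  "additive_sheaf q n L =
     \<lparr>sec = (\<lambda>V. \<lparr>carrier = L V,
                  mult = sgerm_map2 q V (+),
                  one = sgerm_const q V (0\<^sub>m n n)\<rparr>),
      res = sgerm_res q\<rparr>"

definition unipotent_sheaf ::
  "complex \<Rightarrow> nat \<Rightarrow> (complex set set \<Rightarrow> complex mat sgerm set) \<Rightarrow>
   (complex set, complex mat sgerm) group_presheaf" where
  "unipotent_sheaf q n L =
     \<lparr>sec = (\<lambda>V. \<lparr>carrier = one_plus q n V ` L V,
                  mult = sgerm_map2 q V (*),
                  one = sgerm_const q V (1\<^sub>m n)\<rparr>),
      res = sgerm_res q\<rparr>"

definition lambda_graded_sheaf ::
  "complex \<Rightarrow> nat \<Rightarrow> (nat \<Rightarrow> int) \<Rightarrow> (nat \<Rightarrow> nat) \<Rightarrow> (nat \<Rightarrow> complex mat) \<Rightarrow> nat \<Rightarrow>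
   (complex set, complex mat sgerm) group_presheaf" where
  "lambda_graded_sheaf q k \<mu> r A t =
     additive_sheaf q (total_rank k r) (lambda_graded_sections q k \<mu> r A t)"

definition Stokes_sheaf ::
  "complex \<Rightarrow> nat \<Rightarrow> (nat \<Rightarrow> int) \<Rightarrow> (nat \<Rightarrow> nat) \<Rightarrow> (nat \<Rightarrow> complex mat) \<Rightarrow>
   (complex set, complex mat sgerm) group_presheaf" where
  "Stokes_sheaf q k \<mu> r A = unipotent_sheaf q (total_rank k r) (lambda_sections q k \<mu> r A)"

definition Stokes_t_sheaf ::
  "complex \<Rightarrow> nat \<Rightarrow> (nat \<Rightarrow> int) \<Rightarrow> (nat \<Rightarrow> nat) \<Rightarrow> (nat \<Rightarrow> complex mat) \<Rightarrow> nat \<Rightarrow>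
   (complex set, complex mat sgerm) group_presheaf" where
  "Stokes_t_sheaf q k \<mu> r A t =
     unipotent_sheaf q (total_rank k r) (lambda_t_sections q k \<mu> r A t)"

end

theory Submission
  imports Defs
begin

text \<open>The equation \<open>(\<sigma>\<^sub>q F) A\<^sub>0 = A\<^sub>0 F\<close> controls both where a section is defined and how fast it
  decays. Since \<open>A\<^sub>0\<close> is invertible on \<open>\<complex>\<^sup>*\<close>, a solution on a sector extends uniquely, orbit by
  orbit, to a solution on the whole preimage of the horizon in \<open>\<complex>\<^sup>*\<close> (\<open>extend_from_sector\<close>,
  \<open>solutions_eqI\<close>). Sections of all the sheaves are therefore honest holomorphic functions on
  \<open>q\<close>-invariant open sets, the germs disappear, and gluing is gluing of functions.

  Next, growth is dictated by the block: in block \<open>(i, j)\<close> one step of the equation reads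
  \<open>F\<^sub>i\<^sub>j(z) = z\<^sup>\<delta> A\<^sub>i\<^sup>-\<^sup>1 F\<^sub>i\<^sub>j(q z) A\<^sub>j\<close> with \<open>\<delta> = \<mu>\<^sub>i - \<mu>\<^sub>j\<close>, whereas \<open>\<theta>(q z) = (z/c) \<theta>(z)\<close>. Up to factors
  that are exponential in the number of steps, hence powers of \<open>\<bar>z\<bar>\<close>, a nonzero block thus decays
  like \<open>\<bar>\<theta>\<bar>\<close> to the power \<open>-\<delta>\<close>. So flatness is automatic in the blocks with \<open>i < j\<close>, and \<open>t\<close>-flatness
  says exactly that the blocks with \<open>\<delta> < t\<close> vanish (\<open>solutions_flat\<close>, \<open>solutions_t_flat\<close>,
  \<open>solutions_t_flat_pattern\<close>). Hence \<open>\<lambda>\<^sub>I\<close>, \<open>\<lambda>\<^sub>I\<^sup>t\<close> and \<open>\<lambda>\<^sub>I\<^sup>(\<^sup>t\<^sup>)\<close> are the sheaves of solutions supported in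
  the blocks \<open>i < j\<close>, those among them with \<open>\<delta> \<ge> t\<close>, and those with \<open>\<delta> = t\<close>.

  The rest is algebra. Slopes \<open>\<delta>\<close> add up under multiplication of blocks and are positive, so
  \<open>\<lambda>\<^sub>I\<^sup>t\<close> is a two-sided ideal, which gives normality (\<open>unipotent_sheaf_normal\<close>), and the product of two
  elements of \<open>\<lambda>\<^sub>I\<^sup>t\<close> lies in \<open>\<lambda>\<^sub>I\<^sup>t\<^sup>+\<^sup>1\<close>. Therefore taking the part of slope \<open>t\<close> is a homomorphism
  from \<open>\<Lambda>\<^sub>I\<^sup>t\<close> onto \<open>\<lambda>\<^sub>I\<^sup>(\<^sup>t\<^sup>)\<close> with kernel \<open>\<Lambda>\<^sub>I\<^sup>t\<^sup>+\<^sup>1\<close>, over every open set, and \<open>f \<mapsto> 1 + f\<close> is a section of it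
  (\<open>graded_quotient_presheaf_iso\<close>). In particular the presheaf of quotients is already a sheaf, and
  passing to the associated sheaf changes nothing (\<open>sheafify_unit_iso\<close>).\<close>

section \<open>Sheaves of groups\<close>

text \<open>Gluing data on \<open>Q\<close> are pulled back along the bijections, glued in \<open>P\<close> and pushed forward.
  This is how presheaves of germs and of cosets, where gluing is awkward to check directly, are
  recognised as sheaves.\<close>

lemma iso_of_group_sheavesI:
  fixes P :: "('x, 'a) group_presheaf" and Q :: "('x, 'b) group_presheaf"
  assumes P: "sheaf_of_groups X P"
    and bij: "\<And>U. openin X U \<Longrightarrow> bij_betw (\<phi> U) (carrier (sec P U)) (carrier (sec Q U))"
    and mult: "\<And>U a b. openin X U \<Longrightarrow> a \<in> carrier (sec P U) \<Longrightarrow> b \<in> carrier (sec P U) \<Longrightarrow>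
      \<phi> U (a \<otimes>\<^bsub>sec P U\<^esub> b) = \<phi> U a \<otimes>\<^bsub>sec Q U\<^esub> \<phi> U b"
    and one: "\<And>U. openin X U \<Longrightarrow> \<phi> U \<one>\<^bsub>sec P U\<^esub> = \<one>\<^bsub>sec Q U\<^esub>"
    and res: "\<And>U V a. openin X U \<Longrightarrow> openin X V \<Longrightarrow> V \<subseteq> U \<Longrightarrow> a \<in> carrier (sec P U) \<Longrightarrow>
      res Q U V (\<phi> U a) = \<phi> V (res P U V a)"
  shows "iso_of_group_sheaves X P Q \<phi>"
proof -
  interpret P: sheaf_of_groups X P by (rule P)
  have iso: "\<phi> U \<in> iso (sec P U) (sec Q U)" if "openin X U" for U
    using bij[OF that] mult[OF that] by (auto simp: iso_def hom_def bij_betw_def)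
  have surj: "\<exists>a. a \<in> carrier (sec P U) \<and> \<phi> U a = b"
    if "openin X U" "b \<in> carrier (sec Q U)" for U b
    using bij_betw_imp_surj_on[OF bij[OF that(1)]] that(2) by (metis imageE)
  have resP: "res P U V a \<in> carrier (sec P V)"
    if "openin X U" "openin X V" "V \<subseteq> U" "a \<in> carrier (sec P U)" for U V a
    using P.res_hom[OF that(1,2,3)] that(4) by (auto simp: hom_def)
  have inQ: "\<phi> U a \<in> carrier (sec Q U)" if "openin X U" "a \<in> carrier (sec P U)" for U a
    using bij[OF that(1)] that(2) by (auto simp: bij_betw_def)
  have inj: "a = b" if "openin X U" "a \<in> carrier (sec P U)" "b \<in> carrier (sec P U)" "\<phi> U a = \<phi> U b"
    for U a b
    using bij[OF that(1)] that(2-) by (auto simp: bij_betw_def inj_on_def)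
  have "sheaf_of_groups X Q"
  proof (intro sheaf_of_groups.intro presheaf_of_groups.intro sheaf_of_groups_axioms.intro)
    fix U assume U: "openin X U"
    have "group ((sec Q U)\<lparr>one := \<phi> U \<one>\<^bsub>sec P U\<^esub>\<rparr>)"
      by (rule group.iso_imp_img_group[OF P.group_sec[OF U] iso[OF U]])
    then show "group (sec Q U)"
      by (simp add: one[OF U])
  next
    fix U V assume UV: "openin X U" "openin X V" "V \<subseteq> U"
    show "res Q U V \<in> hom (sec Q U) (sec Q V)"
    proof (rule homI)
      fix x assume "x \<in> carrier (sec Q U)"
      then obtain a where a: "a \<in> carrier (sec P U)" "\<phi> U a = x"
        using surj UV(1) by blast
      then show "res Q U V x \<in> carrier (sec Q V)"
        using res[OF UV a(1)] inQ[OF UV(2) resP[OF UV a(1)]] by simp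
    next
      fix x y assume "x \<in> carrier (sec Q U)" "y \<in> carrier (sec Q U)"
      then obtain a b where a: "a \<in> carrier (sec P U)" "\<phi> U a = x"
        and b: "b \<in> carrier (sec P U)" "\<phi> U b = y"
        using surj UV(1) by meson
      have ab: "a \<otimes>\<^bsub>sec P U\<^esub> b \<in> carrier (sec P U)"
        using P.group_sec[OF UV(1)] a(1) b(1) by (simp add: group.is_monoid monoid.m_closed)
      have "res Q U V (x \<otimes>\<^bsub>sec Q U\<^esub> y) = res Q U V (\<phi> U (a \<otimes>\<^bsub>sec P U\<^esub> b))"
        using mult[OF UV(1) a(1) b(1)] a b by simp
      also have "\<dots> = \<phi> V (res P U V a \<otimes>\<^bsub>sec P V\<^esub> res P U V b)"
        using res[OF UV ab] P.res_hom[OF UV] a(1) b(1) by (simp add: hom_def)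
      also have "\<dots> = res Q U V x \<otimes>\<^bsub>sec Q V\<^esub> res Q U V y"
        using mult[OF UV(2) resP[OF UV a(1)] resP[OF UV b(1)]] res[OF UV a(1)] res[OF UV b(1)] a b
        by simp
      finally show "res Q U V (x \<otimes>\<^bsub>sec Q U\<^esub> y) = res Q U V x \<otimes>\<^bsub>sec Q V\<^esub> res Q U V y" .
    qed
  next
    fix U s assume U: "openin X U" "s \<in> carrier (sec Q U)"
    then obtain a where a: "a \<in> carrier (sec P U)" "\<phi> U a = s"
      using surj by blast
    then show "res Q U U s = s"
      using res[OF U(1) U(1) _ a(1)] P.res_id[OF U(1) a(1)] by simp
  next
    fix U V W s
    assume U: "openin X U" and V: "openin X V" and W: "openin X W" and WV: "W \<subseteq> V" and VU: "V \<subseteq> U"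
      and s: "s \<in> carrier (sec Q U)"
    then obtain a where a: "a \<in> carrier (sec P U)" "\<phi> U a = s"
      using surj by blast
    show "res Q V W (res Q U V s) = res Q U W s"
      using res[OF U V VU a(1)] res[OF V W WV resP[OF U V VU a(1)]] res[OF U W _ a(1)] WV VU a
        P.res_res[OF U V W WV VU a(1)] by auto
  next
    fix \<U> :: "'x set set" and s
    assume op: "\<And>U. U \<in> \<U> \<Longrightarrow> openin X U"
      and s: "\<And>U. U \<in> \<U> \<Longrightarrow> s U \<in> carrier (sec Q U)"
      and agree: "\<And>U V. U \<in> \<U> \<Longrightarrow> V \<in> \<U> \<Longrightarrow> res Q U (U \<inter> V) (s U) = res Q V (U \<inter> V) (s V)"
    have opU: "openin X (\<Union>\<U>)"
      using op by blast
    have "\<exists>a. \<forall>U\<in>\<U>. a U \<in> carrier (sec P U) \<and> \<phi> U (a U) = s U"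
      using surj[OF op s] by (intro bchoice) blast
    then obtain a where a: "\<And>U. U \<in> \<U> \<Longrightarrow> a U \<in> carrier (sec P U)"
      and \<phi>a: "\<And>U. U \<in> \<U> \<Longrightarrow> \<phi> U (a U) = s U"
      by blast
    have "res P U (U \<inter> V) (a U) = res P V (U \<inter> V) (a V)" if "U \<in> \<U>" "V \<in> \<U>" for U V
    proof (rule inj[of "U \<inter> V"])
      show UV: "openin X (U \<inter> V)"
        using op that by blast
      show "res P U (U \<inter> V) (a U) \<in> carrier (sec P (U \<inter> V))"
        "res P V (U \<inter> V) (a V) \<in> carrier (sec P (U \<inter> V))"
        using resP[OF op UV] a that by auto
      show "\<phi> (U \<inter> V) (res P U (U \<inter> V) (a U)) = \<phi> (U \<inter> V) (res P V (U \<inter> V) (a V))"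
        using res[OF op UV _ a] that agree[OF that] \<phi>a by auto
    qed
    with P.ex1_glue[where \<U> = \<U> and s = a, OF op a]
    have "\<exists>!s'. s' \<in> carrier (sec P (\<Union>\<U>)) \<and> (\<forall>U\<in>\<U>. res P (\<Union>\<U>) U s' = a U)"
      by blast
    then obtain a' where a': "a' \<in> carrier (sec P (\<Union>\<U>))"
      and a'r: "\<And>U. U \<in> \<U> \<Longrightarrow> res P (\<Union>\<U>) U a' = a U"
      and a'u: "\<And>b. b \<in> carrier (sec P (\<Union>\<U>)) \<Longrightarrow> (\<forall>U\<in>\<U>. res P (\<Union>\<U>) U b = a U) \<Longrightarrow> b = a'"
      by (elim ex1E) blast
    show "\<exists>!s'. s' \<in> carrier (sec Q (\<Union>\<U>)) \<and> (\<forall>U\<in>\<U>. res Q (\<Union>\<U>) U s' = s U)"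
    proof (rule ex1I[of _ "\<phi> (\<Union>\<U>) a'"])
      show "\<phi> (\<Union>\<U>) a' \<in> carrier (sec Q (\<Union>\<U>)) \<and> (\<forall>U\<in>\<U>. res Q (\<Union>\<U>) U (\<phi> (\<Union>\<U>) a') = s U)"
        using inQ[OF opU a'] res[OF opU op _ a'] a'r \<phi>a by (simp add: Union_upper)
    next
      fix s' assume s': "s' \<in> carrier (sec Q (\<Union>\<U>)) \<and> (\<forall>U\<in>\<U>. res Q (\<Union>\<U>) U s' = s U)"
      then obtain b where b: "b \<in> carrier (sec P (\<Union>\<U>))" "\<phi> (\<Union>\<U>) b = s'"
        using surj opU by blast
      have "res P (\<Union>\<U>) U b = a U" if U: "U \<in> \<U>" for U
      proof (rule inj[OF op[OF U] resP[OF opU op[OF U] _ b(1)] a[OF U]])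
        show "U \<subseteq> \<Union>\<U>" using U by blast
        then show "\<phi> U (res P (\<Union>\<U>) U b) = \<phi> U (a U)"
          using res[OF opU op[OF U] _ b(1)] b(2) s' U \<phi>a by auto
      qed
      then show "s' = \<phi> (\<Union>\<U>) a'"
        using a'u b by blast
    qed
  qed
  then show ?thesis
    using P iso res by (simp add: iso_of_group_sheaves_def)
qed

lemma iso_of_group_sheaves_trans:
  assumes "iso_of_group_sheaves X P Q \<phi>" "iso_of_group_sheaves X Q R \<psi>"
  shows "iso_of_group_sheaves X P R (\<lambda>U s. \<psi> U (\<phi> U s))"
proof -
  have 1: "\<phi> U s \<in> carrier (sec Q U)" if "openin X U" "s \<in> carrier (sec P U)" for U s
    using assms(1) that by (force simp: iso_of_group_sheaves_def iso_def hom_def)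
  have 2: "(\<lambda>s. \<psi> U (\<phi> U s)) \<in> iso (sec P U) (sec R U)" if "openin X U" for U
    using iso_set_trans[of "\<phi> U" "sec P U" "sec Q U" "\<psi> U" "sec R U"] assms that
    by (auto simp: iso_of_group_sheaves_def o_def compose_def)
  show ?thesis
    using assms 1 2 by (simp add: iso_of_group_sheaves_def)
qed

subsection \<open>Germs and the associated sheaf\<close>

context sheaf_of_groups
begin

lemma res_closed:
  "openin X U \<Longrightarrow> openin X V \<Longrightarrow> V \<subseteq> U \<Longrightarrow> s \<in> carrier (sec P U) \<Longrightarrow> res P U V s \<in> carrier (sec P V)"
  using res_hom by (force simp: hom_def)

lemma res_mult:
  "openin X U \<Longrightarrow> openin X V \<Longrightarrow> V \<subseteq> U \<Longrightarrow> s \<in> carrier (sec P U) \<Longrightarrow> s' \<in> carrier (sec P U) \<Longrightarrow>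
    res P U V (s \<otimes>\<^bsub>sec P U\<^esub> s') = res P U V s \<otimes>\<^bsub>sec P V\<^esub> res P U V s'"
  using res_hom by (force simp: hom_def)

lemma mult_closed:
  "openin X U \<Longrightarrow> s \<in> carrier (sec P U) \<Longrightarrow> s' \<in> carrier (sec P U) \<Longrightarrow>
    s \<otimes>\<^bsub>sec P U\<^esub> s' \<in> carrier (sec P U)"
  using group_sec by (simp add: group.is_monoid monoid.m_closed)

lemma stalk_germ_memI:
  "openin X U \<Longrightarrow> x \<in> U \<Longrightarrow> a \<in> carrier (sec P U) \<Longrightarrow> (U, a) \<in> stalk_germ X P x U a"
  by (auto simp: stalk_germ_def)

lemma stalk_germ_eqI:
  assumes U: "openin X U" "a \<in> carrier (sec P U)" and V: "openin X V" "b \<in> carrier (sec P V)"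
    and W: "openin X W" "x \<in> W" "W \<subseteq> U \<inter> V" and eq: "res P U W a = res P V W b"
  shows "stalk_germ X P x U a = stalk_germ X P x V b"
proof -
  have sub: "stalk_germ X P x U a \<subseteq> stalk_germ X P x V b"
    if U: "openin X U" "a \<in> carrier (sec P U)" and V: "openin X V" "b \<in> carrier (sec P V)"
      and W: "W \<subseteq> U \<inter> V" and eq: "res P U W a = res P V W b" for U V a b
  proof (clarsimp simp: stalk_germ_def)
    fix V' c W'
    assume V': "openin X V'" "x \<in> V'" "c \<in> carrier (sec P V')" and W': "openin X W'" "x \<in> W'"
      "W' \<subseteq> U" "W' \<subseteq> V'" and eq': "res P U W' a = res P V' W' c"
    have op: "openin X (W \<inter> W')"
      using \<open>openin X W\<close> W' by blast
    have "res P V (W \<inter> W') b = res P W (W \<inter> W') (res P V W b)"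
      using res_res[OF V(1) \<open>openin X W\<close> op _ _ V(2)] W by auto
    also have "\<dots> = res P U (W \<inter> W') a"
      using res_res[OF U(1) \<open>openin X W\<close> op _ _ U(2)] W eq by auto
    also have "\<dots> = res P W' (W \<inter> W') (res P V' W' c)"
      using res_res[OF U(1) \<open>openin X W'\<close> op _ _ U(2)] W' eq' by auto
    also have "\<dots> = res P V' (W \<inter> W') c"
      using res_res[OF V'(1) \<open>openin X W'\<close> op _ _ V'(3)] W' by auto
    finally show "\<exists>W. openin X W \<and> x \<in> W \<and> W \<subseteq> V \<and> W \<subseteq> V' \<and> res P V W b = res P V' W c"
      using op W W' \<open>x \<in> W\<close> by (intro exI[of _ "W \<inter> W'"]) auto
  qed
  show ?thesis
    using sub[OF U V _ eq] sub[OF V U _ eq[symmetric]] W by blast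
qed

lemma stalk_germ_eqD:
  assumes "openin X U" "x \<in> U" "a \<in> carrier (sec P U)" "openin X V" "x \<in> V" "b \<in> carrier (sec P V)"
    and "stalk_germ X P x U a = stalk_germ X P x V b"
  obtains W where "openin X W" "x \<in> W" "W \<subseteq> U \<inter> V" "res P U W a = res P V W b"
proof -
  have "(V, b) \<in> stalk_germ X P x U a"
    using stalk_germ_memI[OF assms(4-6)] assms(7) by simp
  then show thesis
    using that by (auto simp: stalk_germ_def)
qed

lemma stalk_germ_res:
  assumes "openin X U" "a \<in> carrier (sec P U)" "openin X V" "V \<subseteq> U" "x \<in> V"
  shows "stalk_germ X P x V (res P U V a) = stalk_germ X P x U a"
  using assms res_closed res_id by (intro stalk_germ_eqI[where W = V]) auto

text \<open>Any two representatives of the factors agree with \<open>a\<close> and \<open>b\<close> near \<open>x\<close>, so that the union in the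
  definition of the stalkwise product has one and the same set as its members.\<close>

lemma stalk_mult_germ:
  assumes U: "openin X U" and x: "x \<in> U" and a: "a \<in> carrier (sec P U)" and b: "b \<in> carrier (sec P U)"
  shows "stalk_mult X P x (stalk_germ X P x U a) (stalk_germ X P x U b) =
    stalk_germ X P x U (a \<otimes>\<^bsub>sec P U\<^esub> b)"
proof -
  have key: "stalk_germ X P x (U1 \<inter> V1)
      (res P U1 (U1 \<inter> V1) a1 \<otimes>\<^bsub>sec P (U1 \<inter> V1)\<^esub> res P V1 (U1 \<inter> V1) b1) =
      stalk_germ X P x U (a \<otimes>\<^bsub>sec P U\<^esub> b)"
    if A: "(U1, a1) \<in> stalk_germ X P x U a" and B: "(V1, b1) \<in> stalk_germ X P x U b" for U1 a1 V1 b1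
  proof -
    from A obtain W where U1: "openin X U1" "x \<in> U1" "a1 \<in> carrier (sec P U1)"
      and W: "openin X W" "x \<in> W" "W \<subseteq> U \<inter> U1" and ea: "res P U W a = res P U1 W a1"
      by (auto simp: stalk_germ_def)
    from B obtain W' where V1: "openin X V1" "x \<in> V1" "b1 \<in> carrier (sec P V1)"
      and W': "openin X W'" "x \<in> W'" "W' \<subseteq> U \<inter> V1" and eb: "res P U W' b = res P V1 W' b1"
      by (auto simp: stalk_germ_def)
    let ?T = "W \<inter> W'" and ?I = "U1 \<inter> V1"
    have op: "openin X ?T" "openin X ?I"
      using W W' U1 V1 by auto
    have r: "res P U1 ?I a1 \<in> carrier (sec P ?I)" "res P V1 ?I b1 \<in> carrier (sec P ?I)"
      using res_closed[OF U1(1) op(2) _ U1(3)] res_closed[OF V1(1) op(2) _ V1(3)] by auto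
    have ea': "res P U ?T a = res P U1 ?T a1"
      using res_res[OF U W(1) op(1) _ _ a] res_res[OF U1(1) W(1) op(1) _ _ U1(3)] W ea by auto
    have eb': "res P U ?T b = res P V1 ?T b1"
      using res_res[OF U W'(1) op(1) _ _ b] res_res[OF V1(1) W'(1) op(1) _ _ V1(3)] W' eb by auto
    have "res P ?I ?T (res P U1 ?I a1 \<otimes>\<^bsub>sec P ?I\<^esub> res P V1 ?I b1) =
        res P U ?T (a \<otimes>\<^bsub>sec P U\<^esub> b)"
      using res_mult[OF op(2,1) _ r] res_mult[OF U op(1) _ a b] ea' eb' W W'
        res_res[OF U1(1) op(2,1) _ _ U1(3)] res_res[OF V1(1) op(2,1) _ _ V1(3)]
      by (simp add: le_infI1 le_infI2)
    then show ?thesis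
      using mult_closed[OF op(2) r] mult_closed[OF U a b] U op W W'
      by (intro stalk_germ_eqI[where W = ?T]) auto
  qed
  show ?thesis
  proof (intro equalityI subsetI)
    fix p assume "p \<in> stalk_mult X P x (stalk_germ X P x U a) (stalk_germ X P x U b)"
    then obtain U1 a1 V1 b1 where "(U1, a1) \<in> stalk_germ X P x U a" "(V1, b1) \<in> stalk_germ X P x U b"
      "p \<in> stalk_germ X P x (U1 \<inter> V1)
        (res P U1 (U1 \<inter> V1) a1 \<otimes>\<^bsub>sec P (U1 \<inter> V1)\<^esub> res P V1 (U1 \<inter> V1) b1)"
      unfolding stalk_mult_def by blast
    then show "p \<in> stalk_germ X P x U (a \<otimes>\<^bsub>sec P U\<^esub> b)"
      using key by blast
  next
    fix p assume p: "p \<in> stalk_germ X P x U (a \<otimes>\<^bsub>sec P U\<^esub> b)"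
    have ma: "(U, a) \<in> stalk_germ X P x U a" and mb: "(U, b) \<in> stalk_germ X P x U b"
      using stalk_germ_memI[OF U x a] stalk_germ_memI[OF U x b] by blast+
    show "p \<in> stalk_mult X P x (stalk_germ X P x U a) (stalk_germ X P x U b)"
      unfolding stalk_mult_def
      by (rule UN_I[OF ma], unfold prod.case, rule UN_I[OF mb], unfold prod.case key[OF ma mb]) (rule p)
  qed
qed

text \<open>Equality of germs is equality near each point; uniqueness of gluing makes it global.\<close>

lemma section_eqI:
  assumes U: "openin X U" and a: "a \<in> carrier (sec P U)" and b: "b \<in> carrier (sec P U)"
    and germs: "\<And>x. x \<in> U \<Longrightarrow> stalk_germ X P x U a = stalk_germ X P x U b"
  shows "a = b"
proof -
  have "\<exists>W. openin X W \<and> x \<in> W \<and> W \<subseteq> U \<and> res P U W a = res P U W b" if x: "x \<in> U" for x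
  proof -
    obtain W where "openin X W" "x \<in> W" "W \<subseteq> U \<inter> U" "res P U W a = res P U W b"
      by (rule stalk_germ_eqD[OF U x a U x b germs[OF x]])
    then show ?thesis
      by blast
  qed
  then obtain W where W: "\<And>x. x \<in> U \<Longrightarrow> openin X (W x)" "\<And>x. x \<in> U \<Longrightarrow> x \<in> W x"
    "\<And>x. x \<in> U \<Longrightarrow> W x \<subseteq> U" and eq: "\<And>x. x \<in> U \<Longrightarrow> res P U (W x) a = res P U (W x) b"
    by metis
  let ?\<U> = "W ` U"
  have Un: "\<Union>?\<U> = U"
    using W by auto
  have op: "openin X T" if "T \<in> ?\<U>" for T
    using W that by auto
  have cl: "res P U T a \<in> carrier (sec P T)" if "T \<in> ?\<U>" for T
    using that res_closed[OF U op[OF that] _ a] W by auto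
  have "res P T (T \<inter> T') (res P U T a) = res P T' (T \<inter> T') (res P U T' a)"
    if "T \<in> ?\<U>" "T' \<in> ?\<U>" for T T'
  proof -
    have o: "openin X (T \<inter> T')" "T \<subseteq> U" "T' \<subseteq> U"
      using op that W by auto
    then show ?thesis
      using res_res[OF U op[OF that(1)] o(1) _ o(2) a] res_res[OF U op[OF that(2)] o(1) _ o(3) a] by auto
  qed
  with ex1_glue[where \<U> = ?\<U> and s = "\<lambda>T. res P U T a", OF op cl]
  have "\<exists>!s'. s' \<in> carrier (sec P U) \<and> (\<forall>T\<in>?\<U>. res P U T s' = res P U T a)"
    unfolding Un by blast
  moreover have "\<forall>T\<in>?\<U>. res P U T b = res P U T a"
    using eq by auto
  ultimately show ?thesis
    using a b by blast
qed

text \<open>A section of the associated sheaf is a family of germs that locally comes from sections; for a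
  sheaf these local sections are compatible by the previous lemma, and glue.\<close>

theorem sheafify_unit_iso:
  "iso_of_group_sheaves X P (sheafify X P) (sheafify_unit X P)"
proof (rule iso_of_group_sheavesI)
  show "sheaf_of_groups X P" ..
next
  fix U assume U: "openin X U"
  have "s \<in> sheafify_unit X P U ` carrier (sec P U)" if s: "s \<in> carrier (sec (sheafify X P) U)" for s
  proof -
    have ext: "s \<in> extensional U"
      and "\<forall>x\<in>U. \<exists>V a. openin X V \<and> x \<in> V \<and> V \<subseteq> U \<and> a \<in> carrier (sec P V) \<and>
        restrict s V = sheafify_unit X P V a"
      using s by (auto simp: sheafify_def)
    then obtain W a where W: "\<And>x. x \<in> U \<Longrightarrow> openin X (W x)" "\<And>x. x \<in> U \<Longrightarrow> x \<in> W x"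
      "\<And>x. x \<in> U \<Longrightarrow> W x \<subseteq> U" and a: "\<And>x. x \<in> U \<Longrightarrow> a x \<in> carrier (sec P (W x))"
      and eq: "\<And>x. x \<in> U \<Longrightarrow> restrict s (W x) = sheafify_unit X P (W x) (a x)"
      by metis
    have germ: "stalk_germ X P y (W x) (a x) = s y" if "x \<in> U" "y \<in> W x" for x y
      using fun_cong[OF eq[OF that(1)], of y] that by (simp add: sheafify_unit_def)
    \<comment> \<open>Local sections are indexed by points, the gluing axiom by open sets: choose a point for each.\<close>
    let ?\<U> = "W ` U"
    define pt where "pt T = (SOME x. x \<in> U \<and> W x = T)" for T
    have pt: "pt T \<in> U \<and> W (pt T) = T" if "T \<in> ?\<U>" for T
      unfolding pt_def by (rule someI_ex) (use that in auto)
    have Un: "\<Union>?\<U> = U"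
      using W by auto
    have op: "openin X T" if "T \<in> ?\<U>" for T
      using W that by auto
    have cl: "a (pt T) \<in> carrier (sec P T)" if "T \<in> ?\<U>" for T
      using a[of "pt T"] pt[OF that] by simp
    have germT: "stalk_germ X P y T (a (pt T)) = s y" if "T \<in> ?\<U>" "y \<in> T" for T y
      using germ[of "pt T" y] pt[OF that(1)] that(2) by simp
    have agree: "res P T (T \<inter> T') (a (pt T)) = res P T' (T \<inter> T') (a (pt T'))"
      if T: "T \<in> ?\<U>" "T' \<in> ?\<U>" for T T'
    proof -
      have o: "openin X (T \<inter> T')"
        using op T by blast
      show ?thesis
      proof (rule section_eqI[OF o])
        show "res P T (T \<inter> T') (a (pt T)) \<in> carrier (sec P (T \<inter> T'))"
          by (rule res_closed[OF op[OF T(1)] o _ cl[OF T(1)]]) simp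
        show "res P T' (T \<inter> T') (a (pt T')) \<in> carrier (sec P (T \<inter> T'))"
          by (rule res_closed[OF op[OF T(2)] o _ cl[OF T(2)]]) simp
        fix y assume y: "y \<in> T \<inter> T'"
        have "stalk_germ X P y (T \<inter> T') (res P T (T \<inter> T') (a (pt T))) = s y"
          using stalk_germ_res[OF op[OF T(1)] cl[OF T(1)] o _ y] germT[OF T(1)] y by simp
        moreover have "stalk_germ X P y (T \<inter> T') (res P T' (T \<inter> T') (a (pt T'))) = s y"
          using stalk_germ_res[OF op[OF T(2)] cl[OF T(2)] o _ y] germT[OF T(2)] y by simp
        ultimately show "stalk_germ X P y (T \<inter> T') (res P T (T \<inter> T') (a (pt T))) =
            stalk_germ X P y (T \<inter> T') (res P T' (T \<inter> T') (a (pt T')))"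
          by simp
      qed
    qed
    have "\<exists>!b. b \<in> carrier (sec P U) \<and> (\<forall>T\<in>?\<U>. res P U T b = a (pt T))"
      using ex1_glue[where \<U> = ?\<U> and s = "\<lambda>T. a (pt T)", OF op cl agree] unfolding Un by blast
    then obtain b where "b \<in> carrier (sec P U) \<and> (\<forall>T\<in>?\<U>. res P U T b = a (pt T))"
      by (rule ex1E)
    then have b: "b \<in> carrier (sec P U)" "\<And>T. T \<in> ?\<U> \<Longrightarrow> res P U T b = a (pt T)"
      by auto
    have "s x = sheafify_unit X P U b x" for x
    proof (cases "x \<in> U")
      case True
      then show ?thesis
        using stalk_germ_res[OF U b(1) W(1,3,2)[OF True]] b(2)[of "W x"] germT[of "W x" x] W
        by (simp add: sheafify_unit_def)
    next
      case False
      then show ?thesis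
        using ext by (simp add: sheafify_unit_def extensional_def)
    qed
    then show ?thesis
      using b(1) by blast
  qed
  moreover have "sheafify_unit X P U a \<in> carrier (sec (sheafify X P) U)" if "a \<in> carrier (sec P U)" for a
    using U that by (force simp: sheafify_def sheafify_unit_def)
  moreover have "inj_on (sheafify_unit X P U) (carrier (sec P U))"
  proof (rule inj_onI, rule section_eqI[OF U], assumption, assumption)
    fix a b x
    assume "sheafify_unit X P U a = sheafify_unit X P U b" "x \<in> U"
    then have "sheafify_unit X P U a x = sheafify_unit X P U b x"
      by simp
    with \<open>x \<in> U\<close> show "stalk_germ X P x U a = stalk_germ X P x U b"
      by (simp add: sheafify_unit_def)
  qed
  ultimately show "bij_betw (sheafify_unit X P U) (carrier (sec P U)) (carrier (sec (sheafify X P) U))"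
    by (auto simp: bij_betw_def)
next
  fix U a b assume U: "openin X U" and ab: "a \<in> carrier (sec P U)" "b \<in> carrier (sec P U)"
  show "sheafify_unit X P U (a \<otimes>\<^bsub>sec P U\<^esub> b) =
      sheafify_unit X P U a \<otimes>\<^bsub>sec (sheafify X P) U\<^esub> sheafify_unit X P U b"
    using stalk_mult_germ[OF U _ ab] by (auto simp: sheafify_def sheafify_unit_def fun_eq_iff)
next
  fix U assume "openin X U"
  show "sheafify_unit X P U \<one>\<^bsub>sec P U\<^esub> = \<one>\<^bsub>sec (sheafify X P) U\<^esub>"
    by (simp add: sheafify_def)
next
  fix U V a assume UV: "openin X U" "openin X V" "V \<subseteq> U" and a: "a \<in> carrier (sec P U)"
  show "res (sheafify X P) U V (sheafify_unit X P U a) = sheafify_unit X P V (res P U V a)"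
    using stalk_germ_res[OF UV(1) a UV(2,3)] UV(3) by (auto simp: sheafify_def sheafify_unit_def fun_eq_iff)
qed

end

subsection \<open>Quotients by a sheaf of normal subgroups\<close>

text \<open>The inverse of the isomorphism in the first isomorphism theorem, in terms of a section \<open>\<sigma>\<close> of
  \<open>\<psi>\<close> that is a mere map of sets. For \<open>\<sigma> f = 1 + f\<close> it is the map into the quotient studied below.\<close>

lemma section_coset_iso:
  assumes G: "group G" and L: "group L" and \<psi>: "\<psi> \<in> hom G L"
    and \<sigma>: "\<And>x. x \<in> carrier L \<Longrightarrow> \<sigma> x \<in> carrier G" "\<And>x. x \<in> carrier L \<Longrightarrow> \<psi> (\<sigma> x) = x"
  shows "(\<lambda>x. kernel G L \<psi> #>\<^bsub>G\<^esub> \<sigma> x) \<in> iso L (G Mod kernel G L \<psi>)"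
proof -
  interpret group_hom G L \<psi>
    using G L \<psi> by (simp add: group_hom_def group_hom_axioms_def)
  let ?H = "kernel G L \<psi>"
  have memI: "x \<otimes>\<^bsub>G\<^esub> inv\<^bsub>G\<^esub> y \<in> ?H" if "x \<in> carrier G" "y \<in> carrier G" "\<psi> x = \<psi> y" for x y
    using that by (simp add: kernel_def)
  have memD: "\<psi> x = \<psi> y" if "x \<in> carrier G" "y \<in> carrier G" "x \<otimes>\<^bsub>G\<^esub> inv\<^bsub>G\<^esub> y \<in> ?H" for x y
  proof -
    have "\<psi> x \<otimes>\<^bsub>L\<^esub> inv\<^bsub>L\<^esub> \<psi> y = \<one>\<^bsub>L\<^esub>"
      using that by (simp add: kernel_def)
    moreover have "\<psi> x = (\<psi> x \<otimes>\<^bsub>L\<^esub> inv\<^bsub>L\<^esub> \<psi> y) \<otimes>\<^bsub>L\<^esub> \<psi> y"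
      using that by (simp add: H.m_assoc)
    ultimately show ?thesis
      using that by simp
  qed
  interpret N: normal ?H G
    by (rule normal_kernel)
  have coset_eq: "?H #>\<^bsub>G\<^esub> x = ?H #>\<^bsub>G\<^esub> y" if "x \<in> carrier G" "y \<in> carrier G" "\<psi> x = \<psi> y" for x y
    using G.repr_independence[OF N.rcos_module_rev[OF G that(2,1) memI[OF that]] that(2) N.subgroup_axioms]
    by simp
  have coset_eqD: "\<psi> x = \<psi> y" if "x \<in> carrier G" "y \<in> carrier G" "?H #>\<^bsub>G\<^esub> x = ?H #>\<^bsub>G\<^esub> y" for x y
  proof (rule memD[OF that(1,2)], rule N.rcos_module_imp[OF G that(2)])
    show "x \<in> ?H #>\<^bsub>G\<^esub> y"
      using G.rcos_self[OF that(1) N.subgroup_axioms] that(3) by simp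
  qed
  show ?thesis
    unfolding iso_def bij_betw_def
  proof (intro CollectI conjI homI)
    fix x assume "x \<in> carrier L"
    then show "?H #>\<^bsub>G\<^esub> \<sigma> x \<in> carrier (G Mod ?H)"
      using \<sigma>(1) by (auto simp: FactGroup_def RCOSETS_def)
  next
    fix x y assume xy: "x \<in> carrier L" "y \<in> carrier L"
    have "?H #>\<^bsub>G\<^esub> \<sigma> (x \<otimes>\<^bsub>L\<^esub> y) = ?H #>\<^bsub>G\<^esub> (\<sigma> x \<otimes>\<^bsub>G\<^esub> \<sigma> y)"
      using xy \<sigma> by (intro coset_eq) auto
    then show "?H #>\<^bsub>G\<^esub> \<sigma> (x \<otimes>\<^bsub>L\<^esub> y) = (?H #>\<^bsub>G\<^esub> \<sigma> x) \<otimes>\<^bsub>G Mod ?H\<^esub> (?H #>\<^bsub>G\<^esub> \<sigma> y)"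
      using xy \<sigma>(1) by (simp add: N.rcos_sum)
  next
    show "inj_on (\<lambda>x. ?H #>\<^bsub>G\<^esub> \<sigma> x) (carrier L)"
    proof (rule inj_onI)
      fix x y assume xy: "x \<in> carrier L" "y \<in> carrier L" "?H #>\<^bsub>G\<^esub> \<sigma> x = ?H #>\<^bsub>G\<^esub> \<sigma> y"
      then have "\<psi> (\<sigma> x) = \<psi> (\<sigma> y)"
        using coset_eqD[OF \<sigma>(1) \<sigma>(1)] by blast
      then show "x = y"
        using xy \<sigma>(2) by simp
    qed
  next
    have "?H #>\<^bsub>G\<^esub> x \<in> (\<lambda>x. ?H #>\<^bsub>G\<^esub> \<sigma> x) ` carrier L" if "x \<in> carrier G" for x
      using that \<sigma> coset_eq[of x "\<sigma> (\<psi> x)"] by auto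
    then show "(\<lambda>x. ?H #>\<^bsub>G\<^esub> \<sigma> x) ` carrier L = carrier (G Mod ?H)"
      using \<sigma>(1) by (auto simp: FactGroup_def RCOSETS_def)
  qed
qed

text \<open>The image of a coset of \<open>J\<close> need not fill a coset of \<open>K\<close>; multiplying by \<open>K\<close> saturates it, and
  this is how the quotient presheaf restricts cosets.\<close>

lemma (in group_hom) subgroup_set_mult_image_coset:
  assumes H: "subgroup K H" and J: "subgroup J G" and sub: "h ` J \<subseteq> K" and x: "x \<in> carrier G"
  shows "K <#>\<^bsub>H\<^esub> h ` (J #>\<^bsub>G\<^esub> x) = K #>\<^bsub>H\<^esub> h x"
proof -
  interpret K: subgroup K H by (rule H)
  interpret J: subgroup J G by (rule J)
  show ?thesis
  proof (intro equalityI subsetI)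
    fix y assume "y \<in> K <#>\<^bsub>H\<^esub> h ` (J #>\<^bsub>G\<^esub> x)"
    then obtain k j where k: "k \<in> K" and j: "j \<in> J" and y: "y = k \<otimes>\<^bsub>H\<^esub> h (j \<otimes>\<^bsub>G\<^esub> x)"
      unfolding set_mult_def r_coset_def by blast
    have "h j \<in> K"
      using sub j by blast
    then have "y = (k \<otimes>\<^bsub>H\<^esub> h j) \<otimes>\<^bsub>H\<^esub> h x" "k \<otimes>\<^bsub>H\<^esub> h j \<in> K"
      using y k j x by (simp_all add: H.m_assoc)
    then show "y \<in> K #>\<^bsub>H\<^esub> h x"
      unfolding r_coset_def by blast
  next
    fix y assume "y \<in> K #>\<^bsub>H\<^esub> h x"
    then obtain k where k: "k \<in> K" and y: "y = k \<otimes>\<^bsub>H\<^esub> h x"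
      unfolding r_coset_def by blast
    have "y = k \<otimes>\<^bsub>H\<^esub> h (\<one>\<^bsub>G\<^esub> \<otimes>\<^bsub>G\<^esub> x)"
      using y x by simp
    then show "y \<in> K <#>\<^bsub>H\<^esub> h ` (J #>\<^bsub>G\<^esub> x)"
      unfolding set_mult_def r_coset_def using k J.one_closed by blast
  qed
qed

section \<open>Zeros and growth of theta functions\<close>

text \<open>The half of the theta series with \<open>m \<ge> 0\<close>, as an entire function of \<open>x = z / c\<close>.\<close>

definition half_theta :: "complex \<Rightarrow> complex \<Rightarrow> complex" where
  "half_theta q x = (\<Sum>n. inverse (q ^ (n * (n + 1) div 2)) * x ^ n)"

lemma triangle_Suc: "Suc n * (Suc n + 1) div 2 = n * (n + 1) div 2 + Suc n"
proof -
  have "Suc n * (Suc n + 1) = n * (n + 1) + 2 * Suc n"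
    by simp
  then show ?thesis
    by (metis div_mult_self2 zero_neq_numeral add.commute)
qed

lemma summable_half_theta:
  assumes "1 < cmod q"
  shows "summable (\<lambda>n. norm (inverse (q ^ (n * (n + 1) div 2)) * x ^ n))"
proof -
  have q0: "q \<noteq> 0"
    using assms by auto
  obtain N where N: "2 * cmod x < cmod q ^ N"
    using real_arch_pow[OF assms] by blast
  show ?thesis
  proof (rule summable_ratio_test[where c = "1/2" and N = N])
    fix n assume "N \<le> n"
    then have "cmod q ^ N \<le> cmod q ^ Suc n"
      using assms by (intro power_increasing) auto
    then have "2 * cmod x \<le> cmod q ^ Suc n"
      using N by simp
    then have le: "cmod x / cmod q ^ Suc n \<le> 1/2"
      using q0 by (simp add: field_simps)
    have "norm (inverse (q ^ (Suc n * (Suc n + 1) div 2)) * x ^ Suc n) =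
        (cmod x / cmod q ^ Suc n) * norm (inverse (q ^ (n * (n + 1) div 2)) * x ^ n)"
      unfolding triangle_Suc by (simp add: norm_mult norm_divide norm_inverse norm_power power_add divide_simps)
    also have "\<dots> \<le> 1/2 * norm (inverse (q ^ (n * (n + 1) div 2)) * x ^ n)"
      by (rule mult_right_mono[OF le]) simp
    finally show "norm (norm (inverse (q ^ (Suc n * (Suc n + 1) div 2)) * x ^ Suc n)) \<le>
        1/2 * norm (norm (inverse (q ^ (n * (n + 1) div 2)) * x ^ n))"
      by simp
  qed simp
qed

lemma half_theta_holomorphic:
  assumes "1 < cmod q"
  shows "half_theta q holomorphic_on A"
proof -
  have "summable (\<lambda>n. inverse (q ^ (n * (n + 1) div 2)) * y ^ n)" for y
    using summable_half_theta[OF assms, of y] by (rule summable_norm_cancel)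
  from termdiffs_strong_converges_everywhere[OF this]
  have "(half_theta q has_field_derivative
      (\<Sum>n. diffs (\<lambda>n. inverse (q ^ (n * (n + 1) div 2))) n * x ^ n)) (at x)" for x
    unfolding half_theta_def .
  then have "half_theta q field_differentiable (at x)" for x
    using field_differentiable_def by blast
  then show ?thesis
    by (simp add: field_differentiable_at_within holomorphic_on_def)
qed

lemma half_theta_0: "half_theta q 0 = 1"
proof -
  have "(\<lambda>n. inverse (q ^ (n * (n + 1) div 2)) * 0 ^ n) sums (inverse (q ^ (0 * (0 + 1) div 2)))"
    by (rule powser_sums_zero)
  then show ?thesis
    unfolding half_theta_def by (simp add: sums_iff)
qed

text \<open>The terms with negative index \<open>m = - n - 1\<close> form the same power series, because
  \<open>m (m + 1) = n (n + 1)\<close>.\<close>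

lemma theta_eq_half_theta:
  assumes q: "1 < cmod q" and c: "c \<noteq> 0" and z: "z \<noteq> 0"
  shows "theta q c z = half_theta q (z / c) + (c / z) * half_theta q (c / z)"
proof -
  let ?f = "\<lambda>m::int. q powi (- (m * (m + 1) div 2)) * (z / c) powi m"
  have half: "((\<lambda>n. inverse (q ^ (n * (n + 1) div 2)) * x ^ n) has_sum half_theta q x) (UNIV :: nat set)" for x
    unfolding half_theta_def
    by (rule norm_summable_imp_has_sum[OF summable_half_theta[OF q]])
      (rule summable_sums[OF summable_norm_cancel[OF summable_half_theta[OF q]]])
  have tri: "int n * (int n + 1) div 2 = int (n * (n + 1) div 2)" for n
    by (simp add: zdiv_int algebra_simps)
  have "?f (int n) = inverse (q ^ (n * (n + 1) div 2)) * (z / c) ^ n" for n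
    unfolding tri by (simp add: power_int_minus)
  then have "?f \<circ> int = (\<lambda>n. inverse (q ^ (n * (n + 1) div 2)) * (z / c) ^ n)"
    by (simp only: o_def)
  then have "((?f \<circ> int) has_sum half_theta q (z / c)) UNIV"
    using half[of "z / c"] by (simp only:)
  then have nonneg: "(?f has_sum half_theta q (z / c)) (range int)"
    by (subst has_sum_reindex) (auto simp: inj_on_def)
  let ?h = "\<lambda>n. - int n - 1"
  have "?f (?h n) = (c / z) * (inverse (q ^ (n * (n + 1) div 2)) * (c / z) ^ n)" for n
  proof -
    have "?h n * (?h n + 1) = int n * (int n + 1)"
      by (simp add: algebra_simps)
    then have *: "?h n * (?h n + 1) div 2 = int (n * (n + 1) div 2)"
      using tri by simp
    have "(z / c) powi ?h n = (z / c) powi (- int (Suc n))"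
      by (rule arg_cong[where f = "\<lambda>k. (z / c) powi k"]) simp
    also have "\<dots> = inverse ((z / c) ^ Suc n)"
      by (simp only: power_int_minus power_int_of_nat)
    also have "\<dots> = (c / z) ^ Suc n"
      using c z by (simp add: field_simps)
    finally show ?thesis
      unfolding * by (simp add: power_int_minus)
  qed
  then have "?f \<circ> ?h = (\<lambda>n. (c / z) * (inverse (q ^ (n * (n + 1) div 2)) * (c / z) ^ n))"
    by (simp only: o_def)
  then have "((?f \<circ> ?h) has_sum (c / z) * half_theta q (c / z)) UNIV"
    using has_sum_cmult_right[OF half[of "c / z"], of "c / z"] by (simp only:)
  then have neg: "(?f has_sum (c / z) * half_theta q (c / z)) (range ?h)"
    by (subst has_sum_reindex) (auto simp: inj_on_def)
  have "m \<in> range int \<union> range ?h" for m :: int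
  proof (cases "0 \<le> m")
    case True
    then show ?thesis by (auto simp: image_iff intro: exI[of _ "nat m"])
  next
    case False
    then have "m = ?h (nat (- m - 1))" by simp
    then show ?thesis by blast
  qed
  then have "range int \<union> range ?h = UNIV"
    by auto
  moreover have "range int \<inter> range ?h = {}"
    by auto
  ultimately have "(?f has_sum (half_theta q (z / c) + (c / z) * half_theta q (c / z))) UNIV"
    using has_sum_Un_disjoint[OF nonneg neg] by simp
  then show ?thesis
    unfolding theta_def by (rule infsumI)
qed

lemma theta_holomorphic:
  assumes q: "1 < cmod q" and c: "c \<noteq> 0"
  shows "theta q c holomorphic_on - {0}"
proof -
  have E: "(half_theta q \<circ> g) holomorphic_on - {0}" if "g holomorphic_on - {0}" for g
    by (rule holomorphic_on_compose[OF that half_theta_holomorphic[OF q]])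
  have "(\<lambda>z. half_theta q (z / c) + (c / z) * half_theta q (c / z)) holomorphic_on - {0}"
  proof (intro holomorphic_on_add holomorphic_on_mult)
    have "(\<lambda>z. z / c) holomorphic_on - {0}" "(\<lambda>z. c / z) holomorphic_on - {0}"
      using c by (auto intro!: holomorphic_intros)
    then show "(\<lambda>z. half_theta q (z / c)) holomorphic_on - {0}" "(\<lambda>z. c / z) holomorphic_on - {0}"
      "(\<lambda>z. half_theta q (c / z)) holomorphic_on - {0}"
      using E[of "\<lambda>z. z / c"] E[of "\<lambda>z. c / z"] by (auto simp: o_def)
  qed
  then show ?thesis
    by (rule holomorphic_transform) (simp add: theta_eq_half_theta[OF q c])
qed

text \<open>If the theta function vanished identically, the entire function \<open>half_theta q\<close> would tend
  to \<open>0\<close> at infinity, contradicting Liouville's theorem.\<close>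

lemma theta_nonzero:
  assumes q: "1 < cmod q" and c: "c \<noteq> 0"
  shows "\<exists>z. z \<noteq> 0 \<and> theta q c z \<noteq> 0"
proof (rule ccontr)
  assume "\<not> ?thesis"
  then have zero: "theta q c z = 0" if "z \<noteq> 0" for z
    using that by blast
  have eq: "half_theta q x = - (inverse x * half_theta q (inverse x))" if "x \<noteq> 0" for x
    using zero[of "c * x"] that c theta_eq_half_theta[OF q c, of "c * x"]
    by (simp add: field_simps eq_neg_iff_add_eq_0)
  have "isCont (half_theta q) 0"
    using half_theta_holomorphic[OF q, of UNIV]
    by (metis continuous_on_eq_continuous_at holomorphic_on_imp_continuous_on open_UNIV UNIV_I)
  then have "((\<lambda>x. half_theta q (inverse x)) \<longlongrightarrow> half_theta q 0) at_infinity"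
    by (rule isCont_tendsto_compose) (rule tendsto_inverse_0)
  then have "((\<lambda>x. - (inverse x * half_theta q (inverse x))) \<longlongrightarrow> - (0 * half_theta q 0)) at_infinity"
    by (intro tendsto_intros tendsto_inverse_0)
  moreover have "eventually (\<lambda>x. - (inverse x * half_theta q (inverse x)) = half_theta q x) at_infinity"
    unfolding eventually_at_infinity
  proof (intro exI[of _ 1] allI impI)
    fix x :: complex assume "1 \<le> cmod x"
    then have "x \<noteq> 0"
      by auto
    then show "- (inverse x * half_theta q (inverse x)) = half_theta q x"
      by (rule eq[symmetric])
  qed
  ultimately have "(half_theta q \<longlongrightarrow> 0) at_infinity"
    by (simp add: tendsto_cong)
  from Liouville_weak_0[OF half_theta_holomorphic[OF q] this, of 0] show False
    by (simp add: half_theta_0)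
qed

lemma countable_theta_zeros:
  assumes q: "1 < cmod q" and c: "c \<noteq> 0"
  shows "countable {z. z \<noteq> 0 \<and> theta q c z = 0}"
proof (cases "theta q c constant_on - {0}")
  case True
  then obtain y where y: "\<And>z. z \<noteq> 0 \<Longrightarrow> theta q c z = y"
    by (auto simp: constant_on_def)
  obtain z where "z \<noteq> 0" "theta q c z \<noteq> 0"
    using theta_nonzero[OF q c] by blast
  then have "{z. z \<noteq> 0 \<and> theta q c z = 0} = {}"
    using y by auto
  then show ?thesis by (metis countable_empty)
next
  case False
  have "connected (- {0::complex})"
    by (rule connected_punctured_universe) simp
  moreover have "fsigma (- {0::complex})"
  proof -
    have "x = 0" if "\<And>n. x \<in> ball 0 (inverse (real (Suc n)))" for x :: complex
    proof (rule ccontr)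
      assume "x \<noteq> 0"
      then obtain n where "inverse (real (Suc n)) < cmod x"
        using reals_Archimedean[of "cmod x"] by auto
      with that[of n] show False
        by simp
    qed
    then have "{0::complex} = (\<Inter>n. ball 0 (inverse (real (Suc n))))"
      by auto
    moreover have "gdelta (\<Inter>n. ball (0::complex) (inverse (real (Suc n))))"
      by (rule gdelta.intros) simp
    ultimately have "gdelta {0::complex}"
      by (simp only:)
    then show ?thesis
      by (rule gdelta_imp_fsigma)
  qed
  ultimately have "countable {z \<in> - {0}. theta q c z = 0}"
    using holomorphic_countable_zeros[OF theta_holomorphic[OF q c] _ _ _ False]
    by (simp add: open_Compl)
  then show ?thesis by simp
qed

text \<open>Multiplying \<open>z\<close> by \<open>q\<close> shifts the index of summation by one.\<close>

lemma theta_q: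
  assumes q: "q \<noteq> 0" and c: "c \<noteq> 0" and z: "z \<noteq> 0"
  shows "theta q c (q * z) = (z / c) * theta q c z"
proof -
  let ?f = "\<lambda>m::int. q powi (- (m * (m + 1) div 2)) * (z / c) powi m"
  have "q powi (- (m * (m + 1) div 2)) * (q * z / c) powi m = (z / c) * ?f (m - 1)" for m
  proof -
    have "m * (m + 1) = (m - 1) * (m - 1 + 1) + 2 * m"
      by (simp add: algebra_simps)
    then have "m * (m + 1) div 2 = (m - 1) * (m - 1 + 1) div 2 + m"
      by (metis div_mult_self2 zero_neq_numeral add.commute)
    then have "q powi (- (m * (m + 1) div 2)) * q powi m = q powi (- ((m - 1) * (m - 1 + 1) div 2))"
      using q by (simp flip: power_int_add)
    moreover have "(q * z / c) powi m = q powi m * ((z / c) * (z / c) powi (m - 1))"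
    proof -
      have "(q * z / c) powi m = q powi m * (z / c) powi m"
        by (simp flip: power_int_mult_distrib)
      also have "(z / c) powi m = (z / c) powi (1 + (m - 1))"
        by simp
      also have "\<dots> = (z / c) * (z / c) powi (m - 1)"
        using c z by (subst power_int_add) auto
      finally show ?thesis .
    qed
    ultimately show ?thesis
      by (simp add: mult_ac)
  qed
  then have "theta q c (q * z) = (\<Sum>\<^sub>\<infinity>m\<in>UNIV. (z / c) * ?f (m - 1))"
    unfolding theta_def by simp
  also have "\<dots> = (z / c) * (\<Sum>\<^sub>\<infinity>m\<in>UNIV. ?f (m - 1))"
    by (rule infsum_cmult_right')
  also have "(\<Sum>\<^sub>\<infinity>m\<in>UNIV. ?f (m - 1)) = infsum ?f UNIV"
    by (rule infsum_reindex_bij_betw) (rule bij_betw_byWitness[where f' = "\<lambda>m. m + 1"], auto)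
  finally show ?thesis
    unfolding theta_def .
qed

section \<open>Sectors and their germs\<close>

locale q_scaling =
  fixes q :: complex
  assumes q_gt_1: "1 < cmod q"
begin

lemma q_nonzero [simp]: "q \<noteq> 0"
  using q_gt_1 by auto

lemma Eq_proj_eq_iff: "Eq_proj q z = Eq_proj q w \<longleftrightarrow> (\<exists>m::int. w = q powi m * z)"
proof
  assume "Eq_proj q z = Eq_proj q w"
  moreover have "w \<in> Eq_proj q w"
    unfolding Eq_proj_def by (rule range_eqI[of _ _ 0]) simp
  ultimately show "\<exists>m::int. w = q powi m * z"
    by (auto simp: Eq_proj_def)
next
  assume "\<exists>m::int. w = q powi m * z"
  then obtain m :: int where w: "w = q powi m * z" ..
  have "q powi l * w = q powi (l + m) * z" for l
    using w by (simp add: power_int_add)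
  moreover have "q powi l * z = q powi (l - m) * w" for l
    using w by (simp add: power_int_diff)
  ultimately show "Eq_proj q z = Eq_proj q w"
    unfolding Eq_proj_def by (metis (no_types, lifting) image_cong image_subset_iff rangeI subset_antisym)
qed

lemma Eq_proj_mult_q [simp]: "Eq_proj q (q * z) = Eq_proj q z"
  using Eq_proj_eq_iff[of z "q * z"] by (metis power_int_1_right)

lemma Eq_proj_divide_q [simp]: "Eq_proj q (z / q) = Eq_proj q z"
  using Eq_proj_mult_q[of "z / q"] by simp

lemma Eq_proj_divide_q_power [simp]: "Eq_proj q (z / q ^ m) = Eq_proj q z"
proof (induction m)
  case (Suc m)
  have "z / q ^ Suc m = z / q ^ m / q"
    by (simp add: mult.commute)
  then show ?case
    using Suc Eq_proj_divide_q[of "z / q ^ m"] by (simp only:)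
qed simp

lemma Eq_preimage_nonzero: "z \<in> Eq_preimage q V \<Longrightarrow> z \<noteq> 0"
  by (simp add: Eq_preimage_def)

lemma Eq_preimage_mult_q: "q * z \<in> Eq_preimage q V \<longleftrightarrow> z \<in> Eq_preimage q V"
  by (simp add: Eq_preimage_def)

lemma Eq_preimage_divide_q: "z / q \<in> Eq_preimage q V \<longleftrightarrow> z \<in> Eq_preimage q V"
  by (simp add: Eq_preimage_def)

lemma Eq_preimage_divide_q_power: "z / q ^ m \<in> Eq_preimage q V \<longleftrightarrow> z \<in> Eq_preimage q V"
  by (simp add: Eq_preimage_def)

lemma Eq_preimage_mono: "V \<subseteq> U \<Longrightarrow> Eq_preimage q V \<subseteq> Eq_preimage q U"
  by (auto simp: Eq_preimage_def)

lemma Eq_preimage_Int: "Eq_preimage q (U \<inter> V) = Eq_preimage q U \<inter> Eq_preimage q V"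
  by (auto simp: Eq_preimage_def)

lemma Eq_preimage_Union: "Eq_preimage q (\<Union>\<U>) = (\<Union>U\<in>\<U>. Eq_preimage q U)"
  by (auto simp: Eq_preimage_def)

lemma open_Eq_preimage: "openin (Eq_space q) V \<Longrightarrow> open (Eq_preimage q V)"
  by (simp add: openin_Eq_space)

lemma sector_open: "sector q W V \<Longrightarrow> open W"
  by (simp add: sector_def)

lemma sector_divide_q: "sector q W V \<Longrightarrow> z \<in> W \<Longrightarrow> z / q \<in> W"
  by (simp add: sector_def)

lemma sector_divide_q_power: "sector q W V \<Longrightarrow> z \<in> W \<Longrightarrow> z / q ^ m \<in> W"
proof (induction m)
  case (Suc m)
  have "z / q ^ Suc m = z / q ^ m / q"
    by (simp add: mult.commute)
  then show ?case
    using sector_divide_q[OF Suc.prems(1) Suc.IH[OF Suc.prems]] by (simp only:)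
qed simp

lemma sector_divide_q_power_mono:
  assumes "sector q W V" "z / q ^ m \<in> W" "m \<le> m'"
  shows "z / q ^ m' \<in> W"
proof -
  have "q ^ m' = q ^ m * q ^ (m' - m)"
    using assms(3) by (simp flip: power_add)
  then have "z / q ^ m' = z / q ^ m / q ^ (m' - m)"
    by simp
  then show ?thesis
    using sector_divide_q_power[OF assms(1,2), of "m' - m"] by (simp only:)
qed

lemma sector_subset: "sector q W V \<Longrightarrow> W \<subseteq> Eq_preimage q V"
  by (auto simp: sector_def Eq_preimage_def)

lemma sector_horizon_subset: "sector q W V \<Longrightarrow> V \<subseteq> Eq_proj q ` (- {0})"
  by (auto simp: sector_def)

text \<open>Some point of the orbit of \<open>z\<close> lies in \<open>W\<close>, and with it the whole tail of the orbit towards \<open>0\<close>.\<close>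

lemma sector_absorbs:
  assumes W: "sector q W V" and z: "z \<in> Eq_preimage q V"
  obtains m :: nat where "z / q ^ m \<in> W"
proof -
  obtain w where w: "w \<in> W" "Eq_proj q z = Eq_proj q w"
    using W z by (auto simp: sector_def Eq_preimage_def)
  then obtain l :: int where l: "w = q powi l * z"
    using Eq_proj_eq_iff by blast
  have "z / q ^ nat (- l) = w / q ^ nat l"
  proof (cases "0 \<le> l")
    case True
    then show ?thesis
      using l by (simp add: power_int_def)
  next
    case False
    then show ?thesis
      using l by (simp add: power_int_def divide_simps)
  qed
  then show thesis
    using that sector_divide_q_power[OF W w(1)] by metis
qed

lemma sectorI:
  assumes "open W" "W \<subseteq> Eq_preimage q V" "\<And>z. z \<in> W \<Longrightarrow> z / q \<in> W" "V \<subseteq> Eq_proj q ` (- {0})"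
    and "\<And>z. z \<in> Eq_preimage q V \<Longrightarrow> \<exists>m::nat. z / q ^ m \<in> W"
  shows "sector q W V"
proof -
  have "v \<in> Eq_proj q ` W" if v: "v \<in> V" for v
  proof -
    obtain z where z: "v = Eq_proj q z" "z \<noteq> 0"
      using v assms(4) by blast
    then have "z \<in> Eq_preimage q V"
      using v by (simp add: Eq_preimage_def)
    then obtain m where m: "z / q ^ m \<in> W"
      using assms(5) by blast
    have "v = Eq_proj q (z / q ^ m)"
      using z by simp
    then show ?thesis
      using m by blast
  qed
  then show ?thesis
    using assms(1-3) by (auto simp: sector_def Eq_preimage_def)
qed

lemma sector_Eq_preimage: "openin (Eq_space q) V \<Longrightarrow> sector q (Eq_preimage q V) V"
  by (rule sectorI) (auto simp: openin_Eq_space Eq_preimage_divide_q Eq_preimage_divide_q_power)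

lemma sector_horizon_open: "sector q W V \<Longrightarrow> openin (Eq_space q) V"
proof -
  assume W: "sector q W V"
  have "Eq_preimage q V = (\<Union>m. (\<lambda>z. z / q ^ m) -` W)"
  proof (intro equalityI subsetI)
    fix z assume "z \<in> Eq_preimage q V"
    then show "z \<in> (\<Union>m. (\<lambda>z. z / q ^ m) -` W)"
      by (rule sector_absorbs[OF W]) auto
  next
    fix z assume "z \<in> (\<Union>m. (\<lambda>z. z / q ^ m) -` W)"
    then obtain m where "z / q ^ m \<in> W"
      by auto
    then show "z \<in> Eq_preimage q V"
      using sector_subset[OF W] Eq_preimage_divide_q_power by blast
  qed
  moreover have "open ((\<lambda>z. z / q ^ m) -` W)" for m
    by (intro open_vimage continuous_intros sector_open[OF W]) auto
  ultimately show ?thesis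
    using sector_horizon_subset[OF W] by (auto simp: openin_Eq_space)
qed

text \<open>Both sectors contain the tail of every orbit of the horizon, so the horizon does not shrink.\<close>

lemma sector_Int:
  assumes W: "sector q W V" and W': "sector q W' V"
  shows "sector q (W \<inter> W') V"
proof (rule sectorI)
  fix z assume z: "z \<in> Eq_preimage q V"
  obtain m where m: "z / q ^ m \<in> W"
    by (rule sector_absorbs[OF W z])
  obtain m' where m': "z / q ^ m' \<in> W'"
    by (rule sector_absorbs[OF W' z])
  have "z / q ^ max m m' \<in> W" "z / q ^ max m m' \<in> W'"
    using sector_divide_q_power_mono[OF W m] sector_divide_q_power_mono[OF W' m'] by simp_all
  then show "\<exists>m. z / q ^ m \<in> W \<inter> W'"
    by blast
qed (use sector_open[OF W] sector_open[OF W'] sector_subset[OF W] sector_divide_q[OF W]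
    sector_divide_q[OF W'] sector_horizon_subset[OF W] in auto)

lemma sector_finite_Int:
  assumes "finite I" "\<And>i. i \<in> I \<Longrightarrow> sector q (W i) V" "sector q W0 V"
  shows "\<exists>W'. sector q W' V \<and> W' \<subseteq> W0 \<and> (\<forall>i\<in>I. W' \<subseteq> W i)"
  using assms(1,2)
proof (induction I rule: finite_induct)
  case empty
  then show ?case
    using assms(3) by blast
next
  case (insert i I)
  then obtain W' where W': "sector q W' V" "W' \<subseteq> W0" "\<forall>i\<in>I. W' \<subseteq> W i"
    by auto
  moreover have "sector q (W' \<inter> W i) V"
    using W'(1) insert.prems by (intro sector_Int) auto
  ultimately show ?case
    by (intro exI[of _ "W' \<inter> W i"]) auto
qed

lemma sector_scale:
  assumes W: "sector q W V"
  shows "sector q ((\<lambda>z. z / q) ` W) V"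
proof (rule sectorI)
  have "(\<lambda>z. z / q) ` W = (\<lambda>z. q * z) -` W"
    by (auto simp: image_iff field_simps intro!: bexI[of _ "q * _"])
  then show "open ((\<lambda>z. z / q) ` W)"
    using sector_open[OF W] by (auto intro!: open_vimage continuous_intros)
  fix z assume "z \<in> Eq_preimage q V"
  then obtain m where "z / q ^ m \<in> W"
    by (rule sector_absorbs[OF W])
  then have "z / q ^ m / q \<in> (\<lambda>z. z / q) ` W"
    by blast
  moreover have "z / q ^ m / q = z / q ^ Suc m"
    by (simp add: mult.commute)
  ultimately show "\<exists>m. z / q ^ m \<in> (\<lambda>z. z / q) ` W"
    by metis
qed (use sector_subset[OF W] sector_divide_q[OF W] sector_horizon_subset[OF W] Eq_preimage_divide_q in auto)

lemma sector_restrict: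
  assumes W: "sector q W U" and V: "openin (Eq_space q) V" "V \<subseteq> U"
  shows "sector q (W \<inter> Eq_preimage q V) V"
proof (rule sectorI)
  show "open (W \<inter> Eq_preimage q V)"
    using sector_open[OF W] open_Eq_preimage[OF V(1)] by blast
  show "V \<subseteq> Eq_proj q ` (- {0})"
    using V(1) by (simp add: openin_Eq_space)
  fix z assume z: "z \<in> Eq_preimage q V"
  then have "z \<in> Eq_preimage q U"
    using Eq_preimage_mono[OF V(2)] by blast
  then obtain m where "z / q ^ m \<in> W"
    by (rule sector_absorbs[OF W])
  then show "\<exists>m. z / q ^ m \<in> W \<inter> Eq_preimage q V"
    using z Eq_preimage_divide_q_power by blast
qed (use sector_divide_q[OF W] Eq_preimage_divide_q in auto)

lemma sgerm_memI: "sector q W V \<Longrightarrow> (W, f) \<in> sgerm q V W f"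
  by (auto simp: sgerm_def)

text \<open>The relation defining germs is transitive because sectors with a common horizon intersect in
  such a sector. Consequently the unions over representatives in the operations on germs are
  unions of equal sets, which the lemmas that follow evaluate.\<close>

lemma sgerm_eqI:
  assumes W: "sector q W V" and W': "sector q W' V"
    and W'': "sector q W'' V" "W'' \<subseteq> W \<inter> W'" "\<And>z. z \<in> W'' \<Longrightarrow> f z = g z"
  shows "sgerm q V W f = sgerm q V W' g"
proof -
  have sub: "sgerm q V W f \<subseteq> sgerm q V W' g"
    if W'': "sector q W'' V" "W'' \<subseteq> W \<inter> W'" "\<And>z. z \<in> W'' \<Longrightarrow> f z = g z" for W W' f g
  proof (clarsimp simp: sgerm_def)
    fix T h T'
    assume T: "sector q T V" "sector q T' V" "T' \<subseteq> W" "T' \<subseteq> T" "\<forall>z\<in>T'. f z = h z"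
    have "\<forall>z\<in>W'' \<inter> T'. g z = h z"
      using T W'' by (metis IntD1 IntD2)
    then show "\<exists>W''. sector q W'' V \<and> W'' \<subseteq> W' \<and> W'' \<subseteq> T \<and> (\<forall>z\<in>W''. g z = h z)"
      using sector_Int[OF W''(1) T(2)] W''(2) T(4) by blast
  qed
  show ?thesis
  proof (rule subset_antisym)
    show "sgerm q V W f \<subseteq> sgerm q V W' g"
      by (rule sub[OF W''])
    show "sgerm q V W' g \<subseteq> sgerm q V W f"
      by (rule sub[OF W''(1)]) (use W''(2,3) in auto)
  qed
qed

lemma sgerm_eqD:
  assumes "sector q W V" "sector q W' V" "sgerm q V W f = sgerm q V W' g"
  obtains W'' where "sector q W'' V" "W'' \<subseteq> W \<inter> W'" "\<And>z. z \<in> W'' \<Longrightarrow> f z = g z"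
proof -
  have "(W', g) \<in> sgerm q V W f"
    using sgerm_memI[OF assms(2), of g] assms(3) by simp
  then show thesis
    using that by (auto simp: sgerm_def)
qed

lemma sgerm_memD:
  assumes "(W', g) \<in> sgerm q V W f"
  obtains W'' where "sector q W' V" "sector q W'' V" "W'' \<subseteq> W \<inter> W'" "\<And>z. z \<in> W'' \<Longrightarrow> f z = g z"
  using assms by (auto simp: sgerm_def)

lemma UN_eqI:
  assumes "p \<in> s" "\<And>p'. p' \<in> s \<Longrightarrow> F p' = T"
  shows "(\<Union>p'\<in>s. F p') = T"
  using assms by auto

lemma sgerm_map_sgerm:
  assumes W: "sector q W V"
  shows "sgerm_map q V \<phi> (sgerm q V W f) = sgerm q V W (\<lambda>z. \<phi> z (f z))"
  unfolding sgerm_map_def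
proof (rule UN_eqI[OF sgerm_memI[OF W]], clarify)
  fix W' g assume "(W', g) \<in> sgerm q V W f"
  then obtain W'' where W'': "sector q W' V" "sector q W'' V" "W'' \<subseteq> W \<inter> W'" "\<And>z. z \<in> W'' \<Longrightarrow> f z = g z"
    by (rule sgerm_memD) blast
  show "sgerm q V W' (\<lambda>z. \<phi> z (g z)) = sgerm q V W (\<lambda>z. \<phi> z (f z))"
    by (rule sgerm_eqI[OF W''(1) W W''(2)]) (use W'' in auto)
qed

lemma sgerm_map2_sgerm:
  assumes W: "sector q W V" and W': "sector q W' V"
  shows "sgerm_map2 q V \<phi> (sgerm q V W f) (sgerm q V W' g) = sgerm q V (W \<inter> W') (\<lambda>z. \<phi> (f z) (g z))"
  unfolding sgerm_map2_def
proof (rule UN_eqI[OF sgerm_memI[OF W]], clarify, rule UN_eqI[OF sgerm_memI[OF W']], clarify)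
  fix T f' T' g' assume f': "(T, f') \<in> sgerm q V W f" and g': "(T', g') \<in> sgerm q V W' g"
  from f' obtain S where S: "sector q T V" "sector q S V" "S \<subseteq> W \<inter> T" "\<And>z. z \<in> S \<Longrightarrow> f z = f' z"
    by (rule sgerm_memD) blast
  from g' obtain S' where S': "sector q T' V" "sector q S' V" "S' \<subseteq> W' \<inter> T'" "\<And>z. z \<in> S' \<Longrightarrow> g z = g' z"
    by (rule sgerm_memD) blast
  show "sgerm q V (T \<inter> T') (\<lambda>z. \<phi> (f' z) (g' z)) = sgerm q V (W \<inter> W') (\<lambda>z. \<phi> (f z) (g z))"
    by (rule sgerm_eqI[OF sector_Int[OF S(1) S'(1)] sector_Int[OF W W'] sector_Int[OF S(2) S'(2)]])
      (use S S' in auto)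
qed

lemma sgerm_sigma_sgerm:
  assumes W: "sector q W V"
  shows "sgerm_sigma q V (sgerm q V W f) = sgerm q V ((\<lambda>z. z / q) ` W) (\<lambda>z. f (q * z))"
  unfolding sgerm_sigma_def
proof (rule UN_eqI[OF sgerm_memI[OF W]], clarify)
  fix W' g assume "(W', g) \<in> sgerm q V W f"
  then obtain W'' where W'': "sector q W' V" "sector q W'' V" "W'' \<subseteq> W \<inter> W'" "\<And>z. z \<in> W'' \<Longrightarrow> f z = g z"
    by (rule sgerm_memD) blast
  show "sgerm q V ((\<lambda>z. z / q) ` W') (\<lambda>z. g (q * z)) = sgerm q V ((\<lambda>z. z / q) ` W) (\<lambda>z. f (q * z))"
    by (rule sgerm_eqI[OF sector_scale[OF W''(1)] sector_scale[OF W] sector_scale[OF W''(2)]])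
      (use W'' in auto)
qed

lemma sgerm_res_sgerm:
  assumes W: "sector q W U" and V: "openin (Eq_space q) V" "V \<subseteq> U"
  shows "sgerm_res q U V (sgerm q U W f) = sgerm q V (W \<inter> Eq_preimage q V) f"
  unfolding sgerm_res_def
proof (rule UN_eqI[OF sgerm_memI[OF W]], clarify)
  fix W' g assume "(W', g) \<in> sgerm q U W f"
  then obtain W'' where W'': "sector q W' U" "sector q W'' U" "W'' \<subseteq> W \<inter> W'" "\<And>z. z \<in> W'' \<Longrightarrow> f z = g z"
    by (rule sgerm_memD) blast
  show "sgerm q V (W' \<inter> Eq_preimage q V) g = sgerm q V (W \<inter> Eq_preimage q V) f"
    by (rule sgerm_eqI[OF sector_restrict[OF W''(1) V] sector_restrict[OF W V] sector_restrict[OF W''(2) V]])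
      (use W'' in auto)
qed

abbreviation full_germ :: "complex set set \<Rightarrow> (complex \<Rightarrow> 'm) \<Rightarrow> 'm sgerm" where
  "full_germ V F \<equiv> sgerm q V (Eq_preimage q V) F"

text \<open>Every point of the preimage is reached from the sector by finitely many multiplications by \<open>q\<close>.\<close>

lemma sector_induct:
  assumes W: "sector q W V" and z: "z \<in> Eq_preimage q V" and base: "\<And>w. w \<in> W \<Longrightarrow> \<Phi> w"
    and step: "\<And>w. w \<in> Eq_preimage q V \<Longrightarrow> \<Phi> w \<Longrightarrow> \<Phi> (q * w)"
  shows "\<Phi> z"
proof -
  have *: "\<Phi> z" if "z \<in> Eq_preimage q V" "z / q ^ m \<in> W" for m z
    using that
  proof (induction m arbitrary: z)
    case 0
    then show ?case
      using base by simp
  next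
    case (Suc m)
    have "\<Phi> (z / q)"
      using Suc.prems by (intro Suc.IH) (simp_all add: Eq_preimage_divide_q)
    then show ?case
      using step[of "z / q"] Suc.prems by (simp add: Eq_preimage_divide_q)
  qed
  show ?thesis
    using sector_absorbs[OF W z] * z by blast
qed

lemma qdown_in_sector: "sector q W V \<Longrightarrow> K \<subseteq> W \<Longrightarrow> qdown q K \<subseteq> W"
  using sector_divide_q_power by (auto simp: qdown_def)

lemma scale_tendsto_0: "(\<lambda>m. z / q ^ m) \<longlonglongrightarrow> 0"
proof -
  have "(\<lambda>m. z * inverse q ^ m) \<longlonglongrightarrow> z * 0"
    using q_gt_1 by (intro tendsto_mult_left LIMSEQ_power_zero) (simp add: norm_inverse inverse_less_1_iff)
  then show ?thesis
    by (simp add: field_simps power_inverse)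
qed

text \<open>The translates \<open>K / q\<^sup>m\<close> enter the disc of radius \<open>\<epsilon>\<close> after finitely many steps, and from
  then on \<open>v\<close> decreases along each orbit; so compactness of finitely many translates suffices.\<close>

lemma sector_continuous_bounded_qdown:
  fixes v :: "complex \<Rightarrow> real"
  assumes W: "sector q W V" and cont: "continuous_on W v" and K: "compact K" "K \<subseteq> W" and \<epsilon>: "0 < \<epsilon>"
    and decr: "\<And>w. w \<in> W \<Longrightarrow> cmod w \<le> \<epsilon> \<Longrightarrow> q * w \<in> W \<Longrightarrow> v w \<le> v (q * w)"
  shows "\<exists>B. \<forall>w\<in>qdown q K. v w \<le> B"
proof -
  have inW: "z / q ^ m \<in> W" if "z \<in> K" for z m
    using sector_divide_q_power[OF W] K(2) that by blast
  have "\<exists>B. \<forall>z\<in>K. v (z / q ^ m) \<le> B" for m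
  proof -
    have "continuous_on K (\<lambda>z. v (z / q ^ m))"
      by (rule continuous_on_compose2[OF cont]) (use inW in \<open>auto intro!: continuous_intros\<close>)
    then have "bounded ((\<lambda>z. v (z / q ^ m)) ` K)"
      using K(1) by (intro compact_imp_bounded compact_continuous_image)
    then obtain B where "\<forall>x\<in>(\<lambda>z. v (z / q ^ m)) ` K. norm x \<le> B"
      unfolding bounded_iff by blast
    then show ?thesis
      by (intro exI[of _ B]) (auto simp: abs_le_iff)
  qed
  then obtain B where B: "\<And>z m. z \<in> K \<Longrightarrow> v (z / q ^ m) \<le> B m"
    by metis
  obtain R where R: "\<And>z. z \<in> K \<Longrightarrow> cmod z \<le> R"
    using compact_imp_bounded[OF K(1)] by (auto simp: bounded_iff)
  obtain m0 where m0: "R / \<epsilon> < cmod q ^ m0"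
    using real_arch_pow[OF q_gt_1] by blast
  have small: "cmod (z / q ^ m) \<le> \<epsilon>" if "z \<in> K" "m0 \<le> m" for z m
  proof -
    have "R / \<epsilon> < cmod q ^ m"
      using m0 power_increasing[OF that(2), of "cmod q"] q_gt_1 by linarith
    then have "cmod z \<le> \<epsilon> * cmod q ^ m"
      using R[OF that(1)] \<epsilon> by (simp add: field_simps)
    then show ?thesis
      using q_gt_1 by (simp add: norm_divide norm_power divide_le_eq)
  qed
  have late: "v (z / q ^ (m0 + j)) \<le> B m0" if "z \<in> K" for z j
  proof (induction j)
    case 0
    then show ?case
      using B[OF that] by simp
  next
    case (Suc j)
    have "q * (z / q ^ (m0 + Suc j)) = z / q ^ (m0 + j)"
      by simp
    moreover have "v (z / q ^ (m0 + Suc j)) \<le> v (q * (z / q ^ (m0 + Suc j)))"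
    proof (rule decr[OF inW[OF that] small[OF that]])
      show "q * (z / q ^ (m0 + Suc j)) \<in> W"
        unfolding calculation by (rule inW[OF that])
    qed simp
    ultimately have "v (z / q ^ (m0 + Suc j)) \<le> v (z / q ^ (m0 + j))"
      by (simp only:)
    with Suc show ?case
      by linarith
  qed
  have "v (z / q ^ m) \<le> (\<Sum>m\<le>m0. \<bar>B m\<bar>)" if z: "z \<in> K" for z m
  proof -
    have "v (z / q ^ m) \<le> \<bar>B (min m m0)\<bar>"
      using B[OF z, of m] late[OF z, of "m - m0"] by (cases "m \<le> m0") (simp_all add: min_def)
    also have "\<dots> \<le> (\<Sum>m\<le>m0. \<bar>B m\<bar>)"
      by (rule member_le_sum) auto
    finally show ?thesis .
  qed
  then have "v w \<le> (\<Sum>m\<le>m0. \<bar>B m\<bar>)" if "w \<in> qdown q K" for w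
    using that unfolding qdown_def by blast
  then show ?thesis
    by blast
qed

lemma theta_orbit:
  assumes c: "c \<noteq> 0" and z: "z \<noteq> 0"
  shows "cmod (theta q c (z / q ^ m)) = cmod c ^ m * (\<Prod>l=1..m. cmod (q ^ l / z)) * cmod (theta q c z)"
proof (induction m)
  case (Suc m)
  let ?w = "z / q ^ Suc m"
  have "theta q c (q * ?w) = (?w / c) * theta q c ?w"
    using c z by (intro theta_q) auto
  moreover have "q * ?w = z / q ^ m"
    by simp
  ultimately have "theta q c ?w = c * (q ^ Suc m / z) * theta q c (z / q ^ m)"
    using c z by (simp add: field_simps)
  then have "cmod (theta q c ?w) = cmod c * cmod (q ^ Suc m / z) * cmod (theta q c (z / q ^ m))"
    by (simp only: norm_mult)
  moreover have "(\<Prod>l=1..Suc m. cmod (q ^ l / z)) = (\<Prod>l=1..m. cmod (q ^ l / z)) * cmod (q ^ Suc m / z)"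
    by simp
  ultimately show ?case
    by (simp only: Suc power_Suc[of "cmod c"] mult_ac)
qed simp

end

section \<open>Block diagonal matrices\<close>

definition block_offset :: "(nat \<Rightarrow> nat) \<Rightarrow> nat \<Rightarrow> nat" where
  "block_offset r i = (\<Sum>l=1..<i. r l)"

text \<open>Rows and columns are numbered from \<open>0\<close>, blocks from \<open>1\<close>: index \<open>a\<close> belongs to the first block whose
  end exceeds it.\<close>

definition block_of :: "(nat \<Rightarrow> nat) \<Rightarrow> nat \<Rightarrow> nat" where
  "block_of r a = (LEAST i. a < (\<Sum>l=1..i. r l))"

definition diag_blocks :: "nat \<Rightarrow> (nat \<Rightarrow> complex mat) \<Rightarrow> complex mat" where
  "diag_blocks k f = diag_block_mat (map f [1..<Suc k])"

lemma A0_mat_eq_diag_blocks: "A0_mat k \<mu> A z = diag_blocks k (\<lambda>i. z powi (- \<mu> i) \<cdot>\<^sub>m A i)"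
  by (simp add: A0_mat_def diag_blocks_def)

lemma total_rank_0 [simp]: "total_rank 0 r = 0"
  by (simp add: total_rank_def)

lemma total_rank_Suc: "total_rank (Suc k) r = total_rank k r + r (Suc k)"
  by (simp add: total_rank_def)

lemma block_offset_Suc_eq_total_rank: "block_offset r (Suc k) = total_rank k r"
  by (simp add: block_offset_def total_rank_def atLeastLessThanSuc_atLeastAtMost)

lemma block_offset_add_le_total_rank:
  assumes "i \<in> {1..k}"
  shows "block_offset r i + r i \<le> total_rank k r"
proof -
  have "block_offset r i + r i = (\<Sum>l\<in>{1..i}. r l)"
    using assms by (simp add: block_offset_def flip: atLeastLessThanSuc_atLeastAtMost)
  also have "\<dots> \<le> total_rank k r"
    unfolding total_rank_def using assms by (intro sum_mono2) auto
  finally show ?thesis .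
qed

lemma block_of_offset_add:
  assumes i: "1 \<le> i" and a: "a < r i"
  shows "block_of r (block_offset r i + a) = i"
  unfolding block_of_def
proof (rule Least_equality)
  have "(\<Sum>l=1..i. r l) = block_offset r i + r i"
    using i by (simp add: block_offset_def flip: atLeastLessThanSuc_atLeastAtMost)
  then show "block_offset r i + a < (\<Sum>l=1..i. r l)"
    using a by simp
next
  fix j assume j: "block_offset r i + a < (\<Sum>l=1..j. r l)"
  show "i \<le> j"
  proof (rule ccontr)
    assume "\<not> i \<le> j"
    then have "(\<Sum>l=1..j. r l) \<le> block_offset r i"
      unfolding block_offset_def by (intro sum_mono2) auto
    with j show False
      by simp
  qed
qed

lemma index_block_cases:
  assumes "a < total_rank k r"
  obtains i a' where "i \<in> {1..k}" "a' < r i" "a = block_offset r i + a'"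
proof -
  have "\<exists>i a'. i \<in> {1..k} \<and> a' < r i \<and> a = block_offset r i + a'"
    using assms
  proof (induction k)
    case (Suc k)
    show ?case
    proof (cases "a < total_rank k r")
      case True
      then show ?thesis
        using Suc.IH by fastforce
    next
      case False
      then show ?thesis
        using Suc.prems
        by (intro exI[of _ "Suc k"] exI[of _ "a - total_rank k r"])
          (auto simp: total_rank_Suc block_offset_Suc_eq_total_rank)
    qed
  qed simp
  then show thesis
    using that by blast
qed

lemma block_of_range: "a < total_rank k r \<Longrightarrow> block_of r a \<in> {1..k}"
  by (erule index_block_cases) (simp add: block_of_offset_add)

lemma block_of_mono:
  assumes "b \<le> a" "a < total_rank k r"
  shows "block_of r b \<le> block_of r a"
proof -
  obtain i a' where "i \<in> {1..k}" "a' < r i" "a = block_offset r i + a'"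
    using index_block_cases[OF assms(2)] .
  then have "a < (\<Sum>l=1..i. r l)" and i: "block_of r a = i"
    using block_of_offset_add[of i a' r]
    by (simp_all add: block_offset_def flip: atLeastLessThanSuc_atLeastAtMost)
  then have "b < (\<Sum>l=1..i. r l)"
    using assms(1) by simp
  then show ?thesis
    unfolding i unfolding block_of_def by (rule Least_le)
qed

lemma diag_blocks_0: "diag_blocks 0 f = 0\<^sub>m 0 0"
  by (simp add: diag_blocks_def)

lemma diag_blocks_Suc:
  "diag_blocks (Suc k) f = four_block_mat (diag_blocks k f)
     (0\<^sub>m (dim_row (diag_blocks k f)) (dim_col (f (Suc k))))
     (0\<^sub>m (dim_row (f (Suc k))) (dim_col (diag_blocks k f))) (f (Suc k))"
  unfolding diag_blocks_def by (simp add: diag_block_mat_last Let_def)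

lemma diag_blocks_carrier:
  "(\<And>i. i \<in> {1..k} \<Longrightarrow> f i \<in> carrier_mat (r i) (r i)) \<Longrightarrow>
    diag_blocks k f \<in> carrier_mat (total_rank k r) (total_rank k r)"
proof (induction k)
  case (Suc k)
  then have "diag_blocks k f \<in> carrier_mat (total_rank k r) (total_rank k r)"
    by simp
  then show ?case
    using Suc.prems[of "Suc k"] by (simp add: diag_blocks_Suc total_rank_Suc)
qed (simp add: diag_blocks_0)

text \<open>Used for the explicit inverse of \<open>A\<^sub>0\<close>, which is again block diagonal.\<close>

lemma diag_blocks_mult:
  assumes "\<And>i. i \<in> {1..k} \<Longrightarrow> f i \<in> carrier_mat (r i) (r i)"
    and "\<And>i. i \<in> {1..k} \<Longrightarrow> g i \<in> carrier_mat (r i) (r i)"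
    and "\<And>i. i \<in> {1..k} \<Longrightarrow> f i * g i = 1\<^sub>m (r i)"
  shows "diag_blocks k f * diag_blocks k g = 1\<^sub>m (total_rank k r)"
  using assms
proof (induction k)
  case 0
  have "0\<^sub>m 0 0 = (1\<^sub>m 0 :: complex mat)"
    by (rule eq_matI) auto
  then show ?case
    by (simp add: diag_blocks_0)
next
  case (Suc k)
  let ?n = "total_rank k r" and ?m = "r (Suc k)"
  have F: "diag_blocks k f \<in> carrier_mat ?n ?n" and G: "diag_blocks k g \<in> carrier_mat ?n ?n"
    using Suc.prems by (auto intro: diag_blocks_carrier)
  have f: "f (Suc k) \<in> carrier_mat ?m ?m" and g: "g (Suc k) \<in> carrier_mat ?m ?m"
    and fg: "f (Suc k) * g (Suc k) = 1\<^sub>m ?m"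
    using Suc.prems by auto
  have FG: "diag_blocks k f * diag_blocks k g = 1\<^sub>m ?n"
    using Suc.IH Suc.prems by simp
  have "diag_blocks (Suc k) f * diag_blocks (Suc k) g =
      four_block_mat (diag_blocks k f) (0\<^sub>m ?n ?m) (0\<^sub>m ?m ?n) (f (Suc k)) *
      four_block_mat (diag_blocks k g) (0\<^sub>m ?n ?m) (0\<^sub>m ?m ?n) (g (Suc k))"
    using F G f g by (simp add: diag_blocks_Suc)
  also have "\<dots> = four_block_mat (1\<^sub>m ?n) (0\<^sub>m ?n ?m) (0\<^sub>m ?m ?n) (1\<^sub>m ?m)"
    by (subst mult_four_block_mat[OF F _ _ f G _ _ g]) (use F G f g FG fg in auto)
  finally show ?case
    by (simp add: total_rank_Suc)
qed

lemma diag_blocks_index: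
  assumes "\<And>i. i \<in> {1..k} \<Longrightarrow> f i \<in> carrier_mat (r i) (r i)"
    and "i \<in> {1..k}" "j \<in> {1..k}" "a < r i" "b < r j"
  shows "diag_blocks k f $$ (block_offset r i + a, block_offset r j + b) =
    (if i = j then f i $$ (a, b) else 0)"
  using assms
proof (induction k)
  case (Suc k)
  let ?n = "total_rank k r" and ?m = "r (Suc k)"
  have F: "diag_blocks k f \<in> carrier_mat ?n ?n"
    using Suc.prems by (auto intro: diag_blocks_carrier)
  have f: "f (Suc k) \<in> carrier_mat ?m ?m"
    using Suc.prems by auto
  have lt: "block_offset r i + a < ?n" if "i \<in> {1..k}" "a < r i" for i a
    using block_offset_add_le_total_rank[OF that(1), of r] that(2) by simp
  have lt': "block_offset r i + a < ?n + ?m" if "i \<in> {1..Suc k}" "a < r i" for i a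
    using block_offset_add_le_total_rank[OF that(1), of r] that(2) by (simp add: total_rank_Suc)
  have 1: "block_offset r i + a < ?n + ?m" "block_offset r j + b < ?n + ?m"
    using lt' Suc.prems by auto
  have 2: "diag_blocks (Suc k) f $$ (block_offset r i + a, block_offset r j + b) =
    (if block_offset r i + a < ?n then
      if block_offset r j + b < ?n then diag_blocks k f $$ (block_offset r i + a, block_offset r j + b) else 0
      else if block_offset r j + b < ?n then 0
      else f (Suc k) $$ (block_offset r i + a - ?n, block_offset r j + b - ?n))"
    using F f 1 by (simp add: diag_blocks_Suc)
  show ?case
  proof (cases "i = Suc k")
    case True
    then show ?thesis
      using 2 lt[of j b] Suc.prems(3,5)
      by (cases "j = Suc k") (auto simp: block_offset_Suc_eq_total_rank)
  next
    case False
    then have i: "i \<in> {1..k}"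
      using Suc.prems by auto
    show ?thesis
    proof (cases "j = Suc k")
      case True
      then show ?thesis
        using 2 lt[OF i Suc.prems(4)] False by (simp add: block_offset_Suc_eq_total_rank)
    next
      case False
      then have j: "j \<in> {1..k}"
        using Suc.prems by auto
      show ?thesis
        using 2 lt[OF i Suc.prems(4)] lt[OF j Suc.prems(5)] Suc.IH[OF _ i j Suc.prems(4,5)] Suc.prems(1)
        by simp
    qed
  qed
qed simp

text \<open>Choosing a sector, a theta function or a bound for each entry of a matrix.\<close>

lemma choice_less2:
  assumes "\<And>a b. a < n \<Longrightarrow> b < n \<Longrightarrow> \<exists>x. Q a b x"
  shows "\<exists>f. \<forall>a<n. \<forall>b<n. Q a b (f a b)"
proof -
  have "\<forall>a b. \<exists>x. a < n \<longrightarrow> b < n \<longrightarrow> Q a b x"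
    using assms by blast
  then have "\<exists>f. \<forall>a b. a < n \<longrightarrow> b < n \<longrightarrow> Q a b (f a b)"
    by metis
  then show ?thesis
    by blast
qed

lemma triple_mult_index:
  fixes A B F :: "complex mat"
  assumes "A \<in> carrier_mat n n" "F \<in> carrier_mat n n" "B \<in> carrier_mat n n" "a < n" "b < n"
  shows "(A * F * B) $$ (a, b) = (\<Sum>c<n. \<Sum>d<n. A $$ (a, c) * F $$ (c, d) * B $$ (d, b))"
proof -
  have "A * F * B = A * (F * B)"
    using assms by (intro assoc_mult_mat[of _ n n _ n _ n]) auto
  then show ?thesis
    using assms by (simp add: scalar_prod_def lessThan_atLeast0 sum_distrib_left mult.assoc)
qed

section \<open>Matrices with a prescribed block pattern\<close>

text \<open>Patterns are relations between blocks. All the sheaves considered here, \<open>\<lambda>\<^sub>I\<close>, the steps of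
  its filtration and their graded pieces, consist of matrices supported in such a pattern.\<close>

definition pattern_mats :: "nat \<Rightarrow> (nat \<Rightarrow> nat) \<Rightarrow> (nat \<Rightarrow> nat \<Rightarrow> bool) \<Rightarrow> complex mat set" where
  "pattern_mats k r S = {M \<in> carrier_mat (total_rank k r) (total_rank k r).
     \<forall>a<total_rank k r. \<forall>b<total_rank k r. \<not> S (block_of r a) (block_of r b) \<longrightarrow> M $$ (a, b) = 0}"

definition unipotent_mats :: "nat \<Rightarrow> (nat \<Rightarrow> nat) \<Rightarrow> (nat \<Rightarrow> nat \<Rightarrow> bool) \<Rightarrow> complex mat set" where
  "unipotent_mats k r S = (\<lambda>M. 1\<^sub>m (total_rank k r) + M) ` pattern_mats k r S"

locale block_structure =
  fixes k :: nat and r :: "nat \<Rightarrow> nat"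
begin

abbreviation n where "n \<equiv> total_rank k r"
abbreviation bl where "bl \<equiv> block_of r"
abbreviation pmat where "pmat \<equiv> pattern_mats k r"
abbreviation umat where "umat \<equiv> unipotent_mats k r"

lemma pattern_mats_carrier: "M \<in> pmat S \<Longrightarrow> M \<in> carrier_mat n n"
  by (simp add: pattern_mats_def)

lemma pattern_mats_zero: "0\<^sub>m n n \<in> pmat S"
  by (simp add: pattern_mats_def)

lemma pattern_mats_add: "M \<in> pmat S \<Longrightarrow> N \<in> pmat S \<Longrightarrow> M + N \<in> pmat S"
  by (auto simp: pattern_mats_def)

lemma pattern_mats_uminus: "M \<in> pmat S \<Longrightarrow> - M \<in> pmat S"
  by (auto simp: pattern_mats_def)

lemma pattern_mats_mono: "M \<in> pmat S \<Longrightarrow> (\<And>i j. i \<in> {1..k} \<Longrightarrow> j \<in> {1..k} \<Longrightarrow> S i j \<Longrightarrow> T i j) \<Longrightarrow> M \<in> pmat T"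
  using block_of_range[of _ k r] unfolding pattern_mats_def mem_Collect_eq by blast

lemma pattern_mats_mult:
  assumes "M \<in> pmat S" "N \<in> pmat T"
    and "\<And>i j l. i \<in> {1..k} \<Longrightarrow> j \<in> {1..k} \<Longrightarrow> l \<in> {1..k} \<Longrightarrow> S i j \<Longrightarrow> T j l \<Longrightarrow> R i l"
  shows "M * N \<in> pmat R"
proof -
  have c: "M \<in> carrier_mat n n" "N \<in> carrier_mat n n"
    using assms by (auto simp: pattern_mats_def)
  have "(M * N) $$ (a, b) = 0" if ab: "a < n" "b < n" "\<not> R (bl a) (bl b)" for a b
  proof -
    have "M $$ (a, l) * N $$ (l, b) = 0" if "l < n" for l
    proof (cases "S (bl a) (bl l)")
      case True
      then have "\<not> T (bl l) (bl b)"
        using assms(3)[of "bl a" "bl l" "bl b"] block_of_range ab that by blast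
      then show ?thesis
        using assms(2) ab that by (simp add: pattern_mats_def)
    next
      case False
      then show ?thesis
        using assms(1) ab that by (simp add: pattern_mats_def)
    qed
    then have "(\<Sum>l = 0..<n. M $$ (a, l) * N $$ (l, b)) = 0"
      by (intro sum.neutral) simp
    then show ?thesis
      using c ab by (simp add: scalar_prod_def)
  qed
  then show ?thesis
    using c by (simp add: pattern_mats_def)
qed

lemma unipotent_mats_carrier: "M \<in> umat S \<Longrightarrow> M \<in> carrier_mat n n"
  by (auto simp: unipotent_mats_def pattern_mats_carrier)

lemma unipotent_mats_one: "1\<^sub>m n \<in> umat S"
  unfolding unipotent_mats_def using pattern_mats_zero[of S] by (rule rev_image_eqI) simp

lemma unipotent_mats_mono:
  "M \<in> umat S \<Longrightarrow> (\<And>i j. i \<in> {1..k} \<Longrightarrow> j \<in> {1..k} \<Longrightarrow> S i j \<Longrightarrow> T i j) \<Longrightarrow> M \<in> umat T"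
  unfolding unipotent_mats_def using pattern_mats_mono by blast

lemma unipotent_product_expand:
  fixes X Y :: "complex mat"
  assumes "X \<in> carrier_mat n n" "Y \<in> carrier_mat n n"
  shows "(1\<^sub>m n + X) * (1\<^sub>m n + Y) = 1\<^sub>m n + (X + Y + X * Y)"
proof -
  have "(1\<^sub>m n + X) * (1\<^sub>m n + Y) = 1\<^sub>m n * (1\<^sub>m n + Y) + X * (1\<^sub>m n + Y)"
    using assms by (intro add_mult_distrib_mat[where nr = n and n = n and nc = n]) auto
  also have "X * (1\<^sub>m n + Y) = X * 1\<^sub>m n + X * Y"
    using assms by (intro mult_add_distrib_mat[where nr = n and n = n and nc = n]) auto
  also have "1\<^sub>m n * (1\<^sub>m n + Y) + (X * 1\<^sub>m n + X * Y) = 1\<^sub>m n + (X + Y + X * Y)"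
  proof -
    have "1\<^sub>m n + Y \<in> carrier_mat n n"
      using assms by simp
    then have "1\<^sub>m n * (1\<^sub>m n + Y) = 1\<^sub>m n + Y"
      by (rule left_mult_one_mat)
    moreover have "X * 1\<^sub>m n = X"
      using assms(1) by (rule right_mult_one_mat)
    moreover have "1\<^sub>m n + Y + (X + X * Y) = 1\<^sub>m n + (X + Y + X * Y)"
      using assms by (intro eq_matI) auto
    ultimately show ?thesis
      by simp
  qed
  finally show ?thesis .
qed

lemma unipotent_mats_mult:
  assumes "M \<in> umat S" "N \<in> umat S"
    and trans: "\<And>i j l. i \<in> {1..k} \<Longrightarrow> j \<in> {1..k} \<Longrightarrow> l \<in> {1..k} \<Longrightarrow> S i j \<Longrightarrow> S j l \<Longrightarrow> S i l"
  shows "M * N \<in> umat S"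
proof -
  obtain X Y where X: "X \<in> pmat S" "M = 1\<^sub>m n + X" and Y: "Y \<in> pmat S" "N = 1\<^sub>m n + Y"
    using assms(1,2) by (auto simp: unipotent_mats_def)
  have "X + Y + X * Y \<in> pmat S"
    using pattern_mats_mult[OF X(1) Y(1) trans] X Y by (intro pattern_mats_add) auto
  then show ?thesis
    unfolding X(2) Y(2) unipotent_product_expand[OF pattern_mats_carrier[OF X(1)] pattern_mats_carrier[OF Y(1)]]
      unipotent_mats_def by (rule imageI)
qed

text \<open>The conjugate of \<open>1 + X\<close> is \<open>1 + G X G\<^sup>-\<^sup>1\<close>, and the pattern \<open>S\<close> is a two-sided ideal for \<open>T\<close>.\<close>

lemma unipotent_mats_conjugate:
  assumes "G \<in> umat T" "G' \<in> umat T" "M \<in> umat S" and inv: "G * G' = 1\<^sub>m n"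
    and left: "\<And>i j l. i \<in> {1..k} \<Longrightarrow> j \<in> {1..k} \<Longrightarrow> l \<in> {1..k} \<Longrightarrow> T i j \<Longrightarrow> S j l \<Longrightarrow> S i l"
    and right: "\<And>i j l. i \<in> {1..k} \<Longrightarrow> j \<in> {1..k} \<Longrightarrow> l \<in> {1..k} \<Longrightarrow> S i j \<Longrightarrow> T j l \<Longrightarrow> S i l"
  shows "G * M * G' \<in> umat S"
proof -
  obtain X Y Y' where X: "X \<in> pmat S" "M = 1\<^sub>m n + X" and Y: "Y \<in> pmat T" "G = 1\<^sub>m n + Y"
    and Y': "Y' \<in> pmat T" "G' = 1\<^sub>m n + Y'"
    using assms(1-3) by (auto simp: unipotent_mats_def)
  note c = pattern_mats_carrier[OF X(1)] pattern_mats_carrier[OF Y(1)] pattern_mats_carrier[OF Y'(1)]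
  have GX: "G * X = X + Y * X"
    unfolding Y(2) using c by (subst add_mult_distrib_mat[where nr = n and n = n and nc = n]) auto
  then have GX_in: "G * X \<in> pmat S"
    using pattern_mats_add[OF X(1) pattern_mats_mult[OF Y(1) X(1) left]] by simp
  have "G * X * G' = G * X + G * X * Y'"
    unfolding Y'(2) using c pattern_mats_carrier[OF GX_in]
    by (subst mult_add_distrib_mat[where nr = n and n = n and nc = n]) auto
  then have conj_in: "G * X * G' \<in> pmat S"
    using pattern_mats_add[OF GX_in pattern_mats_mult[OF GX_in Y'(1) right]] by simp
  have cG: "G \<in> carrier_mat n n" "G' \<in> carrier_mat n n"
    using c Y Y' by auto
  have "G * M = G + G * X"
    unfolding X(2) using c cG by (subst mult_add_distrib_mat[where nr = n and n = n and nc = n]) auto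
  then have "G * M * G' = 1\<^sub>m n + G * X * G'"
    using c cG inv by (simp add: add_mult_distrib_mat[where nr = n and n = n and nc = n])
  then show ?thesis
    using conj_in by (simp add: unipotent_mats_def)
qed

subsection \<open>Inverses\<close>

text \<open>Partial sums of the Neumann series of \<open>(1 + X)\<^sup>-\<^sup>1\<close>, in Horner form, so that they depend
  polynomially on \<open>X\<close>.\<close>

fun neumann :: "complex mat \<Rightarrow> nat \<Rightarrow> complex mat" where
  "neumann X 0 = 1\<^sub>m n"
| "neumann X (Suc m) = 1\<^sub>m n + - (X * neumann X m)"

lemma neumann_carrier: "X \<in> carrier_mat n n \<Longrightarrow> neumann X m \<in> carrier_mat n n"
  by (induction m) auto

lemma neumann_unipotent:
  assumes X: "X \<in> pmat S"
    and trans: "\<And>i j l. i \<in> {1..k} \<Longrightarrow> j \<in> {1..k} \<Longrightarrow> l \<in> {1..k} \<Longrightarrow> S i j \<Longrightarrow> S j l \<Longrightarrow> S i l"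
  shows "neumann X m \<in> umat S"
proof (induction m)
  case 0
  then show ?case
    by (simp add: unipotent_mats_one)
next
  case (Suc m)
  then obtain Y where Y: "Y \<in> pmat S" "neumann X m = 1\<^sub>m n + Y"
    by (auto simp: unipotent_mats_def)
  have "X * neumann X m = X + X * Y"
    unfolding Y(2) using pattern_mats_carrier[OF X] pattern_mats_carrier[OF Y(1)]
    by (subst mult_add_distrib_mat[where nr = n and n = n and nc = n]) auto
  then have "- (X * neumann X m) \<in> pmat S"
    using pattern_mats_uminus[OF pattern_mats_add[OF X pattern_mats_mult[OF X Y(1) trans]]] by simp
  then show ?case
    by (simp add: unipotent_mats_def)
qed

text \<open>The error of the \<open>m\<close>-th partial sum is \<open>\<plusminus>X\<^bsup>m+1\<^esup>\<close>, which for a strictly upper triangular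
  matrix lives above the \<open>m\<close>-th superdiagonal.\<close>

lemma neumann_inverse:
  assumes X: "X \<in> pmat S" and strict: "\<And>i j. i \<in> {1..k} \<Longrightarrow> j \<in> {1..k} \<Longrightarrow> S i j \<Longrightarrow> i < j"
  shows "(1\<^sub>m n + X) * neumann X n = 1\<^sub>m n"
proof -
  have c: "X \<in> carrier_mat n n"
    by (rule pattern_mats_carrier[OF X])
  have tri: "X $$ (a, b) = 0" if "a < n" "b < n" "b \<le> a" for a b
  proof -
    have "\<not> S (bl a) (bl b)"
      using strict[of "bl a" "bl b"] block_of_range[OF that(1)] block_of_range[OF that(2)]
        block_of_mono[OF that(3,1)] by auto
    then show ?thesis
      using X that by (simp add: pattern_mats_def)
  qed
  have "\<exists>R\<in>carrier_mat n n. (1\<^sub>m n + X) * neumann X m = 1\<^sub>m n + R \<and>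
      (\<forall>a<n. \<forall>b<n. b \<le> a + m \<longrightarrow> R $$ (a, b) = 0)" for m
  proof (induction m)
    case 0
    show ?case
      using c tri by (intro bexI[of _ X]) auto
  next
    case (Suc m)
    then obtain R where R: "R \<in> carrier_mat n n" "(1\<^sub>m n + X) * neumann X m = 1\<^sub>m n + R"
      and Rz: "\<And>a b. a < n \<Longrightarrow> b < n \<Longrightarrow> b \<le> a + m \<Longrightarrow> R $$ (a, b) = 0"
      by blast
    let ?N = "neumann X m"
    have N: "?N \<in> carrier_mat n n"
      by (rule neumann_carrier[OF c])
    have comm: "(1\<^sub>m n + X) * X = X * (1\<^sub>m n + X)"
      using c by (simp add: add_mult_distrib_mat[where nr = n and n = n and nc = n]
          mult_add_distrib_mat[where nr = n and n = n and nc = n])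
    have "(1\<^sub>m n + X) * (X * ?N) = X * ((1\<^sub>m n + X) * ?N)"
      using c N comm assoc_mult_mat[of "1\<^sub>m n + X" n n X n ?N n] assoc_mult_mat[of X n n "1\<^sub>m n + X" n ?N n]
      by simp
    also have "\<dots> = X + X * R"
      unfolding R(2) using c R(1) by (subst mult_add_distrib_mat[where nr = n and n = n and nc = n]) auto
    finally have XN: "(1\<^sub>m n + X) * (X * ?N) = X + X * R" .
    have "(1\<^sub>m n + X) * neumann X (Suc m) = (1\<^sub>m n + X) * 1\<^sub>m n + (1\<^sub>m n + X) * - (X * ?N)"
      using c N by (simp add: mult_add_distrib_mat[where nr = n and n = n and nc = n])
    also have "(1\<^sub>m n + X) * - (X * ?N) = - ((1\<^sub>m n + X) * (X * ?N))"
      using c N by (intro eq_matI) auto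
    also have "(1\<^sub>m n + X) * 1\<^sub>m n + - ((1\<^sub>m n + X) * (X * ?N)) = 1\<^sub>m n + - (X * R)"
      unfolding XN using c R(1) by (intro eq_matI) (auto simp del: index_mult_mat(1))
    finally have "(1\<^sub>m n + X) * neumann X (Suc m) = 1\<^sub>m n + - (X * R)" .
    moreover have "(X * R) $$ (a, b) = 0" if ab: "a < n" "b < n" "b \<le> a + Suc m" for a b
    proof -
      have "X $$ (a, l) * R $$ (l, b) = 0" if "l < n" for l
        using tri[OF ab(1) that] Rz[OF that ab(2)] ab(3) by (cases "l \<le> a") auto
      then have "(\<Sum>l = 0..<n. X $$ (a, l) * R $$ (l, b)) = 0"
        by (intro sum.neutral) simp
      then show ?thesis
        using c R(1) ab by (simp add: scalar_prod_def)
    qed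
    ultimately show ?case
      using c R(1) by (intro bexI[of _ "- (X * R)"]) auto
  qed
  then obtain R where "R \<in> carrier_mat n n" "(1\<^sub>m n + X) * neumann X n = 1\<^sub>m n + R"
    "\<forall>a<n. \<forall>b<n. b \<le> a + n \<longrightarrow> R $$ (a, b) = 0"
    by blast
  then show ?thesis
    by (intro eq_matI) (auto simp: trans_le_add2)
qed

subsection \<open>Parts of a matrix and conjugation by block diagonal matrices\<close>

definition pattern_part :: "(nat \<Rightarrow> nat \<Rightarrow> bool) \<Rightarrow> complex mat \<Rightarrow> complex mat" where
  "pattern_part S M = mat n n (\<lambda>(a, b). if S (bl a) (bl b) then M $$ (a, b) else 0)"

lemma pattern_part_carrier [simp]: "pattern_part S M \<in> carrier_mat n n"
  by (simp add: pattern_part_def)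

lemma pattern_part_index [simp]:
  "a < n \<Longrightarrow> b < n \<Longrightarrow> pattern_part S M $$ (a, b) = (if S (bl a) (bl b) then M $$ (a, b) else 0)"
  by (simp add: pattern_part_def)

lemma pattern_part_in: "pattern_part S M \<in> pmat S"
  by (simp add: pattern_mats_def)

lemma pattern_mats_iff: "M \<in> pmat S \<longleftrightarrow> M \<in> carrier_mat n n \<and> pattern_part S M = M"
proof
  assume "M \<in> pmat S"
  then show "M \<in> carrier_mat n n \<and> pattern_part S M = M"
    unfolding pattern_mats_def by (auto intro!: eq_matI simp: pattern_part_def)
next
  assume "M \<in> carrier_mat n n \<and> pattern_part S M = M"
  then show "M \<in> pmat S"
    using pattern_part_in[of S M] by simp
qed

definition block_diagonal :: "complex mat \<Rightarrow> bool" where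
  "block_diagonal B \<longleftrightarrow> B \<in> carrier_mat n n \<and> (\<forall>a<n. \<forall>b<n. bl a \<noteq> bl b \<longrightarrow> B $$ (a, b) = 0)"

text \<open>Block diagonal matrices do not move entries between blocks. Hence the equation of a solution
  passes to each of its block patterns.\<close>

lemma pattern_part_mult_block_diagonal:
  assumes B: "block_diagonal B" and M: "M \<in> carrier_mat n n"
  shows "pattern_part S (M * B) = pattern_part S M * B"
    and "pattern_part S (B * M) = B * pattern_part S M"
proof -
  have c: "B \<in> carrier_mat n n"
    using B by (simp add: block_diagonal_def)
  have d: "B $$ (a, b) = 0" if "a < n" "b < n" "bl a \<noteq> bl b" for a b
    using B that by (simp add: block_diagonal_def)
  show "pattern_part S (M * B) = pattern_part S M * B"
  proof (rule eq_matI)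
    fix a b assume "a < dim_row (pattern_part S M * B)" "b < dim_col (pattern_part S M * B)"
    then have ab: "a < n" "b < n"
      using c by (auto simp: pattern_part_def)
    have "(if S (bl a) (bl b) then M $$ (a, l) * B $$ (l, b) else 0) =
        (if S (bl a) (bl l) then M $$ (a, l) else 0) * B $$ (l, b)" if "l < n" for l
      using d[OF that ab(2)] by (cases "bl l = bl b") auto
    then have "(\<Sum>l = 0..<n. if S (bl a) (bl b) then M $$ (a, l) * B $$ (l, b) else 0) =
        (\<Sum>l = 0..<n. (if S (bl a) (bl l) then M $$ (a, l) else 0) * B $$ (l, b))"
      by (intro sum.cong) auto
    then show "pattern_part S (M * B) $$ (a, b) = (pattern_part S M * B) $$ (a, b)"
      using ab c M by (cases "S (bl a) (bl b)") (simp_all add: scalar_prod_def pattern_part_def)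
  qed (use c in \<open>auto simp: pattern_part_def\<close>)
  show "pattern_part S (B * M) = B * pattern_part S M"
  proof (rule eq_matI)
    fix a b assume "a < dim_row (B * pattern_part S M)" "b < dim_col (B * pattern_part S M)"
    then have ab: "a < n" "b < n"
      using c by (auto simp: pattern_part_def)
    have "(if S (bl a) (bl b) then B $$ (a, l) * M $$ (l, b) else 0) =
        B $$ (a, l) * (if S (bl l) (bl b) then M $$ (l, b) else 0)" if "l < n" for l
      using d[OF ab(1) that] by (cases "bl a = bl l") auto
    then have "(\<Sum>l = 0..<n. if S (bl a) (bl b) then B $$ (a, l) * M $$ (l, b) else 0) =
        (\<Sum>l = 0..<n. B $$ (a, l) * (if S (bl l) (bl b) then M $$ (l, b) else 0))"
      by (intro sum.cong) auto
    then show "pattern_part S (B * M) $$ (a, b) = (B * pattern_part S M) $$ (a, b)"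
      using ab c M by (cases "S (bl a) (bl b)") (simp_all add: scalar_prod_def pattern_part_def)
  qed (use c in \<open>auto simp: pattern_part_def\<close>)
qed

lemma A0_mat_carrier:
  "(\<And>i. i \<in> {1..k} \<Longrightarrow> A i \<in> carrier_mat (r i) (r i)) \<Longrightarrow> A0_mat k \<mu> A z \<in> carrier_mat n n"
  unfolding A0_mat_eq_diag_blocks by (rule diag_blocks_carrier) simp

lemma A0_mat_index:
  assumes A: "\<And>i. i \<in> {1..k} \<Longrightarrow> A i \<in> carrier_mat (r i) (r i)" and ab: "a < n" "b < n"
  shows "A0_mat k \<mu> A z $$ (a, b) = z powi (- \<mu> (bl a)) * A0_mat k \<mu> A 1 $$ (a, b)"
    and "bl a \<noteq> bl b \<Longrightarrow> A0_mat k \<mu> A z $$ (a, b) = 0"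
proof -
  obtain i a' where i: "i \<in> {1..k}" "a' < r i" "a = block_offset r i + a'"
    using index_block_cases[OF ab(1)] .
  obtain j b' where j: "j \<in> {1..k}" "b' < r j" "b = block_offset r j + b'"
    using index_block_cases[OF ab(2)] .
  have bl: "bl a = i" "bl b = j"
    using i j by (auto simp: block_of_offset_add)
  have *: "A0_mat k \<mu> A z $$ (a, b) = (if i = j then (z powi (- \<mu> i) \<cdot>\<^sub>m A i) $$ (a', b') else 0)" for z
    unfolding A0_mat_eq_diag_blocks i(3) j(3)
    by (rule diag_blocks_index) (use A i j in auto)
  show "A0_mat k \<mu> A z $$ (a, b) = z powi (- \<mu> (bl a)) * A0_mat k \<mu> A 1 $$ (a, b)"
    unfolding * using A[OF i(1)] i(2) j(2) bl by (auto simp: carrier_matD)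
  show "A0_mat k \<mu> A z $$ (a, b) = 0" if "bl a \<noteq> bl b"
    unfolding * using that bl by simp
qed

definition mat_holomorphic_on :: "(complex \<Rightarrow> complex mat) \<Rightarrow> complex set \<Rightarrow> bool" where
  "mat_holomorphic_on F U \<longleftrightarrow> (\<forall>a<n. \<forall>b<n. (\<lambda>z. F z $$ (a, b)) holomorphic_on U)"

lemma mat_holomorphic_onI:
  assumes "\<And>a b z. a < n \<Longrightarrow> b < n \<Longrightarrow> z \<in> U \<Longrightarrow> F z $$ (a, b) = G a b z"
    and "\<And>a b. a < n \<Longrightarrow> b < n \<Longrightarrow> G a b holomorphic_on U"
  shows "mat_holomorphic_on F U"
  unfolding mat_holomorphic_on_def
proof (intro allI impI)
  fix a b assume ab: "a < n" "b < n"
  show "(\<lambda>z. F z $$ (a, b)) holomorphic_on U"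
    by (rule holomorphic_transform[OF assms(2)[OF ab]]) (simp add: assms(1)[OF ab])
qed

lemma mat_holomorphic_onD:
  "mat_holomorphic_on F U \<Longrightarrow> a < n \<Longrightarrow> b < n \<Longrightarrow> (\<lambda>z. F z $$ (a, b)) holomorphic_on U"
  by (simp add: mat_holomorphic_on_def)

lemma mat_holomorphic_on_cong:
  "mat_holomorphic_on F U \<Longrightarrow> (\<And>z. z \<in> U \<Longrightarrow> F z = G z) \<Longrightarrow> mat_holomorphic_on G U"
  by (rule mat_holomorphic_onI[where G = "\<lambda>a b z. F z $$ (a, b)"]) (auto simp: mat_holomorphic_on_def)

lemma mat_holomorphic_on_subset:
  "mat_holomorphic_on F U \<Longrightarrow> V \<subseteq> U \<Longrightarrow> mat_holomorphic_on F V"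
  unfolding mat_holomorphic_on_def using holomorphic_on_subset by blast

lemma mat_holomorphic_on_const: "mat_holomorphic_on (\<lambda>z. M) U"
  by (simp add: mat_holomorphic_on_def)

lemma mat_holomorphic_on_add:
  assumes "mat_holomorphic_on F U" "mat_holomorphic_on G U" "\<And>z. z \<in> U \<Longrightarrow> G z \<in> carrier_mat n n"
  shows "mat_holomorphic_on (\<lambda>z. F z + G z) U"
proof (rule mat_holomorphic_onI[where G = "\<lambda>a b z. F z $$ (a, b) + G z $$ (a, b)"])
  fix a b z assume "a < n" "b < n" "z \<in> U"
  then show "(F z + G z) $$ (a, b) = F z $$ (a, b) + G z $$ (a, b)"
    using assms(3)[of z] by auto
qed (intro holomorphic_intros mat_holomorphic_onD assms(1,2))

lemma mat_holomorphic_on_uminus: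
  assumes "mat_holomorphic_on F U" "\<And>z. z \<in> U \<Longrightarrow> F z \<in> carrier_mat n n"
  shows "mat_holomorphic_on (\<lambda>z. - F z) U"
proof (rule mat_holomorphic_onI[where G = "\<lambda>a b z. - (F z $$ (a, b))"])
  fix a b z assume "a < n" "b < n" "z \<in> U"
  then show "(- F z) $$ (a, b) = - (F z $$ (a, b))"
    using assms(2)[of z] by auto
qed (intro holomorphic_intros mat_holomorphic_onD assms(1))

lemma mat_holomorphic_on_mult:
  assumes "mat_holomorphic_on F U" "mat_holomorphic_on G U"
    and "\<And>z. z \<in> U \<Longrightarrow> F z \<in> carrier_mat n n" "\<And>z. z \<in> U \<Longrightarrow> G z \<in> carrier_mat n n"
  shows "mat_holomorphic_on (\<lambda>z. F z * G z) U"
proof (rule mat_holomorphic_onI[where G = "\<lambda>a b z. \<Sum>l = 0..<n. F z $$ (a, l) * G z $$ (l, b)"])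
  fix a b z assume "a < n" "b < n" "z \<in> U"
  then show "(F z * G z) $$ (a, b) = (\<Sum>l = 0..<n. F z $$ (a, l) * G z $$ (l, b))"
    using assms(3,4)[of z] by (simp add: scalar_prod_def)
next
  fix a b assume "a < n" "b < n"
  then show "(\<lambda>z. \<Sum>l = 0..<n. F z $$ (a, l) * G z $$ (l, b)) holomorphic_on U"
    using assms(1,2) by (intro holomorphic_on_sum holomorphic_on_mult mat_holomorphic_onD) auto
qed

lemma mat_holomorphic_on_pattern_part:
  assumes "mat_holomorphic_on F U"
  shows "mat_holomorphic_on (\<lambda>z. pattern_part S (F z)) U"
proof (rule mat_holomorphic_onI[where G = "\<lambda>a b z. if S (bl a) (bl b) then F z $$ (a, b) else 0"])
  fix a b assume "a < n" "b < n"
  then show "(\<lambda>z. if S (bl a) (bl b) then F z $$ (a, b) else 0) holomorphic_on U"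
    using mat_holomorphic_onD[OF assms] by (cases "S (bl a) (bl b)") auto
qed simp

lemma mat_holomorphic_on_neumann:
  assumes "mat_holomorphic_on F U" "\<And>z. z \<in> U \<Longrightarrow> F z \<in> carrier_mat n n"
  shows "mat_holomorphic_on (\<lambda>z. neumann (F z) m) U"
proof (induction m)
  case 0
  then show ?case
    by (simp add: mat_holomorphic_on_const)
next
  case (Suc m)
  have c: "F z * neumann (F z) m \<in> carrier_mat n n" if "z \<in> U" for z
    using assms(2)[OF that] neumann_carrier[OF assms(2)[OF that]] by (rule mult_carrier_mat)
  have "mat_holomorphic_on (\<lambda>z. - (F z * neumann (F z) m)) U"
    using assms Suc neumann_carrier c by (intro mat_holomorphic_on_uminus mat_holomorphic_on_mult) auto
  then show ?case
    using c by (auto intro!: mat_holomorphic_on_add mat_holomorphic_on_const)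
qed

definition pattern_norm :: "(nat \<Rightarrow> nat \<Rightarrow> bool) \<Rightarrow> complex mat \<Rightarrow> real" where
  "pattern_norm S M = (\<Sum>a<n. \<Sum>b<n. if S (bl a) (bl b) then cmod (M $$ (a, b)) else 0)"

lemma pattern_norm_nonneg: "0 \<le> pattern_norm S M"
  unfolding pattern_norm_def by (intro sum_nonneg) auto

lemma entry_le_pattern_norm:
  assumes "a < n" "b < n" "S (bl a) (bl b)"
  shows "cmod (M $$ (a, b)) \<le> pattern_norm S M"
proof -
  let ?f = "\<lambda>a b. if S (bl a) (bl b) then cmod (M $$ (a, b)) else 0"
  have "cmod (M $$ (a, b)) = ?f a b"
    using assms by simp
  also have "\<dots> \<le> (\<Sum>b<n. ?f a b)"
    using assms(2) by (intro member_le_sum) auto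
  also have "\<dots> \<le> (\<Sum>a<n. \<Sum>b<n. ?f a b)"
    using assms(1) by (intro member_le_sum sum_nonneg) auto
  finally show ?thesis
    by (simp add: pattern_norm_def)
qed

text \<open>The power of \<open>w\<close> that conjugation produces in block \<open>(i, j)\<close> is \<open>w\<^bsup>\<mu>\<^sub>j - \<mu>\<^sub>i\<^esup>\<close>; apart from it,
  conjugation by a block diagonal matrix mixes only entries of one and the same block.\<close>

lemma pattern_norm_conjugate:
  fixes A A' :: "nat \<Rightarrow> complex mat" and \<mu> :: "nat \<Rightarrow> int"
  assumes A: "\<And>i. i \<in> {1..k} \<Longrightarrow> A i \<in> carrier_mat (r i) (r i)"
    and A': "\<And>i. i \<in> {1..k} \<Longrightarrow> A' i \<in> carrier_mat (r i) (r i)"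
  shows "\<exists>C>0. \<forall>S w e M. M \<in> carrier_mat n n \<longrightarrow> w \<noteq> 0 \<longrightarrow> 0 \<le> e \<longrightarrow>
      (\<forall>i\<in>{1..k}. \<forall>j\<in>{1..k}. S i j \<longrightarrow> cmod w powi (\<mu> j - \<mu> i) \<le> e) \<longrightarrow>
      pattern_norm S (A0_mat k \<mu> A w * M * A0_mat k (\<lambda>i. - \<mu> i) A' w) \<le> C * e * pattern_norm S M"
proof -
  let ?B = "A0_mat k \<mu> A" and ?B' = "A0_mat k (\<lambda>i. - \<mu> i) A'"
  define \<alpha> where "\<alpha> = (\<lambda>a c. ?B 1 $$ (a, c))"
  define \<beta> where "\<beta> = (\<lambda>d b. ?B' 1 $$ (d, b))"
  define K where "K = (\<Sum>a<n. \<Sum>c<n. cmod (\<alpha> a c)) * (\<Sum>d<n. \<Sum>b<n. cmod (\<beta> d b))"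
  have le_sum2: "cmod (g a b) \<le> (\<Sum>a<n. \<Sum>b<n. cmod (g a b))" if "a < n" "b < n" for g a b
  proof -
    have "cmod (g a b) \<le> (\<Sum>b<n. cmod (g a b))"
      using that(2) by (intro member_le_sum) auto
    also have "\<dots> \<le> (\<Sum>a<n. \<Sum>b<n. cmod (g a b))"
      using that(1) by (intro member_le_sum sum_nonneg) auto
    finally show ?thesis .
  qed
  have K0: "0 \<le> K"
    unfolding K_def by (intro mult_nonneg_nonneg sum_nonneg) auto
  have K_bound: "cmod (\<alpha> a c) * cmod (\<beta> d b) \<le> K" if "a < n" "c < n" "d < n" "b < n" for a c d b
    unfolding K_def using le_sum2[OF that(1,2)] le_sum2[OF that(3,4)]
    by (intro mult_mono) (auto intro!: sum_nonneg)
  have B: "?B w \<in> carrier_mat n n" "?B' w \<in> carrier_mat n n" for w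
    using A0_mat_carrier[OF A] A0_mat_carrier[OF A'] by blast+
  have entry: "cmod ((?B w * M * ?B' w) $$ (a, b)) \<le> K * e * pattern_norm S M"
    if M: "M \<in> carrier_mat n n" and w: "w \<noteq> 0" and e: "0 \<le> e"
      and bound: "\<And>i j. i \<in> {1..k} \<Longrightarrow> j \<in> {1..k} \<Longrightarrow> S i j \<Longrightarrow> cmod w powi (\<mu> j - \<mu> i) \<le> e"
      and ab: "a < n" "b < n" "S (bl a) (bl b)"
    for M w e S a b
  proof -
    let ?N = "\<lambda>c d. if S (bl c) (bl d) then cmod (M $$ (c, d)) else 0"
    have term_le: "cmod (?B w $$ (a, c) * M $$ (c, d) * ?B' w $$ (d, b)) \<le> e * (K * ?N c d)"
      if cd: "c < n" "d < n" for c d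
    proof (cases "bl a = bl c \<and> bl d = bl b")
      case True
      have "?B w $$ (a, c) = w powi (- \<mu> (bl a)) * \<alpha> a c"
        unfolding \<alpha>_def by (rule A0_mat_index(1)[OF A ab(1) cd(1)])
      moreover have "?B' w $$ (d, b) = w powi (\<mu> (bl b)) * \<beta> d b"
        unfolding \<beta>_def using A0_mat_index(1)[OF A' cd(2) ab(2), of "\<lambda>i. - \<mu> i" w] True by simp
      ultimately have "?B w $$ (a, c) * M $$ (c, d) * ?B' w $$ (d, b) =
          (w powi (- \<mu> (bl a)) * w powi (\<mu> (bl b))) * (\<alpha> a c * \<beta> d b * M $$ (c, d))"
        by (simp only: mult_ac)
      also have "w powi (- \<mu> (bl a)) * w powi (\<mu> (bl b)) = w powi (\<mu> (bl b) - \<mu> (bl a))"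
        using w by (simp flip: power_int_add)
      finally have "cmod (?B w $$ (a, c) * M $$ (c, d) * ?B' w $$ (d, b)) =
          cmod w powi (\<mu> (bl b) - \<mu> (bl a)) * (cmod (\<alpha> a c) * cmod (\<beta> d b) * cmod (M $$ (c, d)))"
        by (simp only: norm_mult norm_power_int)
      also have "\<dots> \<le> e * (K * cmod (M $$ (c, d)))"
        using bound[OF block_of_range[OF ab(1)] block_of_range[OF ab(2)] ab(3)] e K0 K_bound[OF ab(1) cd(1,2) ab(2)]
        by (intro mult_mono mult_nonneg_nonneg) auto
      finally show ?thesis
        using True ab(3) by simp
    next
      case False
      then have "?B w $$ (a, c) = 0 \<or> ?B' w $$ (d, b) = 0"
        using A0_mat_index(2)[OF A ab(1) cd(1)] A0_mat_index(2)[OF A' cd(2) ab(2)] by blast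
      then have "cmod (?B w $$ (a, c) * M $$ (c, d) * ?B' w $$ (d, b)) = 0"
        by auto
      then show ?thesis
        using e K0 by (auto intro!: mult_nonneg_nonneg)
    qed
    have "cmod ((?B w * M * ?B' w) $$ (a, b)) \<le>
        (\<Sum>c<n. \<Sum>d<n. cmod (?B w $$ (a, c) * M $$ (c, d) * ?B' w $$ (d, b)))"
      unfolding triple_mult_index[OF B(1) M B(2) ab(1,2)]
      by (intro order_trans[OF norm_sum] sum_mono norm_sum)
    also have "\<dots> \<le> (\<Sum>c<n. \<Sum>d<n. e * (K * ?N c d))"
      by (intro sum_mono term_le) auto
    also have "\<dots> = K * e * pattern_norm S M"
      by (simp add: pattern_norm_def sum_distrib_left mult_ac)
    finally show ?thesis .
  qed
  have total: "pattern_norm S (?B w * M * ?B' w) \<le> (real n * real n * K + 1) * e * pattern_norm S M"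
    if M: "M \<in> carrier_mat n n" and w: "w \<noteq> 0" and e: "0 \<le> e"
      and bound: "\<And>i j. i \<in> {1..k} \<Longrightarrow> j \<in> {1..k} \<Longrightarrow> S i j \<Longrightarrow> cmod w powi (\<mu> j - \<mu> i) \<le> e"
    for M w e S
  proof -
    have nn: "0 \<le> e * pattern_norm S M"
      using e pattern_norm_nonneg by simp
    have "pattern_norm S (?B w * M * ?B' w) \<le> (\<Sum>a<n. \<Sum>b<n. K * e * pattern_norm S M)"
      unfolding pattern_norm_def[of S "?B w * M * ?B' w"]
    proof (intro sum_mono)
      fix a b assume "a \<in> {..<n}" "b \<in> {..<n}"
      moreover have "0 \<le> K * e * pattern_norm S M"
        using K0 nn by (simp add: mult.assoc)
      ultimately show "(if S (bl a) (bl b) then cmod ((?B w * M * ?B' w) $$ (a, b)) else 0) \<le> K * e * pattern_norm S M"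
        using entry[OF M w e bound] by simp
    qed
    also have "\<dots> = (real n * real n * K) * (e * pattern_norm S M)"
      by simp
    also have "\<dots> \<le> (real n * real n * K + 1) * (e * pattern_norm S M)"
      using nn by (intro mult_right_mono) auto
    finally show ?thesis
      by (simp only: mult.assoc)
  qed
  have "0 < real n * real n * K + 1"
    using K0 by (intro add_nonneg_pos mult_nonneg_nonneg) auto
  then show ?thesis
    by (intro exI[of _ "real n * real n * K + 1"] conjI allI impI total) auto
qed

end

section \<open>Solutions of the conjugation equation\<close>

locale stokes_data = q_scaling q + block_structure k r
  for q :: complex and k :: nat and r :: "nat \<Rightarrow> nat" +
  fixes \<mu> :: "nat \<Rightarrow> int" and A :: "nat \<Rightarrow> complex mat"
  assumes mu_decreasing: "\<And>i j. 1 \<le> i \<Longrightarrow> i < j \<Longrightarrow> j \<le> k \<Longrightarrow> \<mu> i > \<mu> j"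
    and A_invertible: "\<And>i. i \<in> {1..k} \<Longrightarrow> A i \<in> carrier_mat (r i) (r i) \<and> invertible_mat (A i)"
begin

abbreviation P where "P \<equiv> Eq_preimage q"
abbreviation A0 where "A0 \<equiv> A0_mat k \<mu> A"

lemma A_inverse_exists:
  assumes "i \<in> {1..k}"
  shows "\<exists>B. B \<in> carrier_mat (r i) (r i) \<and> A i * B = 1\<^sub>m (r i) \<and> B * A i = 1\<^sub>m (r i)"
proof -
  have c: "A i \<in> carrier_mat (r i) (r i)"
    using A_invertible[OF assms] by blast
  obtain B where B: "A i * B = 1\<^sub>m (dim_row (A i))" "B * A i = 1\<^sub>m (dim_row B)"
    using A_invertible[OF assms] by (auto simp: invertible_mat_def inverts_mat_def)
  have "dim_col B = r i"
    using arg_cong[OF B(1), of dim_col] c by simp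
  moreover have "dim_row B = r i"
    using arg_cong[OF B(2), of dim_col] c by simp
  ultimately show ?thesis
    using B c by (intro exI[of _ B]) auto
qed

definition A_inv :: "nat \<Rightarrow> complex mat" where
  "A_inv i = (SOME B. B \<in> carrier_mat (r i) (r i) \<and> A i * B = 1\<^sub>m (r i) \<and> B * A i = 1\<^sub>m (r i))"

definition A0_inv :: "complex \<Rightarrow> complex mat" where
  "A0_inv = A0_mat k (\<lambda>i. - \<mu> i) A_inv"

lemma A_carrier: "i \<in> {1..k} \<Longrightarrow> A i \<in> carrier_mat (r i) (r i)"
  using A_invertible by blast

lemma A_inv:
  assumes "i \<in> {1..k}"
  shows "A_inv i \<in> carrier_mat (r i) (r i)" "A i * A_inv i = 1\<^sub>m (r i)" "A_inv i * A i = 1\<^sub>m (r i)"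
  using someI_ex[OF A_inverse_exists[OF assms]] unfolding A_inv_def by blast+

lemma A0_carrier [simp]: "A0 z \<in> carrier_mat n n"
  by (rule A0_mat_carrier[OF A_carrier])

lemma A0_inv_carrier [simp]: "A0_inv z \<in> carrier_mat n n"
  unfolding A0_inv_def by (rule A0_mat_carrier[OF A_inv(1)])

lemma A0_block_diagonal: "block_diagonal (A0 z)"
  unfolding block_diagonal_def using A0_mat_index(2)[OF A_carrier] by simp

lemma A0_inv_block_diagonal: "block_diagonal (A0_inv z)"
  unfolding block_diagonal_def A0_inv_def
  using A0_mat_index(2)[OF A_inv(1)] A0_mat_carrier[OF A_inv(1)] by simp

lemma A0_mult_inv:
  assumes z: "z \<noteq> 0"
  shows "A0 z * A0_inv z = 1\<^sub>m n" "A0_inv z * A0 z = 1\<^sub>m n"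
proof -
  have *: "(z powi (- \<mu> i) \<cdot>\<^sub>m A i) * (z powi (- (- \<mu> i)) \<cdot>\<^sub>m A_inv i) = 1\<^sub>m (r i)"
    "(z powi (- (- \<mu> i)) \<cdot>\<^sub>m A_inv i) * (z powi (- \<mu> i) \<cdot>\<^sub>m A i) = 1\<^sub>m (r i)" if i: "i \<in> {1..k}" for i
  proof -
    note c = A_carrier[OF i] A_inv[OF i]
    have "z powi (- \<mu> i) * z powi \<mu> i = 1" "z powi \<mu> i * z powi (- \<mu> i) = 1"
      using z by (simp_all add: power_int_minus)
    then show "(z powi (- \<mu> i) \<cdot>\<^sub>m A i) * (z powi (- (- \<mu> i)) \<cdot>\<^sub>m A_inv i) = 1\<^sub>m (r i)"
      "(z powi (- (- \<mu> i)) \<cdot>\<^sub>m A_inv i) * (z powi (- \<mu> i) \<cdot>\<^sub>m A i) = 1\<^sub>m (r i)"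
      using c by (auto simp: mult_smult_distrib[of _ "r i" "r i" _ "r i"]
          mult_smult_assoc_mat[of _ "r i" "r i" _ "r i"] intro!: eq_matI)
  qed
  show "A0 z * A0_inv z = 1\<^sub>m n" "A0_inv z * A0 z = 1\<^sub>m n"
    unfolding A0_inv_def A0_mat_eq_diag_blocks
    by (rule diag_blocks_mult; use * A_carrier A_inv(1) in simp)+
qed

lemma mat_holomorphic_on_A0: "0 \<notin> U \<Longrightarrow> mat_holomorphic_on A0 U"
  by (rule mat_holomorphic_onI, rule A0_mat_index(1)[OF A_carrier]) (auto intro!: holomorphic_intros)

lemma mat_holomorphic_on_A0_inv: "0 \<notin> U \<Longrightarrow> mat_holomorphic_on A0_inv U"
  unfolding A0_inv_def
  by (rule mat_holomorphic_onI, rule A0_mat_index(1)[OF A_inv(1)]) (auto intro!: holomorphic_intros)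

text \<open>The two directions of transport along an orbit: the equation determines \<open>F(q z)\<close> from \<open>F(z)\<close> and
  conversely.\<close>

lemma A0_equation_iff:
  assumes z: "z \<noteq> 0" and F: "F \<in> carrier_mat n n" and G: "G \<in> carrier_mat n n"
  shows "G * A0 z = A0 z * F \<longleftrightarrow> G = A0 z * F * A0_inv z"
    and "G * A0 z = A0 z * F \<longleftrightarrow> F = A0_inv z * G * A0 z"
proof -
  have a: "X * Y * Z = X * (Y * Z)" if "X \<in> carrier_mat n n" "Y \<in> carrier_mat n n" "Z \<in> carrier_mat n n"
    for X Y Z :: "complex mat"
    using that by (rule assoc_mult_mat)
  note inv = A0_mult_inv[OF z]
  have G1: "G * A0 z * A0_inv z = G"
    using a[OF G A0_carrier[of z] A0_inv_carrier[of z]] inv right_mult_one_mat[OF G] by simp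
  have G2: "A0 z * F * A0_inv z * A0 z = A0 z * F"
    using a[of "A0 z * F" "A0_inv z" "A0 z"] inv F by simp
  have F1: "A0_inv z * (A0 z * F) = F"
    using a[OF A0_inv_carrier[of z] A0_carrier[of z] F] inv left_mult_one_mat[OF F] by simp
  have F2: "A0 z * (A0_inv z * G * A0 z) = G * A0 z"
    using a[of "A0 z" "A0_inv z" "G * A0 z"] a[OF A0_inv_carrier[of z] G A0_carrier[of z]] inv G by simp
  show "G * A0 z = A0 z * F \<longleftrightarrow> G = A0 z * F * A0_inv z"
    using G1 G2 by metis
  show "G * A0 z = A0 z * F \<longleftrightarrow> F = A0_inv z * G * A0 z"
    using F1 F2 a[OF A0_inv_carrier[of z] G A0_carrier[of z]] by metis
qed

lemma A0_equation_pattern_part: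
  assumes "F \<in> carrier_mat n n" "G \<in> carrier_mat n n" "G * A0 z = A0 z * F"
  shows "pattern_part S G * A0 z = A0 z * pattern_part S F"
  using pattern_part_mult_block_diagonal[OF A0_block_diagonal] assms by metis

lemma A0_equation_mult:
  assumes c: "F \<in> carrier_mat n n" "G \<in> carrier_mat n n" "F' \<in> carrier_mat n n" "G' \<in> carrier_mat n n"
    and eq: "F' * A0 z = A0 z * F" "G' * A0 z = A0 z * G"
  shows "F' * G' * A0 z = A0 z * (F * G)"
proof -
  have "F' * G' * A0 z = F' * (G' * A0 z)"
    using c by (intro assoc_mult_mat[of _ n n _ n _ n]) auto
  also have "\<dots> = F' * A0 z * G"
    unfolding eq(2) using c by (intro assoc_mult_mat[of _ n n _ n _ n, symmetric]) auto
  also have "\<dots> = A0 z * (F * G)"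
    unfolding eq(1) using c by (intro assoc_mult_mat[of "A0 z" n n]) auto
  finally show ?thesis .
qed

lemma A0_equation_add:
  assumes c: "F \<in> carrier_mat n n" "G \<in> carrier_mat n n" "F' \<in> carrier_mat n n" "G' \<in> carrier_mat n n"
    and eq: "F' * A0 z = A0 z * F" "G' * A0 z = A0 z * G"
  shows "(F' + G') * A0 z = A0 z * (F + G)"
  using add_mult_distrib_mat[OF c(3,4) A0_carrier] mult_add_distrib_mat[OF A0_carrier c(1,2)] eq by simp

lemma A0_equation_uminus:
  assumes c: "F \<in> carrier_mat n n" "F' \<in> carrier_mat n n" and eq: "F' * A0 z = A0 z * F"
  shows "- F' * A0 z = A0 z * - F"
proof -
  have "- F' * A0 z = - (F' * A0 z)" "A0 z * - F = - (A0 z * F)"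
    using carrier_matD[OF A0_carrier[of z]] carrier_matD[OF c(1)] carrier_matD[OF c(2)] by simp_all
  then show ?thesis
    using eq by simp
qed

lemma A0_equation_one: "1\<^sub>m n * A0 z = A0 z * 1\<^sub>m n"
  using left_mult_one_mat[OF A0_carrier] right_mult_one_mat[OF A0_carrier] by simp

lemma A0_equation_zero: "0\<^sub>m n n * A0 z = A0 z * 0\<^sub>m n n"
  using left_mult_zero_mat[OF A0_carrier] right_mult_zero_mat[OF A0_carrier] by simp

lemma A0_equation_neumann:
  assumes c: "F \<in> carrier_mat n n" "F' \<in> carrier_mat n n" and eq: "F' * A0 z = A0 z * F"
  shows "neumann F' m * A0 z = A0 z * neumann F m"
proof (induction m)
  case 0
  then show ?case
    by (simp only: neumann.simps A0_equation_one)
next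
  case (Suc m)
  note N = neumann_carrier[OF c(1)] neumann_carrier[OF c(2)]
  show ?case
    unfolding neumann.simps
    using c N by (intro A0_equation_add A0_equation_uminus A0_equation_mult A0_equation_one eq Suc) auto
qed

text \<open>Sections in canonical form: the value set \<open>K\<close> encodes the block pattern, and extensionality makes
  equality of sections equality of functions.\<close>

definition solutions :: "complex mat set \<Rightarrow> complex set set \<Rightarrow> (complex \<Rightarrow> complex mat) set" where
  "solutions K V = {F \<in> extensional (P V). (\<forall>z\<in>P V. F z \<in> K) \<and>
     (\<forall>z\<in>P V. F (q * z) * A0 z = A0 z * F z) \<and> mat_holomorphic_on F (P V)}"

definition solution_presheaf ::
  "complex mat set \<Rightarrow> (complex mat \<Rightarrow> complex mat \<Rightarrow> complex mat) \<Rightarrow> complex mat \<Rightarrow>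
   (complex set, complex \<Rightarrow> complex mat) group_presheaf" where
  "solution_presheaf K m e =
     \<lparr>sec = (\<lambda>V. \<lparr>carrier = solutions K V, mult = (\<lambda>F G. \<lambda>z\<in>P V. m (F z) (G z)), one = (\<lambda>z\<in>P V. e)\<rparr>),
      res = (\<lambda>U V F. restrict F (P V))\<rparr>"

lemma solutionsD:
  assumes "F \<in> solutions K V"
  shows "F \<in> extensional (P V)" "\<And>z. z \<in> P V \<Longrightarrow> F z \<in> K"
    "\<And>z. z \<in> P V \<Longrightarrow> F (q * z) * A0 z = A0 z * F z" "mat_holomorphic_on F (P V)"
  using assms by (auto simp: solutions_def)

lemma solutionsI:
  assumes "\<And>z. z \<in> P V \<Longrightarrow> F z \<in> K" "\<And>z. z \<in> P V \<Longrightarrow> F (q * z) * A0 z = A0 z * F z"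
    "mat_holomorphic_on F (P V)"
  shows "restrict F (P V) \<in> solutions K V"
  using assms mat_holomorphic_on_cong[OF assms(3), of "restrict F (P V)"]
  by (auto simp: solutions_def Eq_preimage_mult_q)

lemma solutions_restrict:
  assumes F: "F \<in> solutions K U" and sub: "V \<subseteq> U"
  shows "restrict F (P V) \<in> solutions K V"
  using solutionsD[OF F] Eq_preimage_mono[OF sub] mat_holomorphic_on_subset by (intro solutionsI) blast+

lemma solutions_change_values:
  "F \<in> solutions K V \<Longrightarrow> (\<And>z. z \<in> P V \<Longrightarrow> F z \<in> K') \<Longrightarrow> F \<in> solutions K' V"
  by (auto simp: solutions_def)

lemma solution_presheaf_sheaf:
  assumes group: "\<And>V. openin (Eq_space q) V \<Longrightarrow> group (sec (solution_presheaf K m e) V)"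
  shows "sheaf_of_groups (Eq_space q) (solution_presheaf K m e)"
proof (intro sheaf_of_groups.intro presheaf_of_groups.intro sheaf_of_groups_axioms.intro)
  fix U V :: "complex set set" assume sub: "V \<subseteq> U"
  show "res (solution_presheaf K m e) U V
      \<in> hom (sec (solution_presheaf K m e) U) (sec (solution_presheaf K m e) V)"
    using Eq_preimage_mono[OF sub] solutions_restrict[OF _ sub]
    by (auto simp: solution_presheaf_def hom_def fun_eq_iff)
next
  fix U s assume "s \<in> carrier (sec (solution_presheaf K m e) U)"
  then show "res (solution_presheaf K m e) U U s = s"
    using solutionsD(1) by (auto simp: solution_presheaf_def extensional_restrict)
next
  fix U V W :: "complex set set" and s :: "complex \<Rightarrow> complex mat"
  assume "W \<subseteq> V"
  then show "res (solution_presheaf K m e) V W (res (solution_presheaf K m e) U V s) =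
      res (solution_presheaf K m e) U W s"
    using Eq_preimage_mono[of W V] by (auto simp: solution_presheaf_def fun_eq_iff)
next
  fix \<U> and s :: "complex set set \<Rightarrow> complex \<Rightarrow> complex mat"
  assume op: "\<And>U. U \<in> \<U> \<Longrightarrow> openin (Eq_space q) U"
    and s: "\<And>U. U \<in> \<U> \<Longrightarrow> s U \<in> carrier (sec (solution_presheaf K m e) U)"
    and agree: "\<And>U V. U \<in> \<U> \<Longrightarrow> V \<in> \<U> \<Longrightarrow>
      res (solution_presheaf K m e) U (U \<inter> V) (s U) = res (solution_presheaf K m e) V (U \<inter> V) (s V)"
  have sol: "s U \<in> solutions K U" if "U \<in> \<U>" for U
    using s[OF that] by (simp add: solution_presheaf_def)
  have agree': "s U z = s V z" if "U \<in> \<U>" "V \<in> \<U>" "z \<in> P U" "z \<in> P V" for U V z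
    using fun_cong[OF agree[OF that(1,2)], of z] that by (simp add: solution_presheaf_def Eq_preimage_Int)
  define F where "F = (\<lambda>z\<in>P (\<Union>\<U>). s (SOME U. U \<in> \<U> \<and> z \<in> P U) z)"
  have F: "F z = s U z" if "U \<in> \<U>" "z \<in> P U" for U z
  proof -
    let ?U = "SOME U. U \<in> \<U> \<and> z \<in> P U"
    have "\<exists>U. U \<in> \<U> \<and> z \<in> P U"
      using that by blast
    from someI_ex[OF this] have "?U \<in> \<U>" "z \<in> P ?U"
      by blast+
    then have "s ?U z = s U z"
      using agree'[OF _ that(1) _ that(2)] by blast
    moreover have "z \<in> P (\<Union>\<U>)"
      using that by (auto simp: Eq_preimage_Union)
    ultimately show ?thesis
      by (simp add: F_def)
  qed
  have cover: "\<exists>U\<in>\<U>. z \<in> P U" if "z \<in> P (\<Union>\<U>)" for z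
    using that by (simp add: Eq_preimage_Union)
  have F_sol: "F \<in> solutions K (\<Union>\<U>)"
    unfolding solutions_def
  proof (intro CollectI conjI ballI)
    show "F \<in> extensional (P (\<Union>\<U>))"
      by (simp add: F_def)
  next
    fix z assume "z \<in> P (\<Union>\<U>)"
    then obtain U where U: "U \<in> \<U>" "z \<in> P U"
      using cover by blast
    then show "F z \<in> K" "F (q * z) * A0 z = A0 z * F z"
      using F[OF U] F[OF U(1), of "q * z"] solutionsD[OF sol[OF U(1)]] by (auto simp: Eq_preimage_mult_q)
  next
    have "(\<lambda>z. F z $$ (a, b)) holomorphic_on (\<Union>U\<in>\<U>. P U)" if ab: "a < n" "b < n" for a b
    proof (rule holomorphic_on_UN_open)
      fix U assume U: "U \<in> \<U>"
      show "open (P U)"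
        using open_Eq_preimage[OF op[OF U]] .
      show "(\<lambda>z. F z $$ (a, b)) holomorphic_on P U"
        by (rule holomorphic_transform[OF mat_holomorphic_onD[OF solutionsD(4)[OF sol[OF U]] ab]])
          (simp add: F[OF U])
    qed
    then show "mat_holomorphic_on F (P (\<Union>\<U>))"
      by (simp add: mat_holomorphic_on_def Eq_preimage_Union)
  qed
  show "\<exists>!s'. s' \<in> carrier (sec (solution_presheaf K m e) (\<Union>\<U>)) \<and>
      (\<forall>U\<in>\<U>. res (solution_presheaf K m e) (\<Union>\<U>) U s' = s U)"
  proof (rule ex1I[of _ F])
    show "F \<in> carrier (sec (solution_presheaf K m e) (\<Union>\<U>)) \<and>
        (\<forall>U\<in>\<U>. res (solution_presheaf K m e) (\<Union>\<U>) U F = s U)"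
    proof (intro conjI ballI)
      show "F \<in> carrier (sec (solution_presheaf K m e) (\<Union>\<U>))"
        using F_sol by (simp add: solution_presheaf_def)
      fix U assume U: "U \<in> \<U>"
      have "restrict F (P U) = s U"
        by (rule extensionalityI[of _ "P U"]) (use F[OF U] solutionsD(1)[OF sol[OF U]] in auto)
      then show "res (solution_presheaf K m e) (\<Union>\<U>) U F = s U"
        by (simp add: solution_presheaf_def)
    qed
  next
    fix G assume G: "G \<in> carrier (sec (solution_presheaf K m e) (\<Union>\<U>)) \<and>
        (\<forall>U\<in>\<U>. res (solution_presheaf K m e) (\<Union>\<U>) U G = s U)"
    show "G = F"
    proof (rule extensionalityI[of _ "P (\<Union>\<U>)"])
      show "G \<in> extensional (P (\<Union>\<U>))"
        using G by (simp add: solution_presheaf_def solutions_def)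
      show "F \<in> extensional (P (\<Union>\<U>))"
        by (simp add: F_def)
      fix z assume "z \<in> P (\<Union>\<U>)"
      then obtain U where U: "U \<in> \<U>" "z \<in> P U"
        using cover by blast
      have "restrict G (P U) = s U"
        using G U(1) by (simp add: solution_presheaf_def)
      from fun_cong[OF this, of z] show "G z = F z"
        using U F[OF U] by simp
    qed
  qed
qed (rule group)

lemma additive_solutions_group: "group (sec (solution_presheaf (pmat S) (+) (0\<^sub>m n n)) V)"
  (is "group ?G")
proof (rule groupI)
  have car: "carrier ?G = solutions (pmat S) V" and mul: "F \<otimes>\<^bsub>?G\<^esub> G = (\<lambda>z\<in>P V. F z + G z)"
    and one: "\<one>\<^bsub>?G\<^esub> = (\<lambda>z\<in>P V. 0\<^sub>m n n)" for F G
    by (simp_all add: solution_presheaf_def)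
  have c: "F z \<in> carrier_mat n n" if "F \<in> solutions (pmat S) V" "z \<in> P V" for F z
    using solutionsD(2)[OF that] pattern_mats_carrier by blast
  show "F \<otimes>\<^bsub>?G\<^esub> G \<in> carrier ?G" if "F \<in> carrier ?G" "G \<in> carrier ?G" for F G
    using that unfolding car mul
    by (intro solutionsI mat_holomorphic_on_add pattern_mats_add A0_equation_add)
      (auto simp: c solutionsD Eq_preimage_mult_q)
  show "\<one>\<^bsub>?G\<^esub> \<in> carrier ?G"
    unfolding car one
    by (intro solutionsI mat_holomorphic_on_const) (auto simp: pattern_mats_zero A0_equation_zero)
  show "F \<otimes>\<^bsub>?G\<^esub> G \<otimes>\<^bsub>?G\<^esub> H = F \<otimes>\<^bsub>?G\<^esub> (G \<otimes>\<^bsub>?G\<^esub> H)"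
    if "F \<in> carrier ?G" "G \<in> carrier ?G" "H \<in> carrier ?G" for F G H
    using that unfolding car mul by (simp add: fun_eq_iff c assoc_add_mat[of _ n n])
  show "\<one>\<^bsub>?G\<^esub> \<otimes>\<^bsub>?G\<^esub> F = F" if "F \<in> carrier ?G" for F
    using that solutionsD(1) c left_add_zero_mat[of _ n n] unfolding car mul one
    by (intro extensionalityI[of _ "P V"]) auto
  show "\<exists>G\<in>carrier ?G. G \<otimes>\<^bsub>?G\<^esub> F = \<one>\<^bsub>?G\<^esub>" if F: "F \<in> carrier ?G" for F
  proof (rule bexI[of _ "\<lambda>z\<in>P V. - F z"])
    show "(\<lambda>z\<in>P V. - F z) \<otimes>\<^bsub>?G\<^esub> F = \<one>\<^bsub>?G\<^esub>"
      using F c unfolding car mul one by (auto simp: fun_eq_iff)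
    show "(\<lambda>z\<in>P V. - F z) \<in> carrier ?G"
      using F unfolding car
      by (intro solutionsI mat_holomorphic_on_uminus pattern_mats_uminus A0_equation_uminus)
        (auto simp: c solutionsD Eq_preimage_mult_q)
  qed
qed

lemma solutions_minus_one:
  assumes F: "F \<in> solutions (umat S) V"
  shows "(\<lambda>z\<in>P V. - 1\<^sub>m n + F z) \<in> solutions (pmat S) V"
    and "\<And>z. z \<in> P V \<Longrightarrow> 1\<^sub>m n + (\<lambda>z\<in>P V. - 1\<^sub>m n + F z) z = F z"
proof -
  have c: "F z \<in> carrier_mat n n" if "z \<in> P V" for z
    using solutionsD(2)[OF F that] unipotent_mats_carrier by blast
  have m: "- 1\<^sub>m n \<in> carrier_mat n n"
    by simp
  show "(\<lambda>z\<in>P V. - 1\<^sub>m n + F z) \<in> solutions (pmat S) V"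
  proof (rule solutionsI)
    show "mat_holomorphic_on (\<lambda>z. - 1\<^sub>m n + F z) (P V)"
      by (rule mat_holomorphic_on_add[OF mat_holomorphic_on_const solutionsD(4)[OF F] c])
    fix z assume z: "z \<in> P V"
    obtain X where X: "X \<in> pmat S" "F z = 1\<^sub>m n + X"
      using solutionsD(2)[OF F z] by (auto simp: unipotent_mats_def)
    have "- 1\<^sub>m n + F z = X"
      unfolding X(2) using pattern_mats_carrier[OF X(1)] by (intro eq_matI) auto
    then show "- 1\<^sub>m n + F z \<in> pmat S"
      using X(1) by simp
    show "(- 1\<^sub>m n + F (q * z)) * A0 z = A0 z * (- 1\<^sub>m n + F z)"
      by (rule A0_equation_add[OF m c m c A0_equation_uminus[OF _ _ A0_equation_one] solutionsD(3)[OF F z]])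
        (use z in \<open>simp_all add: Eq_preimage_mult_q\<close>)
  qed
  show "1\<^sub>m n + (\<lambda>z\<in>P V. - 1\<^sub>m n + F z) z = F z" if "z \<in> P V" for z
    using c[OF that] that by (auto intro!: eq_matI)
qed

lemma unipotent_solutions_group:
  assumes trans: "\<And>i j l. i \<in> {1..k} \<Longrightarrow> j \<in> {1..k} \<Longrightarrow> l \<in> {1..k} \<Longrightarrow> S i j \<Longrightarrow> S j l \<Longrightarrow> S i l"
    and strict: "\<And>i j. i \<in> {1..k} \<Longrightarrow> j \<in> {1..k} \<Longrightarrow> S i j \<Longrightarrow> i < j"
  shows "group (sec (solution_presheaf (umat S) (*) (1\<^sub>m n)) V)" (is "group ?G")
proof (rule groupI)
  have car: "carrier ?G = solutions (umat S) V" and mul: "F \<otimes>\<^bsub>?G\<^esub> G = (\<lambda>z\<in>P V. F z * G z)"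
    and one: "\<one>\<^bsub>?G\<^esub> = (\<lambda>z\<in>P V. 1\<^sub>m n)" for F G
    by (simp_all add: solution_presheaf_def)
  have c: "F z \<in> carrier_mat n n" if "F \<in> solutions (umat S) V" "z \<in> P V" for F z
    using solutionsD(2)[OF that] unipotent_mats_carrier by blast
  show "F \<otimes>\<^bsub>?G\<^esub> G \<in> carrier ?G" if "F \<in> carrier ?G" "G \<in> carrier ?G" for F G
    using that unfolding car mul
    by (intro solutionsI mat_holomorphic_on_mult unipotent_mats_mult[OF _ _ trans] A0_equation_mult)
      (auto simp: c solutionsD Eq_preimage_mult_q)
  show "\<one>\<^bsub>?G\<^esub> \<in> carrier ?G"
    unfolding car one
    by (intro solutionsI mat_holomorphic_on_const unipotent_mats_one A0_equation_one)
  show "F \<otimes>\<^bsub>?G\<^esub> G \<otimes>\<^bsub>?G\<^esub> H = F \<otimes>\<^bsub>?G\<^esub> (G \<otimes>\<^bsub>?G\<^esub> H)"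
    if "F \<in> carrier ?G" "G \<in> carrier ?G" "H \<in> carrier ?G" for F G H
    using that unfolding car mul by (simp add: fun_eq_iff c assoc_mult_mat[of _ n n _ n _ n])
  show "\<one>\<^bsub>?G\<^esub> \<otimes>\<^bsub>?G\<^esub> F = F" if "F \<in> carrier ?G" for F
    using that solutionsD(1) unfolding car mul one
    by (intro extensionalityI[of _ "P V"]) (auto simp: c left_mult_one_mat[of _ n n])
  \<comment> \<open>Right inverses come from the Neumann series; in a monoid where all of them exist they are
    two-sided, since the right inverse has in turn a right inverse.\<close>
  have right_inv: "\<exists>G\<in>solutions (umat S) V. \<forall>z\<in>P V. F z * G z = 1\<^sub>m n" if F: "F \<in> solutions (umat S) V" for F
  proof -
    define X where "X = (\<lambda>z\<in>P V. - 1\<^sub>m n + F z)"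
    have X_sol: "X \<in> solutions (pmat S) V" and FX: "\<And>z. z \<in> P V \<Longrightarrow> F z = 1\<^sub>m n + X z"
      unfolding X_def using solutions_minus_one[OF F] by simp_all
    note X = solutionsD(2)[OF X_sol]
    note cX = pattern_mats_carrier[OF X]
    show ?thesis
    proof (rule bexI[of _ "\<lambda>z\<in>P V. neumann (X z) n"])
      show "\<forall>z\<in>P V. F z * (\<lambda>z\<in>P V. neumann (X z) n) z = 1\<^sub>m n"
        using neumann_inverse[OF X strict] FX by simp
      show "(\<lambda>z\<in>P V. neumann (X z) n) \<in> solutions (umat S) V"
      proof (rule solutionsI)
        fix z assume z: "z \<in> P V"
        show "neumann (X z) n \<in> umat S"
          by (rule neumann_unipotent[OF X[OF z] trans])
        show "neumann (X (q * z)) n * A0 z = A0 z * neumann (X z) n"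
          by (rule A0_equation_neumann) (use z cX solutionsD(3)[OF X_sol] in \<open>auto simp: Eq_preimage_mult_q\<close>)
      qed (rule mat_holomorphic_on_neumann[OF solutionsD(4)[OF X_sol] cX])
    qed
  qed
  show "\<exists>G\<in>carrier ?G. G \<otimes>\<^bsub>?G\<^esub> F = \<one>\<^bsub>?G\<^esub>" if F: "F \<in> carrier ?G" for F
  proof -
    have F': "F \<in> solutions (umat S) V"
      using F car by simp
    obtain G where G: "G \<in> solutions (umat S) V" "\<And>z. z \<in> P V \<Longrightarrow> F z * G z = 1\<^sub>m n"
      using right_inv[OF F'] by blast
    obtain H where H: "H \<in> solutions (umat S) V" "\<And>z. z \<in> P V \<Longrightarrow> G z * H z = 1\<^sub>m n"
      using right_inv[OF G(1)] by blast
    have "G z * F z = 1\<^sub>m n" if z: "z \<in> P V" for z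
    proof -
      note cc = c[OF F' z] c[OF G(1) z] c[OF H(1) z]
      have "F z = F z * (G z * H z)"
        using H(2)[OF z] right_mult_one_mat[OF cc(1)] by simp
      also have "\<dots> = F z * G z * H z"
        by (rule assoc_mult_mat[symmetric, OF cc])
      also have "\<dots> = H z"
        using G(2)[OF z] left_mult_one_mat[OF cc(3)] by simp
      finally show ?thesis
        using H(2)[OF z] by simp
    qed
    then show ?thesis
      using G(1) unfolding car mul one by (intro bexI[of _ G]) (auto simp: fun_eq_iff)
  qed
qed

text \<open>The tail of each orbit lies in the sector, and the equation leads from there back to every point.\<close>

lemma solutions_eqI:
  assumes F: "F \<in> solutions K V" and G: "G \<in> solutions K V" and K: "K \<subseteq> carrier_mat n n"
    and W: "sector q W V" and eq: "\<And>w. w \<in> W \<Longrightarrow> F w = G w"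
  shows "F = G"
proof (rule extensionalityI[of _ "P V"])
  fix z assume z: "z \<in> P V"
  show "F z = G z"
  proof (rule sector_induct[OF W z])
    fix w assume w: "w \<in> P V" "F w = G w"
    have c: "F w \<in> carrier_mat n n" "G w \<in> carrier_mat n n" "F (q * w) \<in> carrier_mat n n"
      "G (q * w) \<in> carrier_mat n n"
      using solutionsD(2)[OF F] solutionsD(2)[OF G] w K by (auto simp: Eq_preimage_mult_q)
    show "F (q * w) = G (q * w)"
      using A0_equation_iff(1)[OF Eq_preimage_nonzero[OF w(1)] c(1,3)] solutionsD(3)[OF F w(1)]
        A0_equation_iff(1)[OF Eq_preimage_nonzero[OF w(1)] c(2,4)] solutionsD(3)[OF G w(1)] w(2)
      by simp
  qed (rule eq)
qed (use solutionsD(1) F G in auto)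

text \<open>Taking germs of solutions is injective, and all operations on germs act on these representatives
  pointwise.\<close>

lemma full_germ_iso:
  assumes K: "K \<subseteq> carrier_mat n n" and sheaf: "sheaf_of_groups (Eq_space q) (solution_presheaf K m e)"
    and sec: "\<And>V. openin (Eq_space q) V \<Longrightarrow> sec Q V =
      \<lparr>carrier = full_germ V ` solutions K V, mult = sgerm_map2 q V m, one = sgerm_const q V e\<rparr>"
    and res: "group_presheaf.res Q = sgerm_res q"
  shows "iso_of_group_sheaves (Eq_space q) (solution_presheaf K m e) Q full_germ"
proof (rule iso_of_group_sheavesI[OF sheaf])
  fix U assume U: "openin (Eq_space q) U"
  note PU = sector_Eq_preimage[OF U]
  have "inj_on (full_germ U) (solutions K U)"
  proof (rule inj_onI)
    fix F G assume F: "F \<in> solutions K U" and G: "G \<in> solutions K U" and "full_germ U F = full_germ U G"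
    from PU PU this(3) obtain W where "sector q W U" "W \<subseteq> P U \<inter> P U" "\<And>z. z \<in> W \<Longrightarrow> F z = G z"
      by (rule sgerm_eqD) blast
    then show "F = G"
      using solutions_eqI[OF F G K] by blast
  qed
  then show "bij_betw (full_germ U) (carrier (sec (solution_presheaf K m e) U)) (carrier (sec Q U))"
    by (simp add: bij_betw_def sec[OF U] solution_presheaf_def)
  have restr: "full_germ U (restrict F (P U)) = full_germ U F" for F :: "complex \<Rightarrow> complex mat"
    by (rule sgerm_eqI[OF PU PU PU]) auto
  show "full_germ U \<one>\<^bsub>sec (solution_presheaf K m e) U\<^esub> = \<one>\<^bsub>sec Q U\<^esub>"
    using restr by (simp add: sec[OF U] solution_presheaf_def sgerm_const_def)
  show "full_germ U (F \<otimes>\<^bsub>sec (solution_presheaf K m e) U\<^esub> G) = full_germ U F \<otimes>\<^bsub>sec Q U\<^esub> full_germ U G" for F G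
    using restr by (simp add: sec[OF U] solution_presheaf_def sgerm_map2_sgerm[OF PU PU])
next
  fix U V and F :: "complex \<Rightarrow> complex mat"
  assume U: "openin (Eq_space q) U" and V: "openin (Eq_space q) V" "V \<subseteq> U"
  note PU = sector_Eq_preimage[OF U] and PV = sector_Eq_preimage[OF V(1)]
  have sub: "P V \<subseteq> P U"
    by (rule Eq_preimage_mono[OF V(2)])
  have "sgerm q V (P U \<inter> P V) F = full_germ V (restrict F (P V))"
    by (rule sgerm_eqI[OF sector_restrict[OF PU V] PV PV]) (use sub in auto)
  then show "group_presheaf.res Q U V (full_germ U F) = full_germ V (group_presheaf.res (solution_presheaf K m e) U V F)"
    by (simp add: res sgerm_res_sgerm[OF PU V] solution_presheaf_def)
qed

subsection \<open>Extension from a sector\<close>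

fun transport :: "(complex \<Rightarrow> complex mat) \<Rightarrow> nat \<Rightarrow> complex \<Rightarrow> complex mat" where
  "transport f 0 z = f z"
| "transport f (Suc m) z = A0 (z / q) * transport f m (z / q) * A0_inv (z / q)"

lemma pattern_mats_conjugate_A0:
  assumes z: "z \<noteq> 0" and F: "F \<in> pmat S"
  shows "A0 z * F * A0_inv z \<in> pmat S"
proof -
  note c = pattern_mats_carrier[OF F]
  have c': "A0 z * F \<in> carrier_mat n n"
    by (rule mult_carrier_mat[OF A0_carrier c])
  have "pattern_part S (A0 z * F * A0_inv z) = pattern_part S (A0 z * F) * A0_inv z"
    by (rule pattern_part_mult_block_diagonal(1)[OF A0_inv_block_diagonal c'])
  also have "\<dots> = A0 z * F * A0_inv z"
    using pattern_part_mult_block_diagonal(2)[OF A0_block_diagonal c] F by (simp add: pattern_mats_iff)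
  finally show ?thesis
    using mult_carrier_mat[OF c' A0_inv_carrier] by (simp add: pattern_mats_iff)
qed

lemma transport_in:
  assumes "z \<noteq> 0" "f (z / q ^ m) \<in> pmat S"
  shows "transport f m z \<in> pmat S"
  using assms
proof (induction m arbitrary: z)
  case (Suc m)
  then show ?case
    by (auto intro!: pattern_mats_conjugate_A0 Suc.IH)
qed simp

text \<open>At \<open>z\<close> the value is transported from \<open>f (z / q\<^sup>m)\<close>, for any \<open>m\<close> such that this point lies in \<open>W\<close>. The
  equation on \<open>W\<close> makes the choice of \<open>m\<close> immaterial, so the extension is locally one
  \<open>transport f m\<close>, which is holomorphic.\<close>

lemma extend_from_sector:
  assumes W: "sector q W V" and f: "\<And>z. z \<in> W \<Longrightarrow> f z \<in> pmat S"
    and eq: "\<And>z. z \<in> W \<Longrightarrow> f z * A0 (z / q) = A0 (z / q) * f (z / q)"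
    and hol: "mat_holomorphic_on f W"
  obtains F where "F \<in> solutions (pmat S) V" "\<And>z. z \<in> W \<Longrightarrow> F z = f z"
proof -
  note V = sector_horizon_open[OF W]
  have nz: "z \<noteq> 0" if "z \<in> P V" for z
    using Eq_preimage_nonzero that by blast
  have c: "f z \<in> carrier_mat n n" if "z \<in> W" for z
    using pattern_mats_carrier[OF f[OF that]] .
  have stable1: "transport f (Suc m) z = transport f m z" if "z / q ^ m \<in> W" for m z
    using that
  proof (induction m arbitrary: z)
    case 0
    then have z: "z \<in> W" "z \<noteq> 0"
      using sector_subset[OF W] nz by auto
    then show ?case
      using A0_equation_iff(1)[of "z / q" "f (z / q)" "f z"] eq[OF z(1)] c[OF z(1)]
        c[OF sector_divide_q[OF W z(1)]] by simp
  next
    case (Suc m)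
    then have "transport f (Suc m) (z / q) = transport f m (z / q)"
      by (intro Suc.IH) simp
    then show ?case
      by simp
  qed
  have stable: "transport f (m + j) z = transport f m z" if "z / q ^ m \<in> W" for m j z
  proof (induction j)
    case (Suc j)
    have "z / q ^ (m + j) \<in> W"
      by (rule sector_divide_q_power_mono[OF W that]) simp
    then show ?case
      using stable1[of z "m + j"] Suc by simp
  qed simp
  define F where "F = (\<lambda>z\<in>P V. transport f (LEAST m. z / q ^ m \<in> W) z)"
  have F: "F z = transport f m z" if "z / q ^ m \<in> W" for m z
  proof -
    let ?l = "LEAST m. z / q ^ m \<in> W"
    have "z / q ^ ?l \<in> W" "?l \<le> m"
      using LeastI[of "\<lambda>m. z / q ^ m \<in> W", OF that] Least_le[of "\<lambda>m. z / q ^ m \<in> W", OF that] .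
    moreover have "z \<in> P V"
      using that sector_subset[OF W] Eq_preimage_divide_q_power by blast
    ultimately show ?thesis
      using stable[of z ?l "m - ?l"] by (simp add: F_def)
  qed
  have "F \<in> solutions (pmat S) V"
    unfolding solutions_def
  proof (intro CollectI conjI ballI)
    show "F \<in> extensional (P V)"
      by (simp add: F_def)
  next
    fix z assume z: "z \<in> P V"
    obtain m where m: "z / q ^ m \<in> W"
      by (rule sector_absorbs[OF W z])
    have in_S: "transport f m z \<in> pmat S"
      by (rule transport_in[where f = f and m = m, OF nz[OF z] f[OF m]])
    then show "F z \<in> pmat S"
      using F[OF m] by simp
    have "F (q * z) = A0 z * F z * A0_inv z"
      using F[of "q * z" "Suc m"] F[OF m] m by simp
    moreover have "F z \<in> carrier_mat n n"
      using in_S F[OF m] pattern_mats_carrier by simp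
    moreover from this have "A0 z * F z * A0_inv z \<in> carrier_mat n n"
      by (intro mult_carrier_mat[of _ n n _ n]) auto
    ultimately show "F (q * z) * A0 z = A0 z * F z"
      using A0_equation_iff(1)[OF nz[OF z]] by simp
  next
    let ?U = "\<lambda>m. {z. z \<noteq> 0 \<and> z / q ^ m \<in> W}"
    have PV: "P V = (\<Union>m. ?U m)"
    proof (intro equalityI subsetI)
      fix z assume z: "z \<in> P V"
      then obtain m where "z / q ^ m \<in> W"
        by (rule sector_absorbs[OF W])
      then show "z \<in> (\<Union>m. ?U m)"
        using nz[OF z] by blast
    next
      fix z assume "z \<in> (\<Union>m. ?U m)"
      then show "z \<in> P V"
        using sector_subset[OF W] Eq_preimage_divide_q_power by blast
    qed
    have U_open: "open (?U m)" for m
    proof -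
      have "open ((\<lambda>z. z / q ^ m) -` W)"
        by (intro open_vimage continuous_intros sector_open[OF W]) auto
      then have "open (- {0} \<inter> (\<lambda>z. z / q ^ m) -` W)"
        by (intro open_Int open_Compl) auto
      moreover have "?U m = - {0} \<inter> (\<lambda>z. z / q ^ m) -` W"
        by auto
      ultimately show ?thesis
        by (simp only:)
    qed
    have U_step: "z / q \<in> ?U m" if "z \<in> ?U (Suc m)" for z m
      using that by auto
    have U_hol: "mat_holomorphic_on (transport f m) (?U m)" for m
    proof (induction m)
      case 0
      have "mat_holomorphic_on f (?U 0)"
        by (rule mat_holomorphic_on_subset[OF hol]) auto
      then show ?case
        by simp
    next
      case (Suc m)
      have scale: "mat_holomorphic_on (\<lambda>z. G (z / q)) (?U (Suc m))" if G: "mat_holomorphic_on G (?U m)" for G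
        unfolding mat_holomorphic_on_def
      proof (intro allI impI)
        fix a b assume "a < n" "b < n"
        then have "(\<lambda>z. G z $$ (a, b)) holomorphic_on ?U m"
          by (rule mat_holomorphic_onD[OF G])
        then have "((\<lambda>z. G z $$ (a, b)) \<circ> (\<lambda>z. z / q)) holomorphic_on ?U (Suc m)"
          by (intro holomorphic_on_compose_gen[where t = "?U m"] holomorphic_intros) (use U_step in auto)
        then show "(\<lambda>z. G (z / q) $$ (a, b)) holomorphic_on ?U (Suc m)"
          by (simp add: o_def)
      qed
      have tc: "transport f m (z / q) \<in> carrier_mat n n" if "z \<in> ?U (Suc m)" for z
        using transport_in[of "z / q" f m S] f U_step[OF that] pattern_mats_carrier by blast
      have "mat_holomorphic_on (\<lambda>z. A0 (z / q) * transport f m (z / q) * A0_inv (z / q)) (?U (Suc m))"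
      proof (rule mat_holomorphic_on_mult)
        show "mat_holomorphic_on (\<lambda>z. A0 (z / q) * transport f m (z / q)) (?U (Suc m))"
        proof (rule mat_holomorphic_on_mult)
          show "mat_holomorphic_on (\<lambda>z. A0 (z / q)) (?U (Suc m))"
            by (rule scale[of A0, OF mat_holomorphic_on_A0]) simp
          show "mat_holomorphic_on (\<lambda>z. transport f m (z / q)) (?U (Suc m))"
            by (rule scale[of "transport f m", OF Suc])
        qed (use tc in auto)
        show "mat_holomorphic_on (\<lambda>z. A0_inv (z / q)) (?U (Suc m))"
          by (rule scale[of A0_inv, OF mat_holomorphic_on_A0_inv]) simp
        show "A0 (z / q) * transport f m (z / q) \<in> carrier_mat n n" if "z \<in> ?U (Suc m)" for z
          by (rule mult_carrier_mat[OF A0_carrier tc[OF that]])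
      qed simp
      then show ?case
        by simp
    qed
    have "(\<lambda>z. F z $$ (a, b)) holomorphic_on (\<Union>m. ?U m)" if ab: "a < n" "b < n" for a b
    proof (rule holomorphic_on_UN_open[OF _ U_open])
      fix m
      show "(\<lambda>z. F z $$ (a, b)) holomorphic_on ?U m"
      proof (rule holomorphic_transform[OF mat_holomorphic_onD[OF U_hol ab]])
        fix x assume "x \<in> ?U m"
        then show "transport f m x $$ (a, b) = F x $$ (a, b)"
          using F[of x m] by simp
      qed
    qed
    then show "mat_holomorphic_on F (P V)"
      unfolding PV by (simp add: mat_holomorphic_on_def)
  qed
  moreover have "F z = f z" if "z \<in> W" for z
    using F[of z 0] that by simp
  ultimately show thesis
    using that by blast
qed

section \<open>Growth of solutions\<close>

text \<open>In the blocks whose slope \<open>\<mu>\<^sub>i - \<mu>\<^sub>j\<close> is at least \<open>d\<close>, each step towards \<open>0\<close>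
  gains \<open>\<bar>w\<bar>\<^sup>d\<close> up to a constant.\<close>

lemma pattern_norm_step_down:
  fixes d :: nat
  assumes S: "\<And>i j. i \<in> {1..k} \<Longrightarrow> j \<in> {1..k} \<Longrightarrow> S i j \<Longrightarrow> int d \<le> \<mu> i - \<mu> j"
    and F: "F \<in> solutions K V" and K: "K \<subseteq> carrier_mat n n"
  shows "\<exists>C>0. \<forall>w\<in>P V. cmod w \<le> 1 \<longrightarrow> pattern_norm S (F w) \<le> C * cmod w ^ d * pattern_norm S (F (q * w))"
proof -
  obtain C where C: "0 < C"
    "\<forall>S w e M. M \<in> carrier_mat n n \<longrightarrow> w \<noteq> 0 \<longrightarrow> 0 \<le> e \<longrightarrow>
      (\<forall>i\<in>{1..k}. \<forall>j\<in>{1..k}. S i j \<longrightarrow> cmod w powi (- \<mu> j - - \<mu> i) \<le> e) \<longrightarrow>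
      pattern_norm S (A0_mat k (\<lambda>i. - \<mu> i) A_inv w * M * A0_mat k (\<lambda>i. - (- \<mu> i)) A w) \<le> C * e * pattern_norm S M"
    using pattern_norm_conjugate[OF A_inv(1) A_carrier, of "\<lambda>i. - \<mu> i"] by blast
  have "pattern_norm S (F w) \<le> C * cmod w ^ d * pattern_norm S (F (q * w))"
    if w: "w \<in> P V" "cmod w \<le> 1" for w
  proof -
    have w0: "w \<noteq> 0"
      by (rule Eq_preimage_nonzero[OF w(1)])
    have c: "F w \<in> carrier_mat n n" "F (q * w) \<in> carrier_mat n n"
      using solutionsD(2)[OF F] K w by (auto simp: Eq_preimage_mult_q)
    have eq: "F w = A0_mat k (\<lambda>i. - \<mu> i) A_inv w * F (q * w) * A0_mat k (\<lambda>i. - (- \<mu> i)) A w"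
      using A0_equation_iff(2)[OF w0 c] solutionsD(3)[OF F w(1)] by (simp add: A0_inv_def)
    have "cmod w powi (- \<mu> j - - \<mu> i) \<le> cmod w ^ d" if "i \<in> {1..k}" "j \<in> {1..k}" "S i j" for i j
    proof -
      have "- \<mu> j - - \<mu> i = int (nat (\<mu> i - \<mu> j))" "d \<le> nat (\<mu> i - \<mu> j)"
        using S[OF that] by auto
      then show ?thesis
        using w(2) power_decreasing[of d "nat (\<mu> i - \<mu> j)" "cmod w"]
        by (simp only: power_int_of_nat norm_ge_zero)
    qed
    then show ?thesis
      by (subst eq) (rule C(2)[rule_format, OF c(2) w0], auto)
  qed
  then show ?thesis
    using C(1) by blast
qed

text \<open>In the blocks of slope at most \<open>d\<close>, no step towards \<open>0\<close> gains more than \<open>\<bar>w\<bar>\<^sup>d\<close> up to a constant.\<close>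

lemma pattern_norm_step_up:
  fixes d :: nat
  assumes S: "\<And>i j. i \<in> {1..k} \<Longrightarrow> j \<in> {1..k} \<Longrightarrow> S i j \<Longrightarrow> \<mu> i - \<mu> j \<le> int d"
    and F: "F \<in> solutions K V" and K: "K \<subseteq> carrier_mat n n"
  shows "\<exists>C>0. \<forall>w\<in>P V. cmod w \<le> 1 \<longrightarrow> cmod w ^ d * pattern_norm S (F (q * w)) \<le> C * pattern_norm S (F w)"
proof -
  obtain C where C: "0 < C"
    "\<forall>S w e M. M \<in> carrier_mat n n \<longrightarrow> w \<noteq> 0 \<longrightarrow> 0 \<le> e \<longrightarrow>
      (\<forall>i\<in>{1..k}. \<forall>j\<in>{1..k}. S i j \<longrightarrow> cmod w powi (\<mu> j - \<mu> i) \<le> e) \<longrightarrow>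
      pattern_norm S (A0_mat k \<mu> A w * M * A0_mat k (\<lambda>i. - \<mu> i) A_inv w) \<le> C * e * pattern_norm S M"
    using pattern_norm_conjugate[OF A_carrier A_inv(1), of \<mu>] by blast
  have "cmod w ^ d * pattern_norm S (F (q * w)) \<le> C * pattern_norm S (F w)"
    if w: "w \<in> P V" "cmod w \<le> 1" for w
  proof -
    have w0: "w \<noteq> 0"
      by (rule Eq_preimage_nonzero[OF w(1)])
    have c: "F w \<in> carrier_mat n n" "F (q * w) \<in> carrier_mat n n"
      using solutionsD(2)[OF F] K w by (auto simp: Eq_preimage_mult_q)
    have eq: "F (q * w) = A0_mat k \<mu> A w * F w * A0_mat k (\<lambda>i. - \<mu> i) A_inv w"
      using A0_equation_iff(1)[OF w0 c] solutionsD(3)[OF F w(1)] by (simp add: A0_inv_def)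
    have "cmod w powi (\<mu> j - \<mu> i) \<le> inverse (cmod w ^ d)" if "i \<in> {1..k}" "j \<in> {1..k}" "S i j" for i j
    proof -
      have "cmod w powi (\<mu> j - \<mu> i) \<le> cmod w powi (- int d)"
        using S[OF that] w(2) w0 by (intro power_int_decreasing) auto
      then show ?thesis
        by (simp add: power_int_minus)
    qed
    then have "pattern_norm S (F (q * w)) \<le> C * inverse (cmod w ^ d) * pattern_norm S (F w)"
      by (subst eq) (rule C(2)[rule_format, OF c(1) w0], auto)
    then have "cmod w ^ d * pattern_norm S (F (q * w)) \<le>
        cmod w ^ d * (C * inverse (cmod w ^ d) * pattern_norm S (F w))"
      by (intro mult_left_mono) auto
    then show ?thesis
      using w0 by (simp add: field_simps)
  qed
  then show ?thesis
    using C(1) by blast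
qed

lemma pattern_norm_continuous:
  assumes "F \<in> solutions K V"
  shows "continuous_on (P V) (\<lambda>w. pattern_norm S (F w))"
  unfolding pattern_norm_def
proof (intro continuous_on_sum)
  fix a b assume "a \<in> {..<n}" "b \<in> {..<n}"
  then have "continuous_on (P V) (\<lambda>w. F w $$ (a, b))"
    using mat_holomorphic_onD[OF solutionsD(4)[OF assms]] holomorphic_on_imp_continuous_on by blast
  then show "continuous_on (P V) (\<lambda>w. if S (bl a) (bl b) then cmod (F w $$ (a, b)) else 0)"
    by (cases "S (bl a) (bl b)") (auto intro!: continuous_intros)
qed

lemma solution_entry_le_pattern_norm:
  assumes "F \<in> solutions (pmat S) V" "w \<in> P V" "a < n" "b < n"
  shows "cmod (F w $$ (a, b)) \<le> pattern_norm S (F w)"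
proof (cases "S (bl a) (bl b)")
  case True
  then show ?thesis
    using entry_le_pattern_norm assms by blast
next
  case False
  then have "F w $$ (a, b) = 0"
    using solutionsD(2)[OF assms(1,2)] assms(3,4) by (simp add: pattern_mats_def)
  then show ?thesis
    by (simp add: pattern_norm_nonneg)
qed

text \<open>In the blocks with \<open>i < j\<close> all slopes \<open>\<mu>\<^sub>i - \<mu>\<^sub>j\<close> are at least \<open>1\<close>, so dividing the size of the solution by \<open>\<bar>w\<bar>\<^sup>m\<close> still leaves, for
  small \<open>w\<close>, a function that decreases along orbits.\<close>

lemma solutions_flat:
  assumes V: "openin (Eq_space q) V" and F: "F \<in> solutions (pmat (<)) V" and ab: "a < n" "b < n"
  shows "flat_on q (P V) (\<lambda>z. F z $$ (a, b))"
  unfolding flat_on_def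
proof (intro conjI allI impI)
  show "(\<lambda>z. F z $$ (a, b)) holomorphic_on P V"
    by (rule mat_holomorphic_onD[OF solutionsD(4)[OF F] ab])
next
  fix m :: nat and K assume K: "compact K" "K \<subseteq> P V"
  have car: "pmat (<) \<subseteq> carrier_mat n n"
    using pattern_mats_carrier by blast
  have slope: "int 1 \<le> \<mu> i - \<mu> j" if "i \<in> {1..k}" "j \<in> {1..k}" "i < j" for i j
    using mu_decreasing[of i j] that by simp
  obtain C where C: "0 < C" "\<And>w. w \<in> P V \<Longrightarrow> cmod w \<le> 1 \<Longrightarrow>
      pattern_norm (<) (F w) \<le> C * cmod w ^ 1 * pattern_norm (<) (F (q * w))"
    using pattern_norm_step_down[OF slope F car] by blast
  define v where "v = (\<lambda>w. pattern_norm (<) (F w) / cmod w ^ m)"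
  define \<epsilon> where "\<epsilon> = min 1 (1 / (C * cmod q ^ m))"
  have \<epsilon>: "0 < \<epsilon>"
    using C(1) q_gt_1 by (simp add: \<epsilon>_def)
  have "continuous_on (P V) v"
    unfolding v_def by (intro continuous_intros pattern_norm_continuous[OF F])
      (use Eq_preimage_nonzero in auto)
  moreover have "v w \<le> v (q * w)" if w: "w \<in> P V" "cmod w \<le> \<epsilon>" "q * w \<in> P V" for w
  proof -
    have w0: "w \<noteq> 0"
      by (rule Eq_preimage_nonzero[OF w(1)])
    have small: "C * cmod q ^ m * cmod w \<le> 1"
      using w(2) C(1) q_gt_1 by (simp add: \<epsilon>_def field_simps)
    have "pattern_norm (<) (F w) \<le> C * cmod w * pattern_norm (<) (F (q * w))"
      using C(2)[OF w(1)] w(2) by (simp add: \<epsilon>_def)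
    then have "v w \<le> C * cmod w * pattern_norm (<) (F (q * w)) / cmod w ^ m"
      unfolding v_def by (intro divide_right_mono) auto
    also have "\<dots> = (C * cmod q ^ m * cmod w) * v (q * w)"
      using w0 by (simp add: v_def norm_mult power_mult_distrib)
    also have "\<dots> \<le> 1 * v (q * w)"
      by (rule mult_right_mono[OF small]) (simp add: v_def pattern_norm_nonneg)
    finally show ?thesis
      by simp
  qed
  ultimately obtain B where B: "\<And>w. w \<in> qdown q K \<Longrightarrow> v w \<le> B"
    using sector_continuous_bounded_qdown[OF sector_Eq_preimage[OF V] _ K \<epsilon>, of v] by blast
  have "cmod (F w $$ (a, b) / w ^ m) \<le> B" if w: "w \<in> qdown q K" for w
  proof -
    have "w \<in> P V"
      using qdown_in_sector[OF sector_Eq_preimage[OF V] K(2)] w by blast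
    then have "cmod (F w $$ (a, b) / w ^ m) \<le> v w"
      unfolding v_def norm_divide norm_power
      by (intro divide_right_mono solution_entry_le_pattern_norm[OF F]) (use ab in auto)
    then show ?thesis
      using B[OF w] by linarith
  qed
  then show "bounded ((\<lambda>z. F z $$ (a, b) / z ^ m) ` qdown q K)"
    by (auto simp: bounded_iff)
qed

text \<open>The gain \<open>\<bar>w\<bar>\<^sup>t\<close> of each step is exactly what \<open>\<bar>\<theta>\<bar>\<^sup>t\<close> loses. The remaining constant factor per step is
  absorbed by a power of \<open>\<bar>w\<bar>\<close>.\<close>

lemma solutions_t_flat:
  assumes V: "openin (Eq_space q) V" and F: "F \<in> solutions (pmat S) V"
    and S: "\<And>i j. i \<in> {1..k} \<Longrightarrow> j \<in> {1..k} \<Longrightarrow> S i j \<Longrightarrow> int t \<le> \<mu> i - \<mu> j" and ab: "a < n" "b < n"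
  shows "t_flat_on q t (P V) (\<lambda>z. F z $$ (a, b))"
  unfolding t_flat_on_def
proof (intro conjI exI[of _ "1::complex"] allI impI)
  show "(\<lambda>z. F z $$ (a, b)) holomorphic_on P V"
    by (rule mat_holomorphic_onD[OF solutionsD(4)[OF F] ab])
next
  fix K assume K: "compact K" "K \<subseteq> P V"
  have car: "pmat S \<subseteq> carrier_mat n n"
    using pattern_mats_carrier by blast
  obtain C where C: "0 < C" "\<And>w. w \<in> P V \<Longrightarrow> cmod w \<le> 1 \<Longrightarrow>
      pattern_norm S (F w) \<le> C * cmod w ^ t * pattern_norm S (F (q * w))"
    using pattern_norm_step_down[OF S F car] by blast
  \<comment> \<open>A factor \<open>C\<close> per step is compensated by the power \<open>\<bar>w\<bar>\<^sup>N\<close>, which shrinks by \<open>\<bar>q\<bar>\<^sup>N\<close> per step.\<close>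
  obtain N where N: "C < cmod q ^ N"
    using real_arch_pow[OF q_gt_1] by blast
  define v where "v = (\<lambda>w. pattern_norm S (F w) * cmod (theta q 1 w) ^ t * cmod w ^ N)"
  have "continuous_on (P V) (theta q 1)"
    by (rule continuous_on_subset[OF holomorphic_on_imp_continuous_on[OF theta_holomorphic[OF q_gt_1]]])
      (use Eq_preimage_nonzero in auto)
  then have "continuous_on (P V) v"
    unfolding v_def by (intro continuous_intros pattern_norm_continuous[OF F])
  moreover have "v w \<le> v (q * w)" if w: "w \<in> P V" "cmod w \<le> 1" "q * w \<in> P V" for w
  proof -
    have w0: "w \<noteq> 0"
      by (rule Eq_preimage_nonzero[OF w(1)])
    have theta: "cmod (theta q 1 (q * w)) = cmod w * cmod (theta q 1 w)"
      using theta_q[of q 1 w] w0 by (simp add: norm_mult)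
    have "v w \<le> C * cmod w ^ t * pattern_norm S (F (q * w)) * cmod (theta q 1 w) ^ t * cmod w ^ N"
      unfolding v_def by (intro mult_right_mono C(2)[OF w(1,2)]) auto
    also have "\<dots> = C * (pattern_norm S (F (q * w)) * cmod (theta q 1 (q * w)) ^ t * cmod w ^ N)"
      unfolding theta by (simp add: power_mult_distrib)
    also have "\<dots> \<le> cmod q ^ N * (pattern_norm S (F (q * w)) * cmod (theta q 1 (q * w)) ^ t * cmod w ^ N)"
      using N by (intro mult_right_mono mult_nonneg_nonneg pattern_norm_nonneg) auto
    also have "\<dots> = v (q * w)"
      by (simp add: v_def norm_mult power_mult_distrib)
    finally show ?thesis .
  qed
  ultimately obtain B where B: "\<And>w. w \<in> qdown q K \<Longrightarrow> v w \<le> B"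
    using sector_continuous_bounded_qdown[where \<epsilon> = 1 and v = v, OF sector_Eq_preimage[OF V] _ K] by auto
  have "cmod (F w $$ (a, b)) * cmod (theta q 1 w) ^ t \<le> B * inverse (cmod w ^ N)" if w: "w \<in> qdown q K" for w
  proof -
    have w': "w \<in> P V"
      using qdown_in_sector[OF sector_Eq_preimage[OF V] K(2)] w by blast
    have "cmod (F w $$ (a, b)) * cmod (theta q 1 w) ^ t * cmod w ^ N \<le> v w"
      unfolding v_def by (intro mult_right_mono solution_entry_le_pattern_norm[OF F w' ab]) auto
    then have "cmod (F w $$ (a, b)) * cmod (theta q 1 w) ^ t * cmod w ^ N \<le> B"
      using B[OF w] by linarith
    then show ?thesis
      using Eq_preimage_nonzero[OF w'] by (simp add: field_simps)
  qed
  then show "\<exists>N. (\<lambda>z. cmod (F z $$ (a, b)) * cmod (theta q 1 z) ^ t)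
      \<in> O[at 0 within qdown q K](\<lambda>z. inverse (cmod z ^ N))"
    by (intro exI[of _ N] bigoI[of _ B]) (auto simp: eventually_at_filter)
qed simp

text \<open>By \<open>theta_orbit\<close> the product below is \<open>\<bar>\<theta>\<bar>\<close> on the orbit up to a factor exponential in \<open>m\<close>, and
  so is every power of \<open>\<bar>z/q\<^sup>m\<bar>\<close>. The product no longer involves \<open>c\<close>, so that entries with different
  theta functions can be compared.\<close>

lemma t_flat_entry_on_orbit:
  assumes tf: "t_flat_on q t W f" and W: "sector q W V"
  shows "\<exists>c. c \<noteq> 0 \<and> (\<forall>z\<in>P V. theta q c z \<noteq> 0 \<longrightarrow> (\<exists>L>0.
    (\<lambda>m. cmod (f (z / q ^ m)) * (\<Prod>l=1..m. cmod (q ^ l / z)) ^ t / L ^ m) \<longlonglongrightarrow> 0))"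
proof -
  obtain c where c: "c \<noteq> 0" and growth: "\<And>K. compact K \<Longrightarrow> K \<subseteq> W \<Longrightarrow>
      \<exists>N::nat. (\<lambda>z. cmod (f z) * cmod (theta q c z) ^ t) \<in> O[at 0 within qdown q K](\<lambda>z. inverse (cmod z ^ N))"
    using tf unfolding t_flat_on_def by blast
  have "\<exists>L>0. (\<lambda>m. cmod (f (z / q ^ m)) * (\<Prod>l=1..m. cmod (q ^ l / z)) ^ t / L ^ m) \<longlonglongrightarrow> 0"
    if z: "z \<in> P V" and nz: "theta q c z \<noteq> 0" for z
  proof -
    have z0: "z \<noteq> 0"
      by (rule Eq_preimage_nonzero[OF z])
    obtain m0 where m0: "z / q ^ m0 \<in> W"
      by (rule sector_absorbs[OF W z])
    let ?K = "{z / q ^ m0}"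
    obtain N :: nat where N: "(\<lambda>z. cmod (f z) * cmod (theta q c z) ^ t)
        \<in> O[at 0 within qdown q ?K](\<lambda>z. inverse (cmod z ^ N))"
      using growth[of ?K] m0 by auto
    then obtain B where B: "0 < B" "eventually (\<lambda>z. norm (cmod (f z) * cmod (theta q c z) ^ t)
        \<le> B * norm (inverse (cmod z ^ N))) (at 0 within qdown q ?K)"
      by (rule landau_o.bigE) blast
    have "eventually (\<lambda>m. z / q ^ m \<in> qdown q ?K) sequentially"
      using eventually_ge_at_top[of m0]
    proof eventually_elim
      case (elim m)
      then have "z / q ^ m = z / q ^ m0 / q ^ (m - m0)"
        by (simp flip: power_add)
      then show ?case
        by (auto simp: qdown_def)
    qed
    then have "filterlim (\<lambda>m. z / q ^ m) (at 0 within qdown q ?K) sequentially"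
      using scale_tendsto_0[of z] z0 by (auto simp: filterlim_at intro: eventually_mono)
    from filterlim_iff[THEN iffD1, OF this, rule_format, OF B(2)]
    have ev: "eventually (\<lambda>m. cmod (f (z / q ^ m)) * cmod (theta q c (z / q ^ m)) ^ t
        \<le> B * inverse (cmod (z / q ^ m) ^ N)) sequentially"
      by (simp add: abs_mult)
    let ?p = "\<lambda>m. \<Prod>l=1..m. cmod (q ^ l / z)"
    \<comment> \<open>\<open>M\<close> is the actual rate of growth; dividing by \<open>(2 M)\<^sup>m\<close> turns boundedness into convergence to \<open>0\<close>.\<close>
    define M where "M = cmod q ^ N / cmod c ^ t"
    define D where "D = B / (cmod z ^ N * cmod (theta q c z) ^ t)"
    have M0: "0 < M"
      using c q_gt_1 by (simp add: M_def)
    have upper: "eventually (\<lambda>m. cmod (f (z / q ^ m)) * ?p m ^ t / (2 * M) ^ m \<le> D * (1 / 2) ^ m) sequentially"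
      using ev
    proof eventually_elim
      case (elim m)
      have "cmod (f (z / q ^ m)) * (cmod c ^ m * ?p m * cmod (theta q c z)) ^ t \<le> B * inverse (cmod (z / q ^ m) ^ N)"
        using elim unfolding theta_orbit[OF c z0] .
      moreover have "(cmod c ^ m * ?p m * cmod (theta q c z)) ^ t =
          ?p m ^ t * ((cmod c ^ t) ^ m * cmod (theta q c z) ^ t)"
        by (simp add: power_mult_distrib mult_ac flip: power_mult)
      moreover have "inverse (cmod (z / q ^ m) ^ N) = (cmod q ^ N) ^ m / cmod z ^ N"
        by (simp add: norm_divide norm_power power_divide mult_ac flip: power_mult)
      ultimately have "cmod (f (z / q ^ m)) * ?p m ^ t * ((cmod c ^ t) ^ m * cmod (theta q c z) ^ t) \<le>
          B * ((cmod q ^ N) ^ m / cmod z ^ N)"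
        by (simp only: mult.assoc)
      moreover have "0 < (cmod c ^ t) ^ m * cmod (theta q c z) ^ t"
        using c nz by simp
      ultimately have "cmod (f (z / q ^ m)) * ?p m ^ t \<le>
          B * ((cmod q ^ N) ^ m / cmod z ^ N) / ((cmod c ^ t) ^ m * cmod (theta q c z) ^ t)"
        by (simp only: pos_le_divide_eq)
      also have "\<dots> = D * M ^ m"
        by (simp add: D_def M_def power_divide)
      finally have "cmod (f (z / q ^ m)) * ?p m ^ t \<le> D * M ^ m" .
      then have "cmod (f (z / q ^ m)) * ?p m ^ t / (2 * M) ^ m \<le> D * M ^ m / (2 * M) ^ m"
        using M0 by (intro divide_right_mono) auto
      also have "\<dots> = D * (1 / 2) ^ m"
        using M0 by (simp add: power_mult_distrib power_divide)
      finally show ?case .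
    qed
    have lower: "eventually (\<lambda>m. 0 \<le> cmod (f (z / q ^ m)) * ?p m ^ t / (2 * M) ^ m) sequentially"
      using M0 by (auto intro!: always_eventually divide_nonneg_nonneg mult_nonneg_nonneg zero_le_power prod_nonneg)
    have "(\<lambda>m. D * (1 / 2) ^ m) \<longlonglongrightarrow> 0"
      using tendsto_mult_left[OF LIMSEQ_power_zero[of "1 / 2 :: real"], of D] by simp
    then have "(\<lambda>m. cmod (f (z / q ^ m)) * ?p m ^ t / (2 * M) ^ m) \<longlonglongrightarrow> 0"
      by (rule tendsto_sandwich[OF lower upper tendsto_const])
    then show ?thesis
      using M0 by (intro exI[of _ "2 * M"]) auto
  qed
  then show ?thesis
    using c by blast
qed

text \<open>The slope of block \<open>(i, j)\<close> is \<open>\<mu>\<^sub>i - \<mu>\<^sub>j\<close>.\<close>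

abbreviation slope_at_least :: "nat \<Rightarrow> nat \<Rightarrow> nat \<Rightarrow> bool" where
  "slope_at_least t \<equiv> \<lambda>i j. i < j \<and> int t \<le> \<mu> i - \<mu> j"

abbreviation slope_equal :: "nat \<Rightarrow> nat \<Rightarrow> nat \<Rightarrow> bool" where
  "slope_equal t \<equiv> \<lambda>i j. i < j \<and> \<mu> i - \<mu> j = int t"

lemma pattern_mats_eqI:
  assumes "M \<in> pmat S" "\<And>a b. a < n \<Longrightarrow> b < n \<Longrightarrow> S (bl a) (bl b) \<Longrightarrow> \<not> T (bl a) (bl b) \<Longrightarrow> M $$ (a, b) = 0"
  shows "M \<in> pmat T"
  using assms unfolding pattern_mats_def by blast

lemma solutions_pattern_step:
  assumes F: "F \<in> solutions K V" "K \<subseteq> carrier_mat n n" and w: "w \<in> P V" "F w \<in> pmat T"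
  shows "F (q * w) \<in> pmat T"
proof -
  have "F (q * w) = A0 w * F w * A0_inv w"
    using A0_equation_iff(1)[OF Eq_preimage_nonzero[OF w(1)], of "F w" "F (q * w)"]
      solutionsD(2,3)[OF F(1)] F(2) w Eq_preimage_mult_q by blast
  then show ?thesis
    using pattern_mats_conjugate_A0[OF Eq_preimage_nonzero[OF w(1)] w(2)] by simp
qed

lemma solutions_pattern_propagate:
  assumes F: "F \<in> solutions K V" "K \<subseteq> carrier_mat n n" and W: "sector q W V"
    and pat: "\<And>w. w \<in> W \<Longrightarrow> F w \<in> pmat T"
  shows "F \<in> solutions (pmat T) V"
proof (rule solutions_change_values[OF F(1)])
  fix z assume z: "z \<in> P V"
  show "F z \<in> pmat T"
    by (rule sector_induct[OF W z]) (use pat solutions_pattern_step[OF F] in auto)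
qed

text \<open>On an orbit \<open>z, z/q, z/q\<^sup>2, \<dots>\<close> the blocks with \<open>\<mu>\<^sub>i - \<mu>\<^sub>j < t\<close>, multiplied by \<open>\<bar>\<theta>\<bar>\<^sup>t\<close>, grow faster
  than every exponential unless they vanish, whereas \<open>t\<close>-flatness allows only exponential growth.\<close>

lemma t_flat_orbit_pattern:
  assumes F: "F \<in> solutions (pmat (<)) V" and z: "z \<in> P V"
    and tf: "\<And>a b. a < n \<Longrightarrow> b < n \<Longrightarrow> \<exists>L>0.
      (\<lambda>m. cmod (F (z / q ^ m) $$ (a, b)) * (\<Prod>l=1..m. cmod (q ^ l / z)) ^ t / L ^ m) \<longlonglongrightarrow> 0"
  shows "F z \<in> pmat (slope_at_least t)"
proof (cases t)
  case 0
  then show ?thesis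
    using pattern_mats_mono[OF solutionsD(2)[OF F z], of "slope_at_least 0"] mu_decreasing
    by (simp add: less_imp_le)
next
  case (Suc d)
  have car: "pmat (<) \<subseteq> carrier_mat n n"
    using pattern_mats_carrier by blast
  have z0: "z \<noteq> 0"
    by (rule Eq_preimage_nonzero[OF z])
  define S where "S = (\<lambda>i j. i < j \<and> \<mu> i - \<mu> j < int t)"
  define N where "N = (\<lambda>m. pattern_norm S (F (z / q ^ m)))"
  define p where "p = (\<lambda>m. \<Prod>l=1..m. cmod (q ^ l / z))"
  have p_pos: "0 < p m" for m
    using z0 unfolding p_def by (intro prod_pos) auto
  have p_Suc: "p (Suc m) = p m / cmod (z / q ^ Suc m)" for m
    by (simp add: p_def norm_divide)
  have "\<exists>L. \<forall>a<n. \<forall>b<n. 0 < L a b \<and>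
      (\<lambda>m. cmod (F (z / q ^ m) $$ (a, b)) * p m ^ t / L a b ^ m) \<longlonglongrightarrow> 0"
    by (rule choice_less2) (use tf in \<open>simp add: p_def\<close>)
  then obtain L where L: "\<And>a b. a < n \<Longrightarrow> b < n \<Longrightarrow> 0 < L a b"
    and lim: "\<And>a b. a < n \<Longrightarrow> b < n \<Longrightarrow> (\<lambda>m. cmod (F (z / q ^ m) $$ (a, b)) * p m ^ t / L a b ^ m) \<longlonglongrightarrow> 0"
    by blast
  define L0 where "L0 = 1 + (\<Sum>a<n. \<Sum>b<n. L a b)"
  have sumL: "0 \<le> (\<Sum>b<n. L a b)" if "a < n" for a
    using L that by (intro sum_nonneg) (auto intro: less_imp_le)
  have L0: "L a b \<le> L0" if "a < n" "b < n" for a b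
  proof -
    have "L a b \<le> (\<Sum>b<n. L a b)"
      using that L by (intro member_le_sum) (auto intro: less_imp_le)
    also have "\<dots> \<le> (\<Sum>a<n. \<Sum>b<n. L a b)"
      using that sumL by (intro member_le_sum) auto
    finally show ?thesis
      by (simp add: L0_def)
  qed
  have L0_pos: "0 < L0"
    unfolding L0_def by (intro add_pos_nonneg sum_nonneg) (auto intro: less_imp_le[OF L])
  \<comment> \<open>\<open>s\<close> tends to \<open>0\<close> by \<open>t\<close>-flatness, but it is eventually increasing: a step towards \<open>0\<close> costs \<open>N\<close> at most
    the factor \<open>\<bar>w\<bar>\<^sup>d\<close> with \<open>d = t - 1\<close>, while \<open>p\<^sup>t\<close> gains \<open>\<bar>w\<bar>\<^sup>-\<^sup>t\<close>. So it is \<open>0\<close> from some index on.\<close>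
  define s where "s = (\<lambda>m. N m * p m ^ t / L0 ^ m)"
  have "(\<lambda>m. (\<Sum>a<n. \<Sum>b<n. (if S (bl a) (bl b) then cmod (F (z / q ^ m) $$ (a, b)) else 0) * p m ^ t / L0 ^ m))
      \<longlonglongrightarrow> (\<Sum>a<n. \<Sum>b<n. 0)"
  proof (intro tendsto_sum)
    fix a b assume "a \<in> {..<n}" "b \<in> {..<n}"
    then have ab: "a < n" "b < n"
      by auto
    let ?e = "\<lambda>m. (if S (bl a) (bl b) then cmod (F (z / q ^ m) $$ (a, b)) else 0) * p m ^ t / L0 ^ m"
    have lower: "eventually (\<lambda>m. 0 \<le> ?e m) sequentially"
      using p_pos L0_pos by (intro always_eventually allI) (simp add: less_imp_le)
    have upper: "eventually (\<lambda>m. ?e m \<le> cmod (F (z / q ^ m) $$ (a, b)) * p m ^ t / L a b ^ m) sequentially"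
    proof (intro always_eventually allI)
      fix m
      have "?e m \<le> cmod (F (z / q ^ m) $$ (a, b)) * p m ^ t / L0 ^ m"
        using p_pos[of m] L0_pos by (intro divide_right_mono mult_right_mono) auto
      also have "\<dots> \<le> cmod (F (z / q ^ m) $$ (a, b)) * p m ^ t / L a b ^ m"
        using p_pos[of m] L[OF ab] L0[OF ab]
        by (intro divide_left_mono power_mono mult_nonneg_nonneg mult_pos_pos) (auto intro: less_imp_le)
      finally show "?e m \<le> cmod (F (z / q ^ m) $$ (a, b)) * p m ^ t / L a b ^ m" .
    qed
    show "?e \<longlonglongrightarrow> 0"
      by (rule tendsto_sandwich[OF lower upper tendsto_const lim[OF ab]])
  qed
  then have s_lim: "s \<longlonglongrightarrow> 0"
    by (simp add: s_def N_def pattern_norm_def sum_distrib_right sum_divide_distrib)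
  have slope: "\<mu> i - \<mu> j \<le> int d" if "S i j" for i j
    using that Suc by (simp add: S_def)
  obtain C where C: "0 < C" "\<And>w. w \<in> P V \<Longrightarrow> cmod w \<le> 1 \<Longrightarrow>
      cmod w ^ d * pattern_norm S (F (q * w)) \<le> C * pattern_norm S (F w)"
    using pattern_norm_step_up[OF slope F car] by blast
  have step: "s m \<le> (C * L0 * cmod (z / q ^ Suc m)) * s (Suc m)" if small: "cmod (z / q ^ Suc m) \<le> 1" for m
  proof -
    let ?w = "z / q ^ Suc m"
    have w0: "0 < cmod ?w"
      using z0 by simp
    have "q * ?w = z / q ^ m"
      by simp
    then have "cmod ?w ^ d * N m \<le> C * N (Suc m)"
      using C(2)[of ?w] small z by (simp only: N_def Eq_preimage_divide_q_power)
    then have "cmod ?w ^ d * N m * (p m ^ t / L0 ^ m) \<le> C * N (Suc m) * (p m ^ t / L0 ^ m)"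
      using p_pos[of m] L0_pos by (intro mult_right_mono) (auto intro: less_imp_le)
    moreover have "p m ^ t = p (Suc m) ^ t * (cmod ?w ^ d * cmod ?w)"
      using w0 unfolding p_Suc Suc by (simp add: power_divide)
    ultimately have "cmod ?w ^ d * s m \<le> cmod ?w ^ d * (C * L0 * cmod ?w * s (Suc m))"
      using L0_pos by (simp add: s_def field_simps)
    then show ?thesis
      using w0 by (simp only: mult_le_cancel_left_pos zero_less_power)
  qed
  have "(\<lambda>m. cmod (z / q ^ Suc m)) \<longlonglongrightarrow> 0"
    using LIMSEQ_Suc[OF tendsto_norm_zero[OF scale_tendsto_0[of z]]] .
  then have "eventually (\<lambda>m. cmod (z / q ^ Suc m) < min 1 (1 / (C * L0))) sequentially"
    using C(1) L0_pos by (intro order_tendstoD(2)[where y = 0]) auto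
  then obtain M where M: "\<And>m. M \<le> m \<Longrightarrow> cmod (z / q ^ Suc m) < min 1 (1 / (C * L0))"
    unfolding eventually_sequentially by blast
  have s_nonneg: "0 \<le> s m" for m
    using p_pos[of m] L0_pos by (simp add: s_def N_def pattern_norm_nonneg less_imp_le)
  have "s (M + m) \<le> s (M + Suc m)" for m
  proof -
    let ?c = "cmod (z / q ^ Suc (M + m))"
    have c: "?c < 1" "?c < 1 / (C * L0)"
      using M[of "M + m"] by simp_all
    have "C * L0 * ?c \<le> 1"
      using c(2) C(1) L0_pos by (simp add: field_simps)
    then have "C * L0 * ?c * s (Suc (M + m)) \<le> 1 * s (Suc (M + m))"
      using s_nonneg by (intro mult_right_mono)
    then show ?thesis
      using step[of "M + m"] c(1) by simp
  qed
  then have "incseq (\<lambda>m. s (M + m))"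
    by (rule incseq_SucI)
  moreover have "(\<lambda>m. s (M + m)) \<longlonglongrightarrow> 0"
    using LIMSEQ_ignore_initial_segment[OF s_lim, of M] by (simp add: add.commute)
  ultimately have "s (M + 0) \<le> 0"
    by (rule incseq_le)
  then have "N M * p M ^ t = 0"
    using s_nonneg[of M] L0_pos by (simp add: s_def)
  then have norm0: "pattern_norm S (F (z / q ^ M)) = 0"
    using p_pos[of M] by (simp add: N_def)
  have zM: "z / q ^ M \<in> P V"
    using z by (simp add: Eq_preimage_divide_q_power)
  have "F (z / q ^ M) \<in> pmat (slope_at_least t)"
  proof (rule pattern_mats_eqI[OF solutionsD(2)[OF F zM]])
    fix a b assume "a < n" "b < n" "bl a < bl b" "\<not> slope_at_least t (bl a) (bl b)"
    then show "F (z / q ^ M) $$ (a, b) = 0"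
      using entry_le_pattern_norm[of a b S "F (z / q ^ M)"] norm0 by (simp add: S_def)
  qed
  moreover have "F z \<in> pmat T" if "z \<in> P V" "F (z / q ^ M) \<in> pmat T" for M z T
    using that
  proof (induction M arbitrary: z)
    case (Suc M)
    have "F (z / q) \<in> pmat T"
      by (rule Suc.IH) (use Suc.prems in \<open>simp_all add: Eq_preimage_divide_q\<close>)
    then show ?case
      using solutions_pattern_step[OF F car, of "z / q" T] Suc.prems by (simp add: Eq_preimage_divide_q)
  qed simp
  ultimately show ?thesis
    using z by blast
qed

text \<open>Different entries may be \<open>t\<close>-flat with respect to different theta functions. Off the zeros of all
  of them the orbit argument applies; continuity covers the zeros.\<close>

lemma solutions_t_flat_pattern:
  assumes V: "openin (Eq_space q) V" and F: "F \<in> solutions (pmat (<)) V"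
    and tf: "\<And>a b. a < n \<Longrightarrow> b < n \<Longrightarrow>
      \<exists>W f W'. sector q W V \<and> t_flat_on q t W f \<and> sector q W' V \<and> (\<forall>w\<in>W'. F w $$ (a, b) = f w)"
  shows "F \<in> solutions (pmat (slope_at_least t)) V"
proof -
  let ?e = "\<lambda>z a b m. cmod (F (z / q ^ m) $$ (a, b)) * (\<Prod>l=1..m. cmod (q ^ l / z)) ^ t"
  have "\<exists>c. c \<noteq> 0 \<and> (\<forall>z\<in>P V. theta q c z \<noteq> 0 \<longrightarrow> (\<exists>L>0. (\<lambda>m. ?e z a b m / L ^ m) \<longlonglongrightarrow> 0))"
    if ab: "a < n" "b < n" for a b
  proof -
    obtain W f W' where W: "sector q W V" "t_flat_on q t W f" and W': "sector q W' V"
      and eq: "\<And>w. w \<in> W' \<Longrightarrow> F w $$ (a, b) = f w"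
      using tf[OF ab] by blast
    obtain c where c: "c \<noteq> 0" "\<And>z. z \<in> P V \<Longrightarrow> theta q c z \<noteq> 0 \<Longrightarrow> \<exists>L>0.
        (\<lambda>m. cmod (f (z / q ^ m)) * (\<Prod>l=1..m. cmod (q ^ l / z)) ^ t / L ^ m) \<longlonglongrightarrow> 0"
      using t_flat_entry_on_orbit[OF W(2,1)] by blast
    have "\<exists>L>0. (\<lambda>m. ?e z a b m / L ^ m) \<longlonglongrightarrow> 0" if z: "z \<in> P V" "theta q c z \<noteq> 0" for z
    proof -
      obtain L where L: "0 < L"
        "(\<lambda>m. cmod (f (z / q ^ m)) * (\<Prod>l=1..m. cmod (q ^ l / z)) ^ t / L ^ m) \<longlonglongrightarrow> 0"
        using c(2)[OF z] by blast
      obtain m0 where "z / q ^ m0 \<in> W'"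
        by (rule sector_absorbs[OF W' z(1)])
      then have "f (z / q ^ m) = F (z / q ^ m) $$ (a, b)" if "m0 \<le> m" for m
        using eq sector_divide_q_power_mono[OF W' _ that] by simp
      then have "eventually (\<lambda>m. cmod (f (z / q ^ m)) * (\<Prod>l=1..m. cmod (q ^ l / z)) ^ t / L ^ m =
          ?e z a b m / L ^ m) sequentially"
        unfolding eventually_sequentially by (intro exI[of _ m0]) simp
      from Lim_transform_eventually[OF L(2) this] show ?thesis
        using L(1) by blast
    qed
    then show ?thesis
      using c(1) by blast
  qed
  then have "\<exists>c. \<forall>a<n. \<forall>b<n. c a b \<noteq> 0 \<and>
      (\<forall>z\<in>P V. theta q (c a b) z \<noteq> 0 \<longrightarrow> (\<exists>L>0. (\<lambda>m. ?e z a b m / L ^ m) \<longlonglongrightarrow> 0))"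
    by (rule choice_less2)
  then obtain c where c: "\<And>a b. a < n \<Longrightarrow> b < n \<Longrightarrow> c a b \<noteq> 0"
    and lim: "\<And>a b z. a < n \<Longrightarrow> b < n \<Longrightarrow> z \<in> P V \<Longrightarrow> theta q (c a b) z \<noteq> 0 \<Longrightarrow>
      \<exists>L>0. (\<lambda>m. ?e z a b m / L ^ m) \<longlonglongrightarrow> 0"
    by blast
  define Z where "Z = (\<Union>a<n. \<Union>b<n. {z. z \<noteq> 0 \<and> theta q (c a b) z = 0})"
  have Z: "countable Z"
    unfolding Z_def by (intro countable_UN countable_finite finite_lessThan countable_theta_zeros[OF q_gt_1] c) auto
  have off_Z: "F z \<in> pmat (slope_at_least t)" if z: "z \<in> P V" "z \<notin> Z" for z
  proof (rule t_flat_orbit_pattern[OF F z(1)])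
    fix a b assume ab: "a < n" "b < n"
    have "theta q (c a b) z \<noteq> 0"
      using z Eq_preimage_nonzero[OF z(1)] ab unfolding Z_def by blast
    then show "\<exists>L>0. (\<lambda>m. ?e z a b m / L ^ m) \<longlonglongrightarrow> 0"
      by (rule lim[OF ab z(1)])
  qed
  \<comment> \<open>The zeros of the theta functions are countable, so they cannot fill the open set where an
    entry is nonzero.\<close>
  show ?thesis
  proof (rule solutions_change_values[OF F])
    fix z assume z: "z \<in> P V"
    show "F z \<in> pmat (slope_at_least t)"
    proof (rule pattern_mats_eqI[OF solutionsD(2)[OF F z]], rule ccontr)
      fix a b assume ab: "a < n" "b < n" and no: "\<not> slope_at_least t (bl a) (bl b)"
        and nz: "F z $$ (a, b) \<noteq> 0"
      let ?U = "P V \<inter> (\<lambda>w. F w $$ (a, b)) -` (- {0})"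
      have "continuous_on (P V) (\<lambda>w. F w $$ (a, b))"
        by (rule holomorphic_on_imp_continuous_on[OF mat_holomorphic_onD[OF solutionsD(4)[OF F] ab]])
      then have "open ?U"
        by (rule continuous_open_preimage[OF _ open_Eq_preimage[OF V]]) auto
      moreover have "z \<in> ?U"
        using z nz by simp
      ultimately obtain \<epsilon> where \<epsilon>: "0 < \<epsilon>" "ball z \<epsilon> \<subseteq> ?U"
        by (rule openE)
      have "?U \<subseteq> Z"
      proof (rule subsetI, rule ccontr)
        fix w assume w: "w \<in> ?U" "w \<notin> Z"
        then have "F w $$ (a, b) = 0"
          using off_Z[of w] no ab by (simp add: pattern_mats_def)
        with w show False
          by simp
      qed
      then have "countable (ball z \<epsilon>)"
        using countable_subset[OF _ Z] \<epsilon>(2) by blast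
      then show False
        using uncountable_ball[OF \<epsilon>(1)] by blast
    qed
  qed
qed

section \<open>Sections of the sheaves as global solutions\<close>

lemma mat_block_zero_iff:
  assumes i: "i \<in> {1..k}" and j: "j \<in> {1..k}"
  shows "mat_block r i j M = 0\<^sub>m (r i) (r j) \<longleftrightarrow> (\<forall>a<n. \<forall>b<n. bl a = i \<longrightarrow> bl b = j \<longrightarrow> M $$ (a, b) = 0)"
    (is "?L \<longleftrightarrow> ?R")
proof
  assume L: ?L
  show ?R
  proof (intro allI impI)
    fix a b assume ab: "a < n" "b < n" "bl a = i" "bl b = j"
    obtain i' a' where a: "i' \<in> {1..k}" "a' < r i'" "a = block_offset r i' + a'"
      using index_block_cases[OF ab(1)] .
    obtain j' b' where b: "j' \<in> {1..k}" "b' < r j'" "b = block_offset r j' + b'"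
      using index_block_cases[OF ab(2)] .
    have "i' = i" "j' = j"
      using a b ab by (auto simp: block_of_offset_add)
    then have "M $$ (a, b) = mat_block r i j M $$ (a', b')"
      using a b by (simp add: mat_block_def block_offset_def)
    then show "M $$ (a, b) = 0"
      using L a b \<open>i' = i\<close> \<open>j' = j\<close> by simp
  qed
next
  assume R: ?R
  show ?L
  proof (rule eq_matI)
    fix a b assume "a < dim_row (0\<^sub>m (r i) (r j) :: complex mat)" "b < dim_col (0\<^sub>m (r i) (r j) :: complex mat)"
    then have ab: "a < r i" "b < r j"
      by auto
    have "block_offset r i + a < n" "block_offset r j + b < n"
      using block_offset_add_le_total_rank[OF i, of r] block_offset_add_le_total_rank[OF j, of r] ab by auto
    then have "M $$ (block_offset r i + a, block_offset r j + b) = 0"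
      using R ab i j by (simp add: block_of_offset_add)
    then show "mat_block r i j M $$ (a, b) = 0\<^sub>m (r i) (r j) $$ (a, b)"
      using ab by (simp add: mat_block_def block_offset_def)
  qed (auto simp: mat_block_def)
qed

lemma block_vanishes_sgerm_iff:
  assumes W: "sector q W V"
  shows "block_vanishes q V r i j (sgerm q V W f) \<longleftrightarrow>
    (\<exists>W'. sector q W' V \<and> W' \<subseteq> W \<and> (\<forall>z\<in>W'. mat_block r i j (f z) = 0\<^sub>m (r i) (r j)))" (is "?L \<longleftrightarrow> ?R")
proof -
  note PV = sector_Eq_preimage[OF sector_horizon_open[OF W]]
  have L: "?L \<longleftrightarrow> sgerm q V W (\<lambda>z. mat_block r i j (f z)) = sgerm q V (P V) (\<lambda>z. 0\<^sub>m (r i) (r j))"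
    by (simp add: block_vanishes_def sgerm_map_sgerm[OF W] sgerm_const_def)
  show ?thesis
    unfolding L
  proof
    assume "sgerm q V W (\<lambda>z. mat_block r i j (f z)) = sgerm q V (P V) (\<lambda>z. 0\<^sub>m (r i) (r j))"
    with W PV show ?R
      by (rule sgerm_eqD) blast
  next
    assume ?R
    then obtain W' where W': "sector q W' V" "W' \<subseteq> W" "\<And>z. z \<in> W' \<Longrightarrow> mat_block r i j (f z) = 0\<^sub>m (r i) (r j)"
      by blast
    show "sgerm q V W (\<lambda>z. mat_block r i j (f z)) = sgerm q V (P V) (\<lambda>z. 0\<^sub>m (r i) (r j))"
      by (rule sgerm_eqI[OF W PV W'(1)]) (use W'(2,3) sector_subset[OF W] in auto)
  qed
qed

lemma block_vanishes_full_germ: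
  assumes V: "openin (Eq_space q) V" and F: "F \<in> solutions (pmat S) V"
    and ij: "i \<in> {1..k}" "j \<in> {1..k}" "\<not> S i j"
  shows "block_vanishes q V r i j (full_germ V F)"
  unfolding block_vanishes_sgerm_iff[OF sector_Eq_preimage[OF V]]
proof (intro exI[of _ "P V"] conjI ballI)
  fix z assume "z \<in> P V"
  then show "mat_block r i j (F z) = 0\<^sub>m (r i) (r j)"
    unfolding mat_block_zero_iff[OF ij(1,2)] using solutionsD(2)[OF F, of z] ij(3) by (auto simp: pattern_mats_def)
qed (use sector_Eq_preimage[OF V] in auto)

text \<open>Finitely many blocks are involved, so one sector serves them all.\<close>

lemma block_vanishes_pattern:
  assumes W: "sector q W V" and car: "f \<in> W \<rightarrow> carrier_mat n n"
    and vanish: "\<And>i j. i \<in> {1..k} \<Longrightarrow> j \<in> {1..k} \<Longrightarrow> \<not> S i j \<Longrightarrow> block_vanishes q V r i j (sgerm q V W f)"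
  shows "\<exists>W'. sector q W' V \<and> W' \<subseteq> W \<and> (\<forall>z\<in>W'. f z \<in> pmat S)"
proof -
  let ?I = "{p \<in> {1..k} \<times> {1..k}. \<not> S (fst p) (snd p)}"
  have "\<forall>p\<in>?I. \<exists>W'. sector q W' V \<and> W' \<subseteq> W \<and> (\<forall>z\<in>W'. mat_block r (fst p) (snd p) (f z) = 0\<^sub>m (r (fst p)) (r (snd p)))"
    using vanish unfolding block_vanishes_sgerm_iff[OF W] by auto
  from bchoice[OF this] obtain T where T: "\<forall>p\<in>?I. sector q (T p) V \<and> T p \<subseteq> W \<and>
      (\<forall>z\<in>T p. mat_block r (fst p) (snd p) (f z) = 0\<^sub>m (r (fst p)) (r (snd p)))" ..
  have T_sector: "sector q (T p) V" if "p \<in> ?I" for p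
    using bspec[OF T that] by (rule conjunct1)
  have "finite ?I"
    by (rule finite_subset[of _ "{1..k} \<times> {1..k}"]) auto
  then have "\<exists>W'. sector q W' V \<and> W' \<subseteq> W \<and> (\<forall>p\<in>?I. W' \<subseteq> T p)"
    by (rule sector_finite_Int[OF _ T_sector W])
  then obtain W' where W': "sector q W' V" "W' \<subseteq> W" "\<forall>p\<in>?I. W' \<subseteq> T p"
    by (elim exE conjE)
  have "f z \<in> pmat S" if z: "z \<in> W'" for z
    unfolding pattern_mats_def
  proof (intro CollectI conjI allI impI)
    show "f z \<in> carrier_mat n n"
      using car W' z by blast
    fix a b assume ab: "a < n" "b < n" "\<not> S (bl a) (bl b)"
    then have p: "(bl a, bl b) \<in> ?I"
      using block_of_range[OF ab(1)] block_of_range[OF ab(2)] by auto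
    then have "mat_block r (bl a) (bl b) (f z) = 0\<^sub>m (r (bl a)) (r (bl b))"
      using bspec[OF T p] bspec[OF W'(3) p] z by auto
    then show "f z $$ (a, b) = 0"
      using mat_block_zero_iff[OF block_of_range[OF ab(1)] block_of_range[OF ab(2)]] ab by blast
  qed
  then show ?thesis
    using W'(1,2) by blast
qed

text \<open>One inclusion is the automatic flatness of solutions; for the other, a representative is
  restricted to a sector where all the conditions hold simultaneously, and extended from there.\<close>

lemma lambda_sections_eq:
  assumes V: "openin (Eq_space q) V"
  shows "lambda_sections q k \<mu> r A V = full_germ V ` solutions (pmat (<)) V"
proof (intro equalityI subsetI)
  fix s assume "s \<in> full_germ V ` solutions (pmat (<)) V"
  then obtain F where F: "F \<in> solutions (pmat (<)) V" and s: "s = full_germ V F"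
    by blast
  note PV = sector_Eq_preimage[OF V]
  show "s \<in> lambda_sections q k \<mu> r A V"
    unfolding lambda_sections_def s
  proof (intro CollectI conjI allI ballI impI)
    have "F \<in> P V \<rightarrow> carrier_mat n n"
      using solutionsD(2)[OF F] pattern_mats_carrier by blast
    then show "\<exists>W f. sector q W V \<and> f \<in> W \<rightarrow> carrier_mat n n \<and> full_germ V F = sgerm q V W f"
      using PV by blast
  next
    fix a b assume "a < n" "b < n"
    then have "flat_on q (P V) (\<lambda>z. F z $$ (a, b))"
      by (rule solutions_flat[OF V F])
    then show "sgerm_entry q V a b (full_germ V F) \<in> flat_sections q V"
      unfolding sgerm_entry_def sgerm_map_sgerm[OF PV] flat_sections_def using PV by blast
  next
    fix i j assume "i \<in> {1..k}" "j \<in> {1..k}" "\<not> i < j"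
    then show "block_vanishes q V r i j (full_germ V F)"
      by (rule block_vanishes_full_germ[OF V F])
  next
    have scale: "P V \<subseteq> (\<lambda>z. z / q) ` P V"
      by (rule subsetI, rule image_eqI[of _ _ "q * _"]) (auto simp: Eq_preimage_mult_q)
    show "sgerm_map q V (\<lambda>z M. M * A0 z) (sgerm_sigma q V (full_germ V F)) =
        sgerm_map q V (\<lambda>z M. A0 z * M) (full_germ V F)"
      unfolding sgerm_sigma_sgerm[OF PV] sgerm_map_sgerm[OF PV] sgerm_map_sgerm[OF sector_scale[OF PV]]
      by (rule sgerm_eqI[OF sector_scale[OF PV] PV PV]) (use scale solutionsD(3)[OF F] in auto)
  qed
next
  fix s assume s: "s \<in> lambda_sections q k \<mu> r A V"
  then obtain W f where W: "sector q W V" and f: "f \<in> W \<rightarrow> carrier_mat n n" and sf: "s = sgerm q V W f"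
    unfolding lambda_sections_def by blast
  have "block_vanishes q V r i j (sgerm q V W f)" if "i \<in> {1..k}" "j \<in> {1..k}" "\<not> i < j" for i j
    using s that unfolding lambda_sections_def sf by blast
  then have "\<exists>W1. sector q W1 V \<and> W1 \<subseteq> W \<and> (\<forall>z\<in>W1. f z \<in> pmat (<))"
    by (rule block_vanishes_pattern[OF W f])
  then obtain W1 where W1: "sector q W1 V" "W1 \<subseteq> W" "\<And>z. z \<in> W1 \<Longrightarrow> f z \<in> pmat (<)"
    by blast
  have "sgerm_map q V (\<lambda>z M. M * A0 z) (sgerm_sigma q V (sgerm q V W f)) =
      sgerm_map q V (\<lambda>z M. A0 z * M) (sgerm q V W f)"
    using s unfolding lambda_sections_def sf by blast
  then have "sgerm q V ((\<lambda>z. z / q) ` W) (\<lambda>z. f (q * z) * A0 z) = sgerm q V W (\<lambda>z. A0 z * f z)"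
    unfolding sgerm_sigma_sgerm[OF W] sgerm_map_sgerm[OF W] sgerm_map_sgerm[OF sector_scale[OF W]] .
  with sector_scale[OF W] W obtain W2 where W2: "sector q W2 V" "\<And>z. z \<in> W2 \<Longrightarrow> f (q * z) * A0 z = A0 z * f z"
    by (rule sgerm_eqD) blast
  have "\<exists>T. sector q T V \<and> (\<lambda>z. f z $$ (a, b)) holomorphic_on T" if ab: "a < n" "b < n" for a b
  proof -
    have "sgerm_entry q V a b (sgerm q V W f) \<in> flat_sections q V"
      using s ab unfolding lambda_sections_def sf by blast
    then obtain W' g where W': "sector q W' V" "flat_on q W' g"
      and eq: "sgerm q V W (\<lambda>z. f z $$ (a, b)) = sgerm q V W' g"
      unfolding sgerm_entry_def sgerm_map_sgerm[OF W] flat_sections_def by blast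
    from W W'(1) eq obtain T where T: "sector q T V" "T \<subseteq> W \<inter> W'" "\<And>z. z \<in> T \<Longrightarrow> f z $$ (a, b) = g z"
      by (rule sgerm_eqD) blast
    have "g holomorphic_on W'"
      using W'(2) by (simp add: flat_on_def)
    then have "g holomorphic_on T"
      by (rule holomorphic_on_subset) (use T(2) in blast)
    then have "(\<lambda>z. f z $$ (a, b)) holomorphic_on T"
      by (rule holomorphic_transform) (simp add: T(3))
    then show ?thesis
      using T(1) by blast
  qed
  then have "\<exists>T. \<forall>a<n. \<forall>b<n. sector q (T a b) V \<and> (\<lambda>z. f z $$ (a, b)) holomorphic_on T a b"
    by (rule choice_less2)
  then obtain T where T: "\<And>a b. a < n \<Longrightarrow> b < n \<Longrightarrow> sector q (T a b) V"
    "\<And>a b. a < n \<Longrightarrow> b < n \<Longrightarrow> (\<lambda>z. f z $$ (a, b)) holomorphic_on T a b"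
    by blast
  have T': "sector q (T (fst p) (snd p)) V" if "p \<in> {..<n} \<times> {..<n}" for p
    using T(1) that by auto
  have "finite ({..<n} \<times> {..<n})"
    by simp
  then have "\<exists>W0. sector q W0 V \<and> W0 \<subseteq> W1 \<inter> W2 \<and> (\<forall>p\<in>{..<n} \<times> {..<n}. W0 \<subseteq> T (fst p) (snd p))"
    by (rule sector_finite_Int[OF _ T' sector_Int[OF W1(1) W2(1)]])
  then obtain W0 where W0: "sector q W0 V" "W0 \<subseteq> W1 \<inter> W2"
    and W0T: "\<forall>p\<in>{..<n} \<times> {..<n}. W0 \<subseteq> T (fst p) (snd p)"
    by (elim exE conjE)
  have "mat_holomorphic_on f W0"
    unfolding mat_holomorphic_on_def
  proof (intro allI impI)
    fix a b assume ab: "a < n" "b < n"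
    show "(\<lambda>z. f z $$ (a, b)) holomorphic_on W0"
      by (rule holomorphic_on_subset[OF T(2)[OF ab]]) (use bspec[OF W0T, of "(a, b)"] ab in auto)
  qed
  moreover have "f z \<in> pmat (<)" if "z \<in> W0" for z
    using W1(3) W0(2) that by blast
  moreover have "f z * A0 (z / q) = A0 (z / q) * f (z / q)" if "z \<in> W0" for z
    using W2(2)[of "z / q"] sector_divide_q[OF W2(1), of z] W0(2) that by auto
  ultimately obtain F where F: "F \<in> solutions (pmat (<)) V" "\<And>z. z \<in> W0 \<Longrightarrow> F z = f z"
    using extend_from_sector[OF W0(1)] by metis
  have "s = full_germ V F"
    unfolding sf
    by (rule sgerm_eqI[OF W sector_Eq_preimage[OF V] W0(1)])
      (use W0(2) W1(2) sector_subset[OF W0(1)] F(2) in auto)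
  then show "s \<in> full_germ V ` solutions (pmat (<)) V"
    using F(1) by blast
qed

lemma lambda_t_sections_eq:
  assumes V: "openin (Eq_space q) V"
  shows "lambda_t_sections q k \<mu> r A t V = full_germ V ` solutions (pmat (slope_at_least t)) V"
proof (intro equalityI subsetI)
  note PV = sector_Eq_preimage[OF V]
  fix s assume "s \<in> full_germ V ` solutions (pmat (slope_at_least t)) V"
  then obtain F where F: "F \<in> solutions (pmat (slope_at_least t)) V" and s: "s = full_germ V F"
    by blast
  have F': "F \<in> solutions (pmat (<)) V"
    by (rule solutions_change_values[OF F]) (rule pattern_mats_mono[OF solutionsD(2)[OF F]], auto)
  have "sgerm_entry q V a b s \<in> t_flat_sections q t V" if ab: "a < n" "b < n" for a b
  proof -
    have "t_flat_on q t (P V) (\<lambda>z. F z $$ (a, b))"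
      by (rule solutions_t_flat[OF V F _ ab]) auto
    moreover have "flat_on q (P V) (\<lambda>z. F z $$ (a, b))"
      by (rule solutions_flat[OF V F' ab])
    ultimately show ?thesis
      unfolding s sgerm_entry_def sgerm_map_sgerm[OF PV] t_flat_sections_def using PV by blast
  qed
  then show "s \<in> lambda_t_sections q k \<mu> r A t V"
    unfolding lambda_t_sections_def lambda_sections_eq[OF V] using F' s by blast
next
  note PV = sector_Eq_preimage[OF V]
  fix s assume "s \<in> lambda_t_sections q k \<mu> r A t V"
  then obtain F where F: "F \<in> solutions (pmat (<)) V" and s: "s = full_germ V F"
    and tf: "\<And>a b. a < n \<Longrightarrow> b < n \<Longrightarrow> sgerm_entry q V a b s \<in> t_flat_sections q t V"
    unfolding lambda_t_sections_def lambda_sections_eq[OF V] by blast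
  have "\<exists>W f W'. sector q W V \<and> t_flat_on q t W f \<and> sector q W' V \<and> (\<forall>w\<in>W'. F w $$ (a, b) = f w)"
    if ab: "a < n" "b < n" for a b
  proof -
    obtain W f where W: "sector q W V" "t_flat_on q t W f"
      and eq: "full_germ V (\<lambda>z. F z $$ (a, b)) = sgerm q V W f"
      using tf[OF ab] unfolding s sgerm_entry_def sgerm_map_sgerm[OF PV] t_flat_sections_def by blast
    from PV W(1) eq obtain T where "sector q T V" "\<And>z. z \<in> T \<Longrightarrow> F z $$ (a, b) = f z"
      by (rule sgerm_eqD) blast
    then show ?thesis
      using W by blast
  qed
  then have "F \<in> solutions (pmat (slope_at_least t)) V"
    by (rule solutions_t_flat_pattern[OF V F])
  then show "s \<in> full_germ V ` solutions (pmat (slope_at_least t)) V"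
    using s by blast
qed

lemma lambda_graded_sections_eq:
  assumes V: "openin (Eq_space q) V"
  shows "lambda_graded_sections q k \<mu> r A t V = full_germ V ` solutions (pmat (slope_equal t)) V"
proof (intro equalityI subsetI)
  fix s assume "s \<in> full_germ V ` solutions (pmat (slope_equal t)) V"
  then obtain F where F: "F \<in> solutions (pmat (slope_equal t)) V" and s: "s = full_germ V F"
    by blast
  have F': "F \<in> solutions (pmat (<)) V"
    by (rule solutions_change_values[OF F]) (rule pattern_mats_mono[OF solutionsD(2)[OF F]], auto)
  have "block_vanishes q V r i j s" if "i \<in> {1..k}" "j \<in> {1..k}" "\<mu> i - \<mu> j \<noteq> int t" for i j
    unfolding s
    by (rule block_vanishes_full_germ[OF V F]) (use that in auto)
  then show "s \<in> lambda_graded_sections q k \<mu> r A t V"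
    unfolding lambda_graded_sections_def lambda_sections_eq[OF V] using F' s by blast
next
  note PV = sector_Eq_preimage[OF V]
  fix s assume "s \<in> lambda_graded_sections q k \<mu> r A t V"
  then obtain F where F: "F \<in> solutions (pmat (<)) V" and s: "s = full_germ V F"
    and bv: "\<And>i j. i \<in> {1..k} \<Longrightarrow> j \<in> {1..k} \<Longrightarrow> \<mu> i - \<mu> j \<noteq> int t \<Longrightarrow> block_vanishes q V r i j s"
    unfolding lambda_graded_sections_def lambda_sections_eq[OF V] by blast
  have car: "F \<in> P V \<rightarrow> carrier_mat n n"
    using solutionsD(2)[OF F] pattern_mats_carrier by blast
  have "block_vanishes q V r i j (full_germ V F)" if "i \<in> {1..k}" "j \<in> {1..k}" "\<not> slope_equal t i j" for i j
  proof (cases "i < j")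
    case True
    then show ?thesis
      using bv that s by blast
  next
    case False
    then show ?thesis
      using block_vanishes_full_germ[OF V F that(1,2)] by blast
  qed
  then have "\<exists>W. sector q W V \<and> W \<subseteq> P V \<and> (\<forall>z\<in>W. F z \<in> pmat (slope_equal t))"
    by (rule block_vanishes_pattern[OF PV car])
  then obtain W where W: "sector q W V" "\<And>z. z \<in> W \<Longrightarrow> F z \<in> pmat (slope_equal t)"
    by blast
  have "F \<in> solutions (pmat (slope_equal t)) V"
    by (rule solutions_pattern_propagate[OF F _ W]) (use pattern_mats_carrier in blast)
  then show "s \<in> full_germ V ` solutions (pmat (slope_equal t)) V"
    using s by blast
qed

section \<open>The filtration of the Stokes sheaf\<close>

lemma full_germ_restrict:
  "openin (Eq_space q) V \<Longrightarrow> full_germ V (restrict F (P V)) = full_germ V F"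
  by (rule sgerm_eqI) (auto intro: sector_Eq_preimage)

lemma one_plus_full_germ:
  assumes V: "openin (Eq_space q) V"
  shows "one_plus q n V (full_germ V F) = full_germ V (\<lambda>z. 1\<^sub>m n + F z)"
  by (simp add: one_plus_def sgerm_map_sgerm[OF sector_Eq_preimage[OF V]])

lemma solutions_one_plus:
  assumes F: "F \<in> solutions (pmat S) V"
  shows "(\<lambda>z\<in>P V. 1\<^sub>m n + F z) \<in> solutions (umat S) V"
proof (rule solutionsI)
  have c: "F z \<in> carrier_mat n n" if "z \<in> P V" for z
    using solutionsD(2)[OF F that] pattern_mats_carrier by blast
  show "mat_holomorphic_on (\<lambda>z. 1\<^sub>m n + F z) (P V)"
    by (rule mat_holomorphic_on_add[OF mat_holomorphic_on_const solutionsD(4)[OF F] c])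
  fix z assume z: "z \<in> P V"
  show "1\<^sub>m n + F z \<in> umat S"
    using solutionsD(2)[OF F z] by (simp add: unipotent_mats_def)
  show "(1\<^sub>m n + F (q * z)) * A0 z = A0 z * (1\<^sub>m n + F z)"
    by (rule A0_equation_add[OF one_carrier_mat c one_carrier_mat c A0_equation_one solutionsD(3)[OF F z]])
      (use z in \<open>simp_all add: Eq_preimage_mult_q\<close>)
qed

lemma one_plus_image_solutions:
  assumes V: "openin (Eq_space q) V"
  shows "one_plus q n V ` full_germ V ` solutions (pmat S) V = full_germ V ` solutions (umat S) V"
proof (intro equalityI subsetI)
  fix s assume "s \<in> one_plus q n V ` full_germ V ` solutions (pmat S) V"
  then obtain F where F: "F \<in> solutions (pmat S) V" "s = one_plus q n V (full_germ V F)"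
    by blast
  then have "s = full_germ V (\<lambda>z\<in>P V. 1\<^sub>m n + F z)"
    by (simp add: one_plus_full_germ[OF V] full_germ_restrict[OF V])
  then show "s \<in> full_germ V ` solutions (umat S) V"
    using solutions_one_plus[OF F(1)] by blast
next
  fix s assume "s \<in> full_germ V ` solutions (umat S) V"
  then obtain F where F: "F \<in> solutions (umat S) V" and s: "s = full_germ V F"
    by blast
  note G = solutions_minus_one[OF F]
  have "one_plus q n V (full_germ V (\<lambda>z\<in>P V. - 1\<^sub>m n + F z)) = s"
    unfolding one_plus_full_germ[OF V] s
    by (rule sgerm_eqI) (use G(2) V in \<open>auto intro: sector_Eq_preimage\<close>)
  then show "s \<in> one_plus q n V ` full_germ V ` solutions (pmat S) V"
    using G(1) by blast
qed

lemma unipotent_sheaf_iso: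
  assumes L: "\<And>V. openin (Eq_space q) V \<Longrightarrow> L V = full_germ V ` solutions (pmat S) V"
    and trans: "\<And>i j l. i \<in> {1..k} \<Longrightarrow> j \<in> {1..k} \<Longrightarrow> l \<in> {1..k} \<Longrightarrow> S i j \<Longrightarrow> S j l \<Longrightarrow> S i l"
    and strict: "\<And>i j. i \<in> {1..k} \<Longrightarrow> j \<in> {1..k} \<Longrightarrow> S i j \<Longrightarrow> i < j"
  shows "iso_of_group_sheaves (Eq_space q) (solution_presheaf (umat S) (*) (1\<^sub>m n)) (unipotent_sheaf q n L) full_germ"
proof (rule full_germ_iso)
  show "umat S \<subseteq> carrier_mat n n"
    using unipotent_mats_carrier by blast
  show "sheaf_of_groups (Eq_space q) (solution_presheaf (umat S) (*) (1\<^sub>m n))"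
    by (rule solution_presheaf_sheaf[OF unipotent_solutions_group[OF trans strict]])
qed (simp_all add: unipotent_sheaf_def L one_plus_image_solutions)

lemma additive_sheaf_iso:
  assumes L: "\<And>V. openin (Eq_space q) V \<Longrightarrow> L V = full_germ V ` solutions (pmat S) V"
  shows "iso_of_group_sheaves (Eq_space q) (solution_presheaf (pmat S) (+) (0\<^sub>m n n)) (additive_sheaf q n L) full_germ"
proof (rule full_germ_iso)
  show "pmat S \<subseteq> carrier_mat n n"
    using pattern_mats_carrier by blast
  show "sheaf_of_groups (Eq_space q) (solution_presheaf (pmat S) (+) (0\<^sub>m n n))"
    by (rule solution_presheaf_sheaf[OF additive_solutions_group])
qed (simp_all add: additive_sheaf_def L)

text \<open>A conjugate in the bigger group is again a solution, so only its values matter, and these are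
  handled by \<open>unipotent_mats_conjugate\<close>.\<close>

lemma solution_presheaf_normal:
  assumes trans_T: "\<And>i j l. i \<in> {1..k} \<Longrightarrow> j \<in> {1..k} \<Longrightarrow> l \<in> {1..k} \<Longrightarrow> T i j \<Longrightarrow> T j l \<Longrightarrow> T i l"
    and sub: "\<And>i j. i \<in> {1..k} \<Longrightarrow> j \<in> {1..k} \<Longrightarrow> S i j \<Longrightarrow> T i j"
    and strict: "\<And>i j. i \<in> {1..k} \<Longrightarrow> j \<in> {1..k} \<Longrightarrow> T i j \<Longrightarrow> i < j"
    and left: "\<And>i j l. i \<in> {1..k} \<Longrightarrow> j \<in> {1..k} \<Longrightarrow> l \<in> {1..k} \<Longrightarrow> T i j \<Longrightarrow> S j l \<Longrightarrow> S i l"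
    and right: "\<And>i j l. i \<in> {1..k} \<Longrightarrow> j \<in> {1..k} \<Longrightarrow> l \<in> {1..k} \<Longrightarrow> S i j \<Longrightarrow> T j l \<Longrightarrow> S i l"
  shows "solutions (umat S) V \<lhd> sec (solution_presheaf (umat T) (*) (1\<^sub>m n)) V" (is "?H \<lhd> ?G")
proof -
  interpret G: group ?G
    by (rule unipotent_solutions_group[OF trans_T strict])
  have car: "carrier ?G = solutions (umat T) V" and mul: "F \<otimes>\<^bsub>?G\<^esub> G = (\<lambda>z\<in>P V. F z * G z)"
    and one: "\<one>\<^bsub>?G\<^esub> = (\<lambda>z\<in>P V. 1\<^sub>m n)" for F G
    by (simp_all add: solution_presheaf_def)
  have subset: "?H \<subseteq> carrier ?G"
    unfolding car
  proof
    fix F assume F: "F \<in> ?H"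
    show "F \<in> solutions (umat T) V"
      by (rule solutions_change_values[OF F], rule unipotent_mats_mono[OF solutionsD(2)[OF F] sub])
  qed
  have "?G\<lparr>carrier := ?H\<rparr> = sec (solution_presheaf (umat S) (*) (1\<^sub>m n)) V"
    by (simp add: solution_presheaf_def)
  moreover have "group (sec (solution_presheaf (umat S) (*) (1\<^sub>m n)) V)"
    by (rule unipotent_solutions_group[OF left[OF _ _ _ sub] strict[OF _ _ sub]])
  ultimately have "subgroup ?H ?G"
    using G.group_incl_imp_subgroup[OF subset] by simp
  moreover have "F \<otimes>\<^bsub>?G\<^esub> X \<otimes>\<^bsub>?G\<^esub> inv\<^bsub>?G\<^esub> F \<in> ?H" if F: "F \<in> carrier ?G" and X: "X \<in> ?H" for F X
  proof -
    let ?F' = "inv\<^bsub>?G\<^esub> F"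
    have F': "?F' \<in> carrier ?G"
      using F by simp
    have inv: "F z * ?F' z = 1\<^sub>m n" if "z \<in> P V" for z
      using fun_cong[OF G.r_inv[OF F], of z] that unfolding mul one by simp
    have "F \<otimes>\<^bsub>?G\<^esub> X \<otimes>\<^bsub>?G\<^esub> ?F' \<in> solutions (umat T) V"
      using F F' X subset G.m_closed car by blast
    then show ?thesis
    proof (rule solutions_change_values)
      fix z assume z: "z \<in> P V"
      have "F z * X z * ?F' z \<in> umat S"
        by (rule unipotent_mats_conjugate[OF _ _ _ inv[OF z] left right])
          (use z F F' X solutionsD(2) in \<open>auto simp: car\<close>)
      then show "(F \<otimes>\<^bsub>?G\<^esub> X \<otimes>\<^bsub>?G\<^esub> ?F') z \<in> umat S"
        using z unfolding mul by simp
    qed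
  qed
  ultimately show ?thesis
    unfolding G.normal_inv_iff by blast
qed

lemma unipotent_sheaf_normal:
  assumes L1: "\<And>V. openin (Eq_space q) V \<Longrightarrow> L1 V = full_germ V ` solutions (pmat S) V"
    and L2: "\<And>V. openin (Eq_space q) V \<Longrightarrow> L2 V = full_germ V ` solutions (pmat T) V"
    and trans_T: "\<And>i j l. i \<in> {1..k} \<Longrightarrow> j \<in> {1..k} \<Longrightarrow> l \<in> {1..k} \<Longrightarrow> T i j \<Longrightarrow> T j l \<Longrightarrow> T i l"
    and sub: "\<And>i j. i \<in> {1..k} \<Longrightarrow> j \<in> {1..k} \<Longrightarrow> S i j \<Longrightarrow> T i j"
    and strict: "\<And>i j. i \<in> {1..k} \<Longrightarrow> j \<in> {1..k} \<Longrightarrow> T i j \<Longrightarrow> i < j"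
    and left: "\<And>i j l. i \<in> {1..k} \<Longrightarrow> j \<in> {1..k} \<Longrightarrow> l \<in> {1..k} \<Longrightarrow> T i j \<Longrightarrow> S j l \<Longrightarrow> S i l"
    and right: "\<And>i j l. i \<in> {1..k} \<Longrightarrow> j \<in> {1..k} \<Longrightarrow> l \<in> {1..k} \<Longrightarrow> S i j \<Longrightarrow> T j l \<Longrightarrow> S i l"
  shows "sheaf_of_normal_subgroups (Eq_space q) (unipotent_sheaf q n L1) (unipotent_sheaf q n L2)"
proof -
  note isoS = unipotent_sheaf_iso[OF L1 left[OF _ _ _ sub] strict[OF _ _ sub]]
  note isoT = unipotent_sheaf_iso[OF L2 trans_T strict]
  have normal: "carrier (sec (unipotent_sheaf q n L1) V) \<lhd> sec (unipotent_sheaf q n L2) V"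
    if V: "openin (Eq_space q) V" for V
  proof -
    let ?G = "sec (solution_presheaf (umat T) (*) (1\<^sub>m n)) V"
    have iso: "full_germ V \<in> iso ?G (sec (unipotent_sheaf q n L2) V)"
      and group2: "group (sec (unipotent_sheaf q n L2) V)"
      using isoT V by (auto simp: iso_of_group_sheaves_def sheaf_of_groups_def presheaf_of_groups_def)
    have group1: "group ?G"
      by (rule unipotent_solutions_group[OF trans_T strict])
    have normal1: "solutions (umat S) V \<lhd> ?G"
      by (rule solution_presheaf_normal[OF trans_T sub strict left right])
    have "full_germ V ` solutions (umat S) V \<lhd> sec (unipotent_sheaf q n L2) V"
      by (rule iso_normal_subgroup[OF iso group1 group2 normal1])
    then show ?thesis
      by (simp add: unipotent_sheaf_def L1[OF V] one_plus_image_solutions[OF V])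
  qed
  show ?thesis
    unfolding sheaf_of_normal_subgroups_def
  proof (intro conjI allI impI ballI)
    show "sheaf_of_groups (Eq_space q) (unipotent_sheaf q n L1)"
      "sheaf_of_groups (Eq_space q) (unipotent_sheaf q n L2)"
      using isoS isoT by (simp_all add: iso_of_group_sheaves_def)
    show "sec (unipotent_sheaf q n L1) V =
        (sec (unipotent_sheaf q n L2) V)\<lparr>carrier := carrier (sec (unipotent_sheaf q n L1) V)\<rparr>" for V
      by (simp add: unipotent_sheaf_def)
    show "group_presheaf.res (unipotent_sheaf q n L1) U V s = group_presheaf.res (unipotent_sheaf q n L2) U V s" for U V s
      by (simp add: unipotent_sheaf_def)
  qed (rule normal)
qed

subsection \<open>The graded part of a unipotent matrix\<close>

lemma pattern_part_index_outside:
  "a < n \<Longrightarrow> b < n \<Longrightarrow> \<not> S (bl a) (bl b) \<Longrightarrow> pattern_part S M $$ (a, b) = 0"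
  by simp

lemma pattern_part_unipotent_index:
  assumes "X \<in> carrier_mat n n" "a < n" "b < n" "slope_equal t (bl a) (bl b)"
  shows "pattern_part (slope_equal t) (1\<^sub>m n + X) $$ (a, b) = X $$ (a, b)"
  using assms by auto

lemma pattern_part_one_plus:
  assumes X: "X \<in> pmat (slope_equal t)"
  shows "pattern_part (slope_equal t) (1\<^sub>m n + X) = X"
proof (rule eq_matI)
  have c: "X \<in> carrier_mat n n"
    by (rule pattern_mats_carrier[OF X])
  fix a b assume "a < dim_row X" "b < dim_col X"
  then have ab: "a < n" "b < n"
    using c by auto
  show "pattern_part (slope_equal t) (1\<^sub>m n + X) $$ (a, b) = X $$ (a, b)"
  proof (cases "slope_equal t (bl a) (bl b)")
    case True
    then show ?thesis
      by (rule pattern_part_unipotent_index[OF c ab])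
  next
    case False
    then have "X $$ (a, b) = 0"
      using X ab by (simp add: pattern_mats_def)
    then show ?thesis
      using pattern_part_index_outside[of a b "slope_equal t", OF ab False] by (simp del: pattern_part_index)
  qed
qed (use pattern_mats_carrier[OF X] in \<open>auto simp: pattern_part_def\<close>)

text \<open>The product \<open>X Y\<close> of two nilpotent parts has slope at least \<open>t + 1\<close>: the slope \<open>\<mu>\<^sub>i - \<mu>\<^sub>j\<close> is
  additive and at least \<open>1\<close> on each strictly upper triangular block.\<close>

lemma pattern_part_unipotent_mult:
  assumes "M \<in> umat (slope_at_least t)" "N \<in> umat (slope_at_least t)"
  shows "pattern_part (slope_equal t) (M * N) =
    pattern_part (slope_equal t) M + pattern_part (slope_equal t) N"
proof -
  obtain X Y where X: "X \<in> pmat (slope_at_least t)" "M = 1\<^sub>m n + X"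
    and Y: "Y \<in> pmat (slope_at_least t)" "N = 1\<^sub>m n + Y"
    using assms by (auto simp: unipotent_mats_def)
  note c = pattern_mats_carrier[OF X(1)] pattern_mats_carrier[OF Y(1)]
  have XY: "X * Y \<in> pmat (slope_at_least (Suc t))"
    by (rule pattern_mats_mult[OF X(1) Y(1)]) (use mu_decreasing in fastforce)
  have c': "X + Y + X * Y \<in> carrier_mat n n" "X * Y \<in> carrier_mat n n"
    using c pattern_mats_carrier[OF XY] by auto
  show ?thesis
  proof (rule eq_matI)
    fix a b
    assume "a < dim_row (pattern_part (slope_equal t) M + pattern_part (slope_equal t) N)"
      "b < dim_col (pattern_part (slope_equal t) M + pattern_part (slope_equal t) N)"
    then have ab: "a < n" "b < n"
      by (auto simp: pattern_part_def)
    show "pattern_part (slope_equal t) (M * N) $$ (a, b) =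
        (pattern_part (slope_equal t) M + pattern_part (slope_equal t) N) $$ (a, b)"
    proof (cases "slope_equal t (bl a) (bl b)")
      case True
      then have "(X * Y) $$ (a, b) = 0"
        using XY ab unfolding pattern_mats_def mem_Collect_eq by auto
      then have "(X + Y + X * Y) $$ (a, b) = X $$ (a, b) + Y $$ (a, b)"
        using c c' ab carrier_matD[OF c'(2)] by (simp del: index_mult_mat(1))
      moreover have "pattern_part (slope_equal t) (M * N) $$ (a, b) = (X + Y + X * Y) $$ (a, b)"
        unfolding X(2) Y(2) unipotent_product_expand[OF c]
        by (rule pattern_part_unipotent_index[OF c'(1) ab True])
      moreover have "pattern_part (slope_equal t) M $$ (a, b) = X $$ (a, b)"
        "pattern_part (slope_equal t) N $$ (a, b) = Y $$ (a, b)"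
        unfolding X(2) Y(2) by (rule pattern_part_unipotent_index[OF _ ab True], rule c)+
      ultimately show ?thesis
        using ab carrier_matD[OF pattern_part_carrier] by (simp del: pattern_part_index)
    next
      case False
      then have "pattern_part (slope_equal t) X $$ (a, b) = 0" for X
        by (rule pattern_part_index_outside[OF ab])
      then show ?thesis
        using ab carrier_matD[OF pattern_part_carrier] by (simp del: pattern_part_index)
    qed
  qed (auto simp: pattern_part_def)
qed

lemma pattern_part_unipotent_zero_iff:
  assumes M: "M \<in> umat (slope_at_least t)"
  shows "pattern_part (slope_equal t) M = 0\<^sub>m n n \<longleftrightarrow> M \<in> umat (slope_at_least (Suc t))"
proof -
  obtain X where X: "X \<in> pmat (slope_at_least t)" "M = 1\<^sub>m n + X"
    using M by (auto simp: unipotent_mats_def)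
  note c = pattern_mats_carrier[OF X(1)]
  show ?thesis
  proof
    assume zero: "pattern_part (slope_equal t) M = 0\<^sub>m n n"
    have "X \<in> pmat (slope_at_least (Suc t))"
    proof (rule pattern_mats_eqI[OF X(1)])
      fix a b assume ab: "a < n" "b < n"
        and "slope_at_least t (bl a) (bl b)" "\<not> slope_at_least (Suc t) (bl a) (bl b)"
      then have "slope_equal t (bl a) (bl b)"
        by auto
      then have "X $$ (a, b) = pattern_part (slope_equal t) M $$ (a, b)"
        unfolding X(2) by (rule pattern_part_unipotent_index[OF c ab, symmetric])
      then show "X $$ (a, b) = 0"
        using zero ab by simp
    qed
    then show "M \<in> umat (slope_at_least (Suc t))"
      unfolding X(2) by (simp add: unipotent_mats_def)
  next
    assume "M \<in> umat (slope_at_least (Suc t))"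
    then obtain Y where Y: "Y \<in> pmat (slope_at_least (Suc t))" "M = 1\<^sub>m n + Y"
      by (auto simp: unipotent_mats_def)
    show "pattern_part (slope_equal t) M = 0\<^sub>m n n"
    proof (rule eq_matI)
      fix a b assume "a < dim_row (0\<^sub>m n n :: complex mat)" "b < dim_col (0\<^sub>m n n :: complex mat)"
      then have ab: "a < n" "b < n"
        by auto
      show "pattern_part (slope_equal t) M $$ (a, b) = 0\<^sub>m n n $$ (a, b)"
      proof (cases "slope_equal t (bl a) (bl b)")
        case True
        then have "Y $$ (a, b) = 0"
          using Y(1) ab unfolding pattern_mats_def mem_Collect_eq by auto
        then show ?thesis
          using pattern_part_unipotent_index[OF pattern_mats_carrier[OF Y(1)] ab True] ab unfolding Y(2) by simp
      next
        case False
        then show ?thesis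
          using pattern_part_index_outside[of a b "slope_equal t", OF ab False] ab by (simp del: pattern_part_index)
      qed
    qed (auto simp: pattern_part_def)
  qed
qed

lemma solutions_pattern_part:
  assumes F: "F \<in> solutions K V" "K \<subseteq> carrier_mat n n"
  shows "(\<lambda>z\<in>P V. pattern_part S (F z)) \<in> solutions (pmat S) V"
proof (rule solutionsI)
  show "mat_holomorphic_on (\<lambda>z. pattern_part S (F z)) (P V)"
    by (rule mat_holomorphic_on_pattern_part[OF solutionsD(4)[OF F(1)]])
  fix z assume z: "z \<in> P V"
  have "F z \<in> carrier_mat n n" "F (q * z) \<in> carrier_mat n n"
    using solutionsD(2)[OF F(1)] F(2) z by (auto simp: Eq_preimage_mult_q)
  then show "pattern_part S (F (q * z)) * A0 z = A0 z * pattern_part S (F z)"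
    by (rule A0_equation_pattern_part) (rule solutionsD(3)[OF F(1) z])
qed (rule pattern_part_in)

subsection \<open>The graded pieces\<close>

abbreviation Stokes_step where "Stokes_step t \<equiv> Stokes_t_sheaf q k \<mu> r A t"
abbreviation graded_sheaf where "graded_sheaf t \<equiv> lambda_graded_sheaf q k \<mu> r A t"

lemma slope_at_least_left:
  "i \<in> {1..k} \<Longrightarrow> j \<in> {1..k} \<Longrightarrow> i < j \<Longrightarrow> slope_at_least t j l \<Longrightarrow> slope_at_least t i l"
  using mu_decreasing[of i j] by auto

lemma slope_at_least_right:
  "j \<in> {1..k} \<Longrightarrow> l \<in> {1..k} \<Longrightarrow> slope_at_least t i j \<Longrightarrow> j < l \<Longrightarrow> slope_at_least t i l"
  using mu_decreasing[of j l] by auto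

lemma Stokes_step_normal_Stokes:
  "sheaf_of_normal_subgroups (Eq_space q) (Stokes_step t) (Stokes_sheaf q k \<mu> r A)"
  unfolding Stokes_t_sheaf_def Stokes_sheaf_def
proof (rule unipotent_sheaf_normal[OF lambda_t_sections_eq lambda_sections_eq])
  fix i j l assume ijl: "i \<in> {1..k}" "j \<in> {1..k}" "l \<in> {1..k}"
  show "slope_at_least t i l" if "i < j" "slope_at_least t j l"
    by (rule slope_at_least_left[OF ijl(1,2) that])
  show "slope_at_least t i l" if "slope_at_least t i j" "j < l"
    by (rule slope_at_least_right[OF ijl(2,3) that])
qed auto

lemma Stokes_step_normal_Suc:
  "sheaf_of_normal_subgroups (Eq_space q) (Stokes_step (Suc t)) (Stokes_step t)"
  unfolding Stokes_t_sheaf_def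
  by (rule unipotent_sheaf_normal[OF lambda_t_sections_eq lambda_t_sections_eq]) auto

lemma Stokes_step_iso:
  "iso_of_group_sheaves (Eq_space q) (solution_presheaf (umat (slope_at_least t)) (*) (1\<^sub>m n)) (Stokes_step t) full_germ"
  unfolding Stokes_t_sheaf_def by (rule unipotent_sheaf_iso[OF lambda_t_sections_eq]) auto

lemma graded_iso:
  "iso_of_group_sheaves (Eq_space q) (solution_presheaf (pmat (slope_equal t)) (+) (0\<^sub>m n n)) (graded_sheaf t) full_germ"
  unfolding lambda_graded_sheaf_def by (rule additive_sheaf_iso[OF lambda_graded_sections_eq])

lemma Stokes_step_sec:
  assumes V: "openin (Eq_space q) V"
  shows "sec (Stokes_step t) V = \<lparr>carrier = full_germ V ` solutions (umat (slope_at_least t)) V,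
    mult = sgerm_map2 q V (*), one = sgerm_const q V (1\<^sub>m n)\<rparr>"
  by (simp add: Stokes_t_sheaf_def unipotent_sheaf_def lambda_t_sections_eq[OF V] one_plus_image_solutions[OF V])

lemma graded_sec:
  assumes V: "openin (Eq_space q) V"
  shows "sec (graded_sheaf t) V = \<lparr>carrier = full_germ V ` solutions (pmat (slope_equal t)) V,
    mult = sgerm_map2 q V (+), one = sgerm_const q V (0\<^sub>m n n)\<rparr>"
  by (simp add: lambda_graded_sheaf_def additive_sheaf_def lambda_graded_sections_eq[OF V])

lemma one_plus_graded:
  assumes V: "openin (Eq_space q) V" and f: "f \<in> carrier (sec (graded_sheaf t) V)"
  shows "one_plus q n V f \<in> carrier (sec (Stokes_step t) V)"
proof -
  obtain F where F: "F \<in> solutions (pmat (slope_equal t)) V" "f = full_germ V F"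
    using f by (auto simp: graded_sec[OF V])
  have "F \<in> solutions (pmat (slope_at_least t)) V"
    by (rule solutions_change_values[OF F(1)], rule pattern_mats_mono[OF solutionsD(2)[OF F(1)]]) auto
  then have "one_plus q n V f \<in> one_plus q n V ` full_germ V ` solutions (pmat (slope_at_least t)) V"
    using F(2) by blast
  then show ?thesis
    unfolding one_plus_image_solutions[OF V] by (simp add: Stokes_step_sec[OF V])
qed

definition graded_part :: "nat \<Rightarrow> complex set set \<Rightarrow> complex mat sgerm \<Rightarrow> complex mat sgerm" where
  "graded_part t V = sgerm_map q V (\<lambda>z. pattern_part (slope_equal t))"

lemma graded_part_full_germ:
  "openin (Eq_space q) V \<Longrightarrow> graded_part t V (full_germ V F) = full_germ V (\<lambda>z. pattern_part (slope_equal t) (F z))"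
  by (simp add: graded_part_def sgerm_map_sgerm[OF sector_Eq_preimage])

lemma umat_subset_carrier: "umat S \<subseteq> carrier_mat n n"
  using unipotent_mats_carrier by blast

lemma graded_part_hom:
  assumes V: "openin (Eq_space q) V"
  shows "graded_part t V \<in> hom (sec (Stokes_step t) V) (sec (graded_sheaf t) V)"
proof (rule homI)
  note PV = sector_Eq_preimage[OF V]
  fix x assume "x \<in> carrier (sec (Stokes_step t) V)"
  then obtain F where F: "F \<in> solutions (umat (slope_at_least t)) V" "x = full_germ V F"
    by (auto simp: Stokes_step_sec[OF V])
  have "graded_part t V x = full_germ V (\<lambda>z\<in>P V. pattern_part (slope_equal t) (F z))"
    by (simp add: F(2) graded_part_full_germ[OF V] full_germ_restrict[OF V])
  then show "graded_part t V x \<in> carrier (sec (graded_sheaf t) V)"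
    using solutions_pattern_part[OF F(1) umat_subset_carrier] by (simp add: graded_sec[OF V])
  fix y assume "y \<in> carrier (sec (Stokes_step t) V)"
  then obtain G where G: "G \<in> solutions (umat (slope_at_least t)) V" "y = full_germ V G"
    by (auto simp: Stokes_step_sec[OF V])
  have "full_germ V (\<lambda>z. pattern_part (slope_equal t) (F z * G z)) =
      full_germ V (\<lambda>z. pattern_part (slope_equal t) (F z) + pattern_part (slope_equal t) (G z))"
    by (rule sgerm_eqI[OF PV PV PV])
      (use pattern_part_unipotent_mult[OF solutionsD(2)[OF F(1)] solutionsD(2)[OF G(1)]] in auto)
  then show "graded_part t V (x \<otimes>\<^bsub>sec (Stokes_step t) V\<^esub> y) =
      graded_part t V x \<otimes>\<^bsub>sec (graded_sheaf t) V\<^esub> graded_part t V y"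
    by (simp add: F(2) G(2) Stokes_step_sec[OF V] graded_sec[OF V] graded_part_full_germ[OF V]
        sgerm_map2_sgerm[OF PV PV])
qed

text \<open>A graded part whose germ is \<open>0\<close> vanishes on a sector, hence everywhere, being a solution itself.\<close>

lemma kernel_graded_part:
  assumes V: "openin (Eq_space q) V"
  shows "kernel (sec (Stokes_step t) V) (sec (graded_sheaf t) V) (graded_part t V) =
    carrier (sec (Stokes_step (Suc t)) V)"
proof -
  note PV = sector_Eq_preimage[OF V]
  have iff: "graded_part t V (full_germ V F) = sgerm_const q V (0\<^sub>m n n) \<longleftrightarrow> F \<in> solutions (umat (slope_at_least (Suc t))) V"
    if F: "F \<in> solutions (umat (slope_at_least t)) V" for F
    unfolding graded_part_full_germ[OF V] sgerm_const_def
  proof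
    assume "full_germ V (\<lambda>z. pattern_part (slope_equal t) (F z)) = full_germ V (\<lambda>z. 0\<^sub>m n n)"
    with PV PV obtain W where W: "sector q W V" "W \<subseteq> P V \<inter> P V"
      "\<And>z. z \<in> W \<Longrightarrow> pattern_part (slope_equal t) (F z) = 0\<^sub>m n n"
      by (rule sgerm_eqD) blast
    have zero: "(\<lambda>z\<in>P V. 0\<^sub>m n n) \<in> solutions (pmat (slope_equal t)) V"
      by (intro solutionsI pattern_mats_zero A0_equation_zero mat_holomorphic_on_const)
    have eq: "(\<lambda>z\<in>P V. pattern_part (slope_equal t) (F z)) = (\<lambda>z\<in>P V. 0\<^sub>m n n)"
    proof (rule solutions_eqI[OF solutions_pattern_part[OF F umat_subset_carrier] zero _ W(1)])
      show "pmat (slope_equal t) \<subseteq> carrier_mat n n"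
        using pattern_mats_carrier by blast
      show "(\<lambda>z\<in>P V. pattern_part (slope_equal t) (F z)) w = (\<lambda>z\<in>P V. 0\<^sub>m n n) w" if "w \<in> W" for w
        using W(2,3) that by auto
    qed
    have "pattern_part (slope_equal t) (F z) = 0\<^sub>m n n" if "z \<in> P V" for z
      using fun_cong[OF eq, of z] that by simp
    then show "F \<in> solutions (umat (slope_at_least (Suc t))) V"
      using pattern_part_unipotent_zero_iff[OF solutionsD(2)[OF F]] by (intro solutions_change_values[OF F]) blast
  next
    assume F': "F \<in> solutions (umat (slope_at_least (Suc t))) V"
    show "full_germ V (\<lambda>z. pattern_part (slope_equal t) (F z)) = full_germ V (\<lambda>z. 0\<^sub>m n n)"
      by (rule sgerm_eqI[OF PV PV PV])
        (use pattern_part_unipotent_zero_iff[OF solutionsD(2)[OF F]] solutionsD(2)[OF F'] in auto)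
  qed
  have sub: "F \<in> solutions (umat (slope_at_least t)) V" if F: "F \<in> solutions (umat (slope_at_least (Suc t))) V" for F
    by (rule solutions_change_values[OF F], rule unipotent_mats_mono[OF solutionsD(2)[OF F]]) auto
  show ?thesis
    unfolding kernel_def Stokes_step_sec[OF V] graded_sec[OF V] using iff sub by auto
qed

lemma graded_part_one_plus:
  assumes V: "openin (Eq_space q) V" and f: "f \<in> carrier (sec (graded_sheaf t) V)"
  shows "graded_part t V (one_plus q n V f) = f"
proof -
  note PV = sector_Eq_preimage[OF V]
  obtain F where F: "F \<in> solutions (pmat (slope_equal t)) V" "f = full_germ V F"
    using f by (auto simp: graded_sec[OF V])
  show ?thesis
    unfolding F(2) one_plus_full_germ[OF V] graded_part_full_germ[OF V]
    by (rule sgerm_eqI[OF PV PV PV]) (use pattern_part_one_plus[OF solutionsD(2)[OF F(1)]] in auto)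
qed

lemma one_plus_res:
  assumes U: "openin (Eq_space q) U" and V: "openin (Eq_space q) V" "V \<subseteq> U"
    and f: "f \<in> carrier (sec (graded_sheaf t) U)"
  shows "sgerm_res q U V (one_plus q n U f) = one_plus q n V (sgerm_res q U V f)"
proof -
  note PU = sector_Eq_preimage[OF U]
  obtain F where F: "f = full_germ U F"
    using f by (auto simp: graded_sec[OF U])
  show ?thesis
    unfolding F one_plus_full_germ[OF U] sgerm_res_sgerm[OF PU V]
    by (simp add: one_plus_def sgerm_map_sgerm[OF sector_restrict[OF PU V]])
qed

text \<open>The first isomorphism theorem for the graded part, over each open set.\<close>

theorem graded_quotient_presheaf_iso:
  "iso_of_group_sheaves (Eq_space q) (graded_sheaf t) (quotient_presheaf (Stokes_step t) (Stokes_step (Suc t)))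
    (\<lambda>V f. carrier (sec (Stokes_step (Suc t)) V) #>\<^bsub>sec (Stokes_step t) V\<^esub> one_plus q n V f)"
proof -
  interpret Gr: sheaf_of_groups "Eq_space q" "graded_sheaf t"
    using graded_iso by (simp add: iso_of_group_sheaves_def)
  interpret St: sheaf_of_groups "Eq_space q" "Stokes_step t"
    using Stokes_step_iso by (simp add: iso_of_group_sheaves_def)
  have normal: "carrier (sec (Stokes_step (Suc t)) V) \<lhd> sec (Stokes_step t) V" if "openin (Eq_space q) V" for V
    using Stokes_step_normal_Suc that by (simp add: sheaf_of_normal_subgroups_def)
  let ?\<phi> = "\<lambda>V f. carrier (sec (Stokes_step (Suc t)) V) #>\<^bsub>sec (Stokes_step t) V\<^esub> one_plus q n V f"
  have iso: "?\<phi> V \<in> iso (sec (graded_sheaf t) V) (sec (Stokes_step t) V Mod carrier (sec (Stokes_step (Suc t)) V))"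
    if V: "openin (Eq_space q) V" for V
    using section_coset_iso[OF St.group_sec[OF V] Gr.group_sec[OF V] graded_part_hom[OF V]
        one_plus_graded[OF V] graded_part_one_plus[OF V]]
    unfolding kernel_graded_part[OF V] .
  show ?thesis
  proof (rule iso_of_group_sheavesI)
    show "sheaf_of_groups (Eq_space q) (graded_sheaf t)" ..
  next
    fix V assume V: "openin (Eq_space q) V"
    have sec: "sec (quotient_presheaf (Stokes_step t) (Stokes_step (Suc t))) V =
        sec (Stokes_step t) V Mod carrier (sec (Stokes_step (Suc t)) V)"
      by (simp add: quotient_presheaf_def)
    show "bij_betw (?\<phi> V) (carrier (sec (graded_sheaf t) V))
        (carrier (sec (quotient_presheaf (Stokes_step t) (Stokes_step (Suc t))) V))"
      using iso[OF V] by (simp add: sec iso_def)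
    show "?\<phi> V (a \<otimes>\<^bsub>sec (graded_sheaf t) V\<^esub> b) =
        ?\<phi> V a \<otimes>\<^bsub>sec (quotient_presheaf (Stokes_step t) (Stokes_step (Suc t))) V\<^esub> ?\<phi> V b"
      if "a \<in> carrier (sec (graded_sheaf t) V)" "b \<in> carrier (sec (graded_sheaf t) V)" for a b
      using iso[OF V] that unfolding sec iso_def hom_def by blast
    have hom: "?\<phi> V \<in> hom (sec (graded_sheaf t) V) (sec (Stokes_step t) V Mod carrier (sec (Stokes_step (Suc t)) V))"
      using iso[OF V] by (simp add: iso_def)
    show "?\<phi> V \<one>\<^bsub>sec (graded_sheaf t) V\<^esub> = \<one>\<^bsub>sec (quotient_presheaf (Stokes_step t) (Stokes_step (Suc t))) V\<^esub>"
      unfolding sec by (rule hom_one[OF hom Gr.group_sec[OF V] normal.factorgroup_is_group[OF normal[OF V]]])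
  next
    fix U V f
    assume U: "openin (Eq_space q) U" and V: "openin (Eq_space q) V" "V \<subseteq> U"
      and f: "f \<in> carrier (sec (graded_sheaf t) U)"
    let ?\<rho> = "group_presheaf.res (Stokes_step t) U V"
    have res: "group_presheaf.res (Stokes_step t') U V = sgerm_res q U V"
      "group_presheaf.res (graded_sheaf t) U V = sgerm_res q U V" for t'
      by (simp_all add: Stokes_t_sheaf_def unipotent_sheaf_def lambda_graded_sheaf_def additive_sheaf_def)
    interpret group_hom "sec (Stokes_step t) U" "sec (Stokes_step t) V" ?\<rho>
      using St.group_sec[OF U] St.group_sec[OF V(1)] St.res_hom[OF U V]
      by (simp add: group_hom_def group_hom_axioms_def)
    have "?\<rho> ` carrier (sec (Stokes_step (Suc t)) U) \<subseteq> carrier (sec (Stokes_step (Suc t)) V)"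
    proof -
      interpret Su: sheaf_of_groups "Eq_space q" "Stokes_step (Suc t)"
        using Stokes_step_iso by (simp add: iso_of_group_sheaves_def)
      show ?thesis
        using Su.res_closed[OF U V] unfolding res by blast
    qed
    then have "carrier (sec (Stokes_step (Suc t)) V) <#>\<^bsub>sec (Stokes_step t) V\<^esub>
        ?\<rho> ` (carrier (sec (Stokes_step (Suc t)) U) #>\<^bsub>sec (Stokes_step t) U\<^esub> one_plus q n U f) =
        carrier (sec (Stokes_step (Suc t)) V) #>\<^bsub>sec (Stokes_step t) V\<^esub> ?\<rho> (one_plus q n U f)"
      by (rule subgroup_set_mult_image_coset[OF normal_imp_subgroup[OF normal[OF V(1)]]
            normal_imp_subgroup[OF normal[OF U]] _ one_plus_graded[OF U f]])
    then show "group_presheaf.res (quotient_presheaf (Stokes_step t) (Stokes_step (Suc t))) U V (?\<phi> U f) =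
        ?\<phi> V (group_presheaf.res (graded_sheaf t) U V f)"
      by (simp add: quotient_presheaf_def res one_plus_res[OF U V f])
  qed
qed

end

theorem proposition4p2:
  fixes q :: complex and k t :: nat
    and \<mu> :: "nat \<Rightarrow> int" and r :: "nat \<Rightarrow> nat" and A :: "nat \<Rightarrow> complex mat"
  assumes "1 < cmod q" and "1 \<le> k"
    and "\<And>i j. 1 \<le> i \<Longrightarrow> i < j \<Longrightarrow> j \<le> k \<Longrightarrow> \<mu> i > \<mu> j"
    and "\<And>i. i \<in> {1..k} \<Longrightarrow> 1 \<le> r i"
    and "\<And>i. i \<in> {1..k} \<Longrightarrow> A i \<in> carrier_mat (r i) (r i) \<and> invertible_mat (A i)"
  shows
    "sheaf_of_normal_subgroups (Eq_space q)
       (Stokes_t_sheaf q k \<mu> r A t) (Stokes_sheaf q k \<mu> r A) \<and>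
     sheaf_of_normal_subgroups (Eq_space q)
       (Stokes_t_sheaf q k \<mu> r A (Suc t)) (Stokes_t_sheaf q k \<mu> r A t) \<and>
     (\<forall>V. openin (Eq_space q) V \<longrightarrow>
        one_plus q (total_rank k r) V ` carrier (sec (lambda_graded_sheaf q k \<mu> r A t) V)
          \<subseteq> carrier (sec (Stokes_t_sheaf q k \<mu> r A t) V)) \<and>
     iso_of_group_sheaves (Eq_space q)
       (lambda_graded_sheaf q k \<mu> r A t)
       (quotient_sheaf (Eq_space q) (Stokes_t_sheaf q k \<mu> r A t) (Stokes_t_sheaf q k \<mu> r A (Suc t)))
       (\<lambda>V f. quotient_proj (Eq_space q)
          (Stokes_t_sheaf q k \<mu> r A t) (Stokes_t_sheaf q k \<mu> r A (Suc t)) V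
          (one_plus q (total_rank k r) V f))"
proof -
  interpret stokes_data q k r \<mu> A
    by unfold_locales (use assms in auto)
  let ?Q = "quotient_presheaf (Stokes_step t) (Stokes_step (Suc t))"
  have "sheaf_of_groups (Eq_space q) ?Q"
    using graded_quotient_presheaf_iso by (simp add: iso_of_group_sheaves_def)
  then have "iso_of_group_sheaves (Eq_space q) ?Q (sheafify (Eq_space q) ?Q) (sheafify_unit (Eq_space q) ?Q)"
    by (rule sheaf_of_groups.sheafify_unit_iso)
  from iso_of_group_sheaves_trans[OF graded_quotient_presheaf_iso this]
  have "iso_of_group_sheaves (Eq_space q) (graded_sheaf t)
      (quotient_sheaf (Eq_space q) (Stokes_step t) (Stokes_step (Suc t)))
      (\<lambda>V f. quotient_proj (Eq_space q) (Stokes_step t) (Stokes_step (Suc t)) V (one_plus q n V f))"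
    by (simp only: quotient_sheaf_def quotient_proj_def)
  then show ?thesis
    using Stokes_step_normal_Stokes Stokes_step_normal_Suc one_plus_graded by blast
qed

end
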